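(* Let $\Sigma$ be a connected finite dimensional simplicial complex with combinatorial weight $m\equiv1$, assumed locally summable (equivalently, every $\tau\in\Sigma$ has only finitely many cofaces), and for each $\circ\in\{+,-,H\}$ let $\Delta^\circ$ be a Laplacian. Then, for every $\circ\in\{+,-,H\}$: (a) $\Delta^\circ$ is bounded if and only if $\deg$ is bounded. (b) $F^c\subseteq D(\Delta^\circ)$. (c) If the Forman curvature $c^H$ is bounded from below, then $\Delta^\circ_c$ is essentially self-adjoint. (d) If $(\Sigma_0,\rho)$ is a complete metric space, then $\Delta^\circ_c$ is essentially self-adjoint.
   Context: Simplicial complex: $V$ is a countable set and $\hat\Sigma$ is a collection of finite subsets of $V$ closed under taking subsets. $\dim\tau=|\tau|-1$, $\hat\Sigma_k=\{\tau\in\hat\Sigma:\dim\tau=k\}$; finite dimensional means $\sup_\tau\dim\tau<\infty$. With weight $m\equiv1$ put $\Sigma=\hat\Sigma$ if $\sum_{v\in\hat\Sigma_0}m(v)<\infty$ (i.e. $V$-vertex set finite), and $\Sigma=\hat\Sigma\setminus\{\varnothing\}$ otherwise; $\Sigma_k=\hat\Sigma_k\cap\Sigma$, and $\Sigma_0$ is identified with the vertex set. For $\tau,\sigma\in\Sigma$, $\tau\prec\sigma$ (equivalently $\sigma\succ\tau$) means $\tau\subset\sigma$ and $|\sigma\setminus\tau|=1$; $\sigma$ is then a coface of $\tau$. All sums are over elements of $\Sigma$. Locally summable means $\sum_{\sigma\succ\tau}m(\sigma)<\infty$ for all $\tau\in\Sigma$. For vertices, $v\sim w$ means $v\neq w$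 and $\{v,w\}\in\Sigma_1$; $\Sigma$ is connected if the graph $(\Sigma_0,\sim)$ is connected. Functions: $F=\mathbb{R}^{\Sigma}$; $F^c$ is the subspace of finitely supported functions; $F^1=\{\omega\in F:\sum_{\sigma\succ\tau}m(\sigma)|\omega(\sigma)|<\infty\text{ for all }\tau\in\Sigma\}$. Coboundary operator: a linear map $\delta:F\to F$ with $\delta\delta=0$ such that $\theta(\tau,\sigma):=\delta 1_\tau(\sigma)\in\{-1,0,1\}$, $\theta(\tau,\sigma)\neq0$ iff $\tau\prec\sigma$, and $\delta\omega(\sigma)=\sum_{\tau\prec\sigma}\omega(\tau)\theta(\tau,\sigma)$. Boundary operator: $\partial:F^1\to F$, $\partial\omega(\rho)=\frac1{m(\rho)}\sum_{\tau\succ\rho}m(\tau)\omega(\tau)\theta(\rho,\tau)$ (here $m\equiv1$). Forms and Laplacians: $\|\omega\|^2=\sum_\Sigma m\omega^2$, $\ell^2=\{\omega\in F:\|\omega\|<\infty\}$. Put $\mathcal Q^+(\omega)=\|\delta\omega\|^2$ for $\omega\in F$, and $\mathcal Q^-(\omega)=\|\partial\omega\|^2$, $\mathcal Q^H(\omega)=\|\delta\omega+\partial\omega\|^2$ for $\omega\in F^1$. $Q^\circ_N$ is the restriction of $\mathcal Q^\circ$ to $D(Q^\circ_N)=\{\omega\in\ell^2:\mathcal Q^\circ(\omega)<\infty\}$, and $Q^\circ_D$ its restriction to the closure of $F^c$ in $D(Q_N^\circ)$ with respect to $(\mathcal Q^\circ(\cdot)+\|\cdot\|^2)^{1/2}$.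 For forms, $Q\subseteq Q'$ means $D(Q)\subseteq D(Q')$ and $Q=Q'$ on $D(Q)$. A Laplacian $\Delta^\circ$ is the positive self-adjoint operator on $\ell^2$ associated to a closed form $Q^\circ$ with $Q^\circ_D\subseteq Q^\circ\subseteq Q^\circ_N$. $\Delta^\circ_c$ is the restriction of $\Delta^\circ$ to $F^c$, acting as $\partial\delta$, $\delta\partial$, $(\delta+\partial)^2=\partial\delta+\delta\partial$ for $\circ=+,-,H$. Further notation: $\deg(v)=\#\{e\in\Sigma_1:e\succ v\}$ for $v\in\Sigma_0$. Degree path metric: $\rho(v,w)=\inf_{v=v_0\sim\dots\sim v_n=w}\sum_{k=1}^n\max\{\deg(v_k),\deg(v_{k-1})\}^{-1/2}$ (with $\rho(v,v)=0$). Forman curvature (for $m\equiv1$): $$c^H(\tau)=\#\{\rho\prec\tau\}+\#\{\sigma\succ\tau\}-\sum_{\rho\prec\tau}\sum_{\tau'\succ\rho,\tau'\ne\tau}\big|1-\#\{\sigma:\tau,\tau'\prec\sigma\}\big|.$$ *)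

theory Defs
  imports "HOL-Analysis.Analysis" "HOL-Library.Function_Algebras"
begin

subsection \<open>Simplicial complexes with weight 1\<close>

definition sdim :: "'v set \<Rightarrow> int" where
  "sdim \<tau> = int (card \<tau>) - 1"

definition abstract_simplicial_complex :: "'v set \<Rightarrow> 'v set set \<Rightarrow> bool" where
  "abstract_simplicial_complex V K \<longleftrightarrow>
     countable V \<and> (\<forall>\<tau>\<in>K. finite \<tau> \<and> \<tau> \<subseteq> V) \<and> (\<forall>\<tau>\<in>K. \<forall>\<rho>. \<rho> \<subseteq> \<tau> \<longrightarrow> \<rho> \<in> K)"

definition finite_dimensional :: "'v set set \<Rightarrow> bool" where
  "finite_dimensional K \<longleftrightarrow> bdd_above (sdim ` K)"

text \<open>The set \<open>\<Sigma>\<close> of simplices that carry functions: the empty simplex is kept only if the total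
  weight of the vertices is finite, i.e. (weight 1) if there are finitely many vertices.\<close>

definition simplices :: "'v set set \<Rightarrow> 'v set set" where
  "simplices K = (if finite {\<tau>\<in>K. sdim \<tau> = 0} then K else K - {{}})"

text \<open>From here on the parameter \<open>S\<close> stands for \<open>\<Sigma>\<close>.\<close>

definition ksimplices :: "'v set set \<Rightarrow> int \<Rightarrow> 'v set set" where
  "ksimplices S k = {\<tau>\<in>S. sdim \<tau> = k}"

definition vertices :: "'v set set \<Rightarrow> 'v set" where
  "vertices S = {v. {v} \<in> ksimplices S 0}"

definition covered :: "'v set \<Rightarrow> 'v set \<Rightarrow> bool" (infix \<open>\<lessdot>\<close> 50) where
  "\<tau> \<lessdot> \<sigma> \<longleftrightarrow> \<tau> \<subseteq> \<sigma> \<and> card (\<sigma> - \<tau>) = 1"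

definition faces :: "'v set set \<Rightarrow> 'v set \<Rightarrow> 'v set set" where
  "faces S \<sigma> = {\<tau>\<in>S. \<tau> \<lessdot> \<sigma>}"

definition cofaces :: "'v set set \<Rightarrow> 'v set \<Rightarrow> 'v set set" where
  "cofaces S \<tau> = {\<sigma>\<in>S. \<tau> \<lessdot> \<sigma>}"

text \<open>For weight 1 the sum \<open>\<Sum>\<sigma>\<succ>\<tau>. m \<sigma>\<close> is the number of cofaces of \<open>\<tau>\<close>.\<close>

definition locally_summable :: "'v set set \<Rightarrow> bool" where
  "locally_summable S \<longleftrightarrow> (\<forall>\<tau>\<in>S. finite (cofaces S \<tau>))"

definition adj :: "'v set set \<Rightarrow> 'v \<Rightarrow> 'v \<Rightarrow> bool" where
  "adj S v w \<longleftrightarrow> v \<noteq> w \<and> {v, w} \<in> ksimplices S 1"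

definition connected_complex :: "'v set set \<Rightarrow> bool" where
  "connected_complex S \<longleftrightarrow> (\<forall>v\<in>vertices S. \<forall>w\<in>vertices S. (adj S)\<^sup>*\<^sup>* v w)"

definition deg :: "'v set set \<Rightarrow> 'v \<Rightarrow> nat" where
  "deg S v = card {e \<in> ksimplices S 1. {v} \<lessdot> e}"

definition path_lengths :: "'v set set \<Rightarrow> 'v \<Rightarrow> 'v \<Rightarrow> real set" where
  "path_lengths S v w =
     {(\<Sum>k=1..n. real (max (deg S (p k)) (deg S (p (k - 1)))) powr (-1/2)) | (n::nat) p.
        p 0 = v \<and> p n = w \<and> (\<forall>k\<in>{1..n}. adj S (p (k - 1)) (p k))}"

text \<open>The value 0 is a default for points that are not joined by a path; in a connected complex
  this does not concern pairs of vertices. It is needed because \<^const>\<open>Metric_space\<close> demands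
  nonnegativity and symmetry also outside the carrier.\<close>

definition deg_dist :: "'v set set \<Rightarrow> 'v \<Rightarrow> 'v \<Rightarrow> real" where
  "deg_dist S v w = (if path_lengths S v w = {} then 0 else Inf (path_lengths S v w))"

definition forman :: "'v set set \<Rightarrow> 'v set \<Rightarrow> int" where
  "forman S \<tau> = int (card (faces S \<tau>)) + int (card (cofaces S \<tau>))
     - (\<Sum>\<rho>\<in>faces S \<tau>. \<Sum>\<tau>'\<in>cofaces S \<rho> - {\<tau>}. \<bar>1 - int (card {\<sigma>\<in>S. \<tau> \<lessdot> \<sigma> \<and> \<tau>' \<lessdot> \<sigma>})\<bar>)"


subsection \<open>Cochains, coboundary and boundary\<close>

text \<open>\<open>F = \<real>\<^sup>\<Sigma>\<close> is modelled by the functions on all sets of vertices that vanish off \<open>\<Sigma>\<close>.\<close>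

definition cochains :: "'v set set \<Rightarrow> ('v set \<Rightarrow> real) set" where
  "cochains S = {\<omega>. \<forall>\<tau>. \<tau> \<notin> S \<longrightarrow> \<omega> \<tau> = 0}"

definition fin_cochains :: "'v set set \<Rightarrow> ('v set \<Rightarrow> real) set" where
  "fin_cochains S = {\<omega>\<in>cochains S. finite {\<tau>. \<omega> \<tau> \<noteq> 0}}"

definition cochains1 :: "'v set set \<Rightarrow> ('v set \<Rightarrow> real) set" where
  "cochains1 S = {\<omega>\<in>cochains S. \<forall>\<tau>\<in>S. (\<lambda>\<sigma>. \<bar>\<omega> \<sigma>\<bar>) summable_on cofaces S \<tau>}"

definition theta :: "(('v set \<Rightarrow> real) \<Rightarrow> 'v set \<Rightarrow> real) \<Rightarrow> 'v set \<Rightarrow> 'v set \<Rightarrow> real" where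
  "theta \<delta> \<tau> \<sigma> = \<delta> (indicat_real {\<tau>}) \<sigma>"

definition coboundary :: "'v set set \<Rightarrow> (('v set \<Rightarrow> real) \<Rightarrow> 'v set \<Rightarrow> real) \<Rightarrow> bool" where
  "coboundary S \<delta> \<longleftrightarrow>
     (\<forall>\<omega>\<in>cochains S. \<delta> \<omega> \<in> cochains S) \<and>
     (\<forall>\<omega>\<in>cochains S. \<forall>\<eta>\<in>cochains S. \<delta> (\<omega> + \<eta>) = \<delta> \<omega> + \<delta> \<eta>) \<and>
     (\<forall>\<omega>\<in>cochains S. \<forall>a. \<delta> (\<lambda>\<tau>. a * \<omega> \<tau>) = (\<lambda>\<sigma>. a * \<delta> \<omega> \<sigma>)) \<and>
     (\<forall>\<omega>\<in>cochains S. \<delta> (\<delta> \<omega>) = 0) \<and>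
     (\<forall>\<tau>\<in>S. \<forall>\<sigma>\<in>S. theta \<delta> \<tau> \<sigma> \<in> {-1, 0, 1} \<and> (theta \<delta> \<tau> \<sigma> \<noteq> 0 \<longleftrightarrow> \<tau> \<lessdot> \<sigma>)) \<and>
     (\<forall>\<omega>\<in>cochains S. \<forall>\<sigma>\<in>S. \<delta> \<omega> \<sigma> = (\<Sum>\<tau>\<in>faces S \<sigma>. \<omega> \<tau> * theta \<delta> \<tau> \<sigma>))"

definition boundary ::
  "'v set set \<Rightarrow> (('v set \<Rightarrow> real) \<Rightarrow> 'v set \<Rightarrow> real) \<Rightarrow> ('v set \<Rightarrow> real) \<Rightarrow> 'v set \<Rightarrow> real" where
  "boundary S \<delta> \<omega> =
     (\<lambda>\<rho>. if \<rho> \<in> S then \<Sum>\<^sub>\<infinity>\<tau>\<in>cofaces S \<rho>. \<omega> \<tau> * theta \<delta> \<rho> \<tau> else 0)"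


subsection \<open>The Hilbert space \<open>\<ell>\<^sup>2(\<Sigma>)\<close> and unbounded operators on it\<close>

definition l2 :: "'v set set \<Rightarrow> ('v set \<Rightarrow> real) set" where
  "l2 S = {\<omega>\<in>cochains S. (\<lambda>\<tau>. (\<omega> \<tau>)\<^sup>2) summable_on S}"

definition l2_inner :: "'v set set \<Rightarrow> ('v set \<Rightarrow> real) \<Rightarrow> ('v set \<Rightarrow> real) \<Rightarrow> real" where
  "l2_inner S \<omega> \<eta> = (\<Sum>\<^sub>\<infinity>\<tau>\<in>S. \<omega> \<tau> * \<eta> \<tau>)"

definition l2_norm :: "'v set set \<Rightarrow> ('v set \<Rightarrow> real) \<Rightarrow> real" where
  "l2_norm S \<omega> = sqrt (\<Sum>\<^sub>\<infinity>\<tau>\<in>S. (\<omega> \<tau>)\<^sup>2)"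

text \<open>An operator \<open>A\<close> on \<open>\<ell>\<^sup>2\<close> is represented by its graph \<open>{(f, A f) | f \<in> D(A)}\<close>, so that
  \<open>D(A)\<close> is \<^term>\<open>Domain A\<close>.\<close>

type_synonym 'v l2_op = "(('v set \<Rightarrow> real) \<times> ('v set \<Rightarrow> real)) set"

definition bounded_op :: "'v set set \<Rightarrow> 'v l2_op \<Rightarrow> bool" where
  "bounded_op S A \<longleftrightarrow> (\<exists>C. \<forall>(f, g)\<in>A. l2_norm S g \<le> C * l2_norm S f)"

definition densely_defined :: "'v set set \<Rightarrow> 'v l2_op \<Rightarrow> bool" where
  "densely_defined S A \<longleftrightarrow> (\<forall>f\<in>l2 S. \<forall>e>0. \<exists>u\<in>Domain A. l2_norm S (f - u) < e)"

definition op_adjoint :: "'v set set \<Rightarrow> 'v l2_op \<Rightarrow> 'v l2_op" where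
  "op_adjoint S A =
     {(f, g). f \<in> l2 S \<and> g \<in> l2 S \<and> (\<forall>(u, v)\<in>A. l2_inner S v f = l2_inner S u g)}"

definition op_closure :: "'v set set \<Rightarrow> 'v l2_op \<Rightarrow> 'v l2_op" where
  "op_closure S A =
     {(f, g). f \<in> l2 S \<and> g \<in> l2 S \<and>
        (\<exists>u v. (\<forall>n::nat. (u n, v n) \<in> A) \<and>
           (\<lambda>n. l2_norm S (u n - f)) \<longlonglongrightarrow> 0 \<and> (\<lambda>n. l2_norm S (v n - g)) \<longlonglongrightarrow> 0)}"

text \<open>Density of the domain makes the adjoint single-valued, hence a self-adjoint \<open>A\<close> is a genuine
  (linear) operator and not merely a relation.\<close>

definition self_adjoint :: "'v set set \<Rightarrow> 'v l2_op \<Rightarrow> bool" where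
  "self_adjoint S A \<longleftrightarrow> densely_defined S A \<and> A = op_adjoint S A"

definition essentially_self_adjoint :: "'v set set \<Rightarrow> 'v l2_op \<Rightarrow> bool" where
  "essentially_self_adjoint S A \<longleftrightarrow> self_adjoint S (op_closure S A)"


subsection \<open>Quadratic forms and Laplacians\<close>

text \<open>A form is a pair of its domain and its values; values outside the domain are irrelevant.\<close>

type_synonym 'v form = "('v set \<Rightarrow> real) set \<times> (('v set \<Rightarrow> real) \<Rightarrow> real)"

definition form_sub :: "'v form \<Rightarrow> 'v form \<Rightarrow> bool" where
  "form_sub Q Q' \<longleftrightarrow> fst Q \<subseteq> fst Q' \<and> (\<forall>f\<in>fst Q. snd Q f = snd Q' f)"

definition nonneg_quadratic_form :: "'v set set \<Rightarrow> 'v form \<Rightarrow> bool" where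
  "nonneg_quadratic_form S Q \<longleftrightarrow>
     fst Q \<subseteq> l2 S \<and> 0 \<in> fst Q \<and>
     (\<forall>f\<in>fst Q. \<forall>g\<in>fst Q. f + g \<in> fst Q) \<and> (\<forall>f\<in>fst Q. \<forall>a. (\<lambda>\<tau>. a * f \<tau>) \<in> fst Q) \<and>
     (\<forall>f\<in>fst Q. 0 \<le> snd Q f) \<and>
     (\<forall>f\<in>fst Q. \<forall>a. snd Q (\<lambda>\<tau>. a * f \<tau>) = a\<^sup>2 * snd Q f) \<and>
     (\<forall>f\<in>fst Q. \<forall>g\<in>fst Q. snd Q (f + g) + snd Q (f - g) = 2 * snd Q f + 2 * snd Q g)"

definition form_norm :: "'v set set \<Rightarrow> 'v form \<Rightarrow> ('v set \<Rightarrow> real) \<Rightarrow> real" where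
  "form_norm S Q f = sqrt (snd Q f + (l2_norm S f)\<^sup>2)"

definition form_polar :: "'v form \<Rightarrow> ('v set \<Rightarrow> real) \<Rightarrow> ('v set \<Rightarrow> real) \<Rightarrow> real" where
  "form_polar Q f g = (snd Q (f + g) - snd Q (f - g)) / 4"

definition closed_form :: "'v set set \<Rightarrow> 'v form \<Rightarrow> bool" where
  "closed_form S Q \<longleftrightarrow> nonneg_quadratic_form S Q \<and>
     (\<forall>u. (\<forall>n::nat. u n \<in> fst Q) \<and>
          (\<forall>e>0. \<exists>N. \<forall>m\<ge>N. \<forall>n\<ge>N. form_norm S Q (u m - u n) < e)
        \<longrightarrow> (\<exists>f\<in>fst Q. (\<lambda>n. form_norm S Q (u n - f)) \<longlonglongrightarrow> 0))"

text \<open>The operator associated with a form by the first representation theorem.\<close>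

definition form_operator :: "'v set set \<Rightarrow> 'v form \<Rightarrow> 'v l2_op" where
  "form_operator S Q =
     {(f, g). f \<in> fst Q \<and> g \<in> l2 S \<and> (\<forall>h\<in>fst Q. form_polar Q f h = l2_inner S g h)}"

text \<open>The three cases \<open>+\<close>, \<open>-\<close>, \<open>H\<close>.\<close>

datatype lap_kind = Plus | Minus | Hodge

fun energy_dom :: "'v set set \<Rightarrow> lap_kind \<Rightarrow> ('v set \<Rightarrow> real) set" where
  "energy_dom S Plus = cochains S"
| "energy_dom S Minus = cochains1 S"
| "energy_dom S Hodge = cochains1 S"

fun energy_op ::
  "'v set set \<Rightarrow> (('v set \<Rightarrow> real) \<Rightarrow> 'v set \<Rightarrow> real) \<Rightarrow> lap_kind \<Rightarrow>
     ('v set \<Rightarrow> real) \<Rightarrow> 'v set \<Rightarrow> real" where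
  "energy_op S \<delta> Plus \<omega> = \<delta> \<omega>"
| "energy_op S \<delta> Minus \<omega> = boundary S \<delta> \<omega>"
| "energy_op S \<delta> Hodge \<omega> = \<delta> \<omega> + boundary S \<delta> \<omega>"

text \<open>The energy is the squared norm of \<^term>\<open>energy_op S \<delta> k \<omega>\<close>; it is finite iff that cochain is
  square summable.\<close>

definition neumann_form ::
  "'v set set \<Rightarrow> (('v set \<Rightarrow> real) \<Rightarrow> 'v set \<Rightarrow> real) \<Rightarrow> lap_kind \<Rightarrow> 'v form" where
  "neumann_form S \<delta> k =
     ({\<omega> \<in> l2 S \<inter> energy_dom S k. energy_op S \<delta> k \<omega> \<in> l2 S},
      \<lambda>\<omega>. (l2_norm S (energy_op S \<delta> k \<omega>))\<^sup>2)"

definition dirichlet_form ::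
  "'v set set \<Rightarrow> (('v set \<Rightarrow> real) \<Rightarrow> 'v set \<Rightarrow> real) \<Rightarrow> lap_kind \<Rightarrow> 'v form" where
  "dirichlet_form S \<delta> k =
     ({\<omega> \<in> fst (neumann_form S \<delta> k).
         \<exists>u. (\<forall>n::nat. u n \<in> fin_cochains S) \<and>
             (\<lambda>n. form_norm S (neumann_form S \<delta> k) (u n - \<omega>)) \<longlonglongrightarrow> 0},
      snd (neumann_form S \<delta> k))"

definition is_laplacian ::
  "'v set set \<Rightarrow> (('v set \<Rightarrow> real) \<Rightarrow> 'v set \<Rightarrow> real) \<Rightarrow> lap_kind \<Rightarrow> 'v l2_op \<Rightarrow> bool" where
  "is_laplacian S \<delta> k \<Delta> \<longleftrightarrow>
     (\<exists>Q. closed_form S Q \<and> form_sub (dirichlet_form S \<delta> k) Q \<and> form_sub Q (neumann_form S \<delta> k)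
        \<and> \<Delta> = form_operator S Q)"

definition restrict_fin :: "'v set set \<Rightarrow> 'v l2_op \<Rightarrow> 'v l2_op" where
  "restrict_fin S A = {(f, g) \<in> A. f \<in> fin_cochains S}"

end

theory Submission
  imports Defs
begin

text \<open>On finitely supported cochains every Laplacian acts as \<open>a\<^sup>T a\<close> for a row- and column-finite incidence
  matrix \<open>a\<close>, which gives (b); (a) is a Schur test in one direction and testing on the star of a vertex
  in the other. For (c) and (d) it suffices that \<open>a\<^sup>T a f = - \<mu> f\<close> has no solution \<open>f \<noteq> 0\<close> in \<open>\<ell>\<^sup>2\<close> for
  some \<open>\<mu> > 0\<close>; because \<open>\<delta>\<delta> = 0\<close> and \<open>\<partial>\<partial> = 0\<close>, only the Hodge case has to be treated. Under a lower bound on the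
  Forman curvature the maximum principle applies at a simplex where \<open>\<bar>f\<bar>\<close> is maximal (it exists since
  \<open>m = 1\<close>). Under completeness, balls of the degree path metric are finite, and one tests the equation
  with \<open>\<phi>\<^sup>2 f\<close> for cutoff functions \<open>\<phi>\<close> of the distance.\<close>

subsection \<open>The Hilbert space of square summable cochains\<close>

text \<open>Local summability makes every sum over cofaces finite, so F^1 = F, and \<delta>,
  \<partial>, \<delta> + \<partial> are matrices with finite rows and columns; this treats the three
  Laplacians at once. All indicators lie in the form domain, so on finite cochains the operator does
  not depend on the form chosen between Dirichlet and Neumann. The kernel criterion uses the real
  point -\<mu> instead of i and -i because the operator is nonnegative and functions are real. The
  freedom in \<mu> serves the curvature argument: except at vertices without a face, c^H is the
  diagonal entry of the Hodge Laplacian minus the absolute off-diagonal row sum, so a positive \<mu>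
  above -inf c^H makes the shifted matrix diagonally dominant. In the cutoff argument the obstacle
  is that a solution f is merely square summable and may have infinite energy; the error must be
  controlled by the norm of f and differences of the cutoff alone. The empty simplex needs separate
  care: it is in S only if there are finitely many vertices, and otherwise disjoint simplices have
  no meet in S.\<close>

lemma cochains_add: "f \<in> cochains S \<Longrightarrow> g \<in> cochains S \<Longrightarrow> f + g \<in> cochains S"
  and cochains_diff: "f \<in> cochains S \<Longrightarrow> g \<in> cochains S \<Longrightarrow> f - g \<in> cochains S"
  and cochains_scale: "f \<in> cochains S \<Longrightarrow> (\<lambda>\<tau>. a * f \<tau>) \<in> cochains S"
  and cochains_zero: "0 \<in> cochains S"
  by (auto simp: cochains_def)

lemma cochain_outside: "f \<in> cochains S \<Longrightarrow> \<tau> \<notin> S \<Longrightarrow> f \<tau> = 0"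
  by (auto simp: cochains_def)

lemma l2_cochain: "f \<in> l2 S \<Longrightarrow> f \<in> cochains S"
  by (auto simp: l2_def)

lemma fin_cochain: "u \<in> fin_cochains S \<Longrightarrow> u \<in> cochains S"
  by (auto simp: fin_cochains_def)

text \<open>Membership and norm bound come together from finite partial sums, since the terms are
  nonnegative; no summability has to be known beforehand.\<close>

lemma l2_boundedI:
  assumes "f \<in> cochains S" and "\<And>B. finite B \<Longrightarrow> B \<subseteq> S \<Longrightarrow> (\<Sum>\<tau>\<in>B. (f \<tau>)\<^sup>2) \<le> C"
  shows "f \<in> l2 S" and "(l2_norm S f)\<^sup>2 \<le> C"
proof -
  have sm: "(\<lambda>\<tau>. (f \<tau>)\<^sup>2) summable_on S"
    by (rule nonneg_bdd_above_summable_on) (auto simp: bdd_above_def intro!: exI[of _ C] assms)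
  then show "f \<in> l2 S" using assms by (auto simp: l2_def)
  have "infsum (\<lambda>\<tau>. (f \<tau>)\<^sup>2) S \<le> C"
    by (rule infsum_le_finite_sums[OF sm]) (use assms in auto)
  then show "(l2_norm S f)\<^sup>2 \<le> C"
    by (simp add: l2_norm_def infsum_nonneg)
qed

lemma l2_finite_sum_le:
  assumes "f \<in> l2 S" "finite B"
  shows "(\<Sum>\<tau>\<in>B. (f \<tau>)\<^sup>2) \<le> (l2_norm S f)\<^sup>2"
proof -
  have "(\<Sum>\<tau>\<in>B. (f \<tau>)\<^sup>2) = (\<Sum>\<tau>\<in>B \<inter> S. (f \<tau>)\<^sup>2)"
    using assms by (intro sum.mono_neutral_right) (auto dest!: l2_cochain dest: cochain_outside)
  also have "\<dots> \<le> infsum (\<lambda>\<tau>. (f \<tau>)\<^sup>2) S"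
    by (rule finite_sum_le_infsum) (use assms in \<open>auto simp: l2_def\<close>)
  finally show ?thesis by (simp add: l2_norm_def infsum_nonneg)
qed

lemma l2_norm_nonneg [simp]: "0 \<le> l2_norm S f"
  by (simp add: l2_norm_def infsum_nonneg)

lemma l2_point_le: "f \<in> l2 S \<Longrightarrow> \<bar>f \<tau>\<bar> \<le> l2_norm S f"
  using l2_finite_sum_le[of f S "{\<tau>}"] by (simp add: abs_le_square_iff[symmetric])

lemma l2_norm_sq: "(l2_norm S f)\<^sup>2 = l2_inner S f f"
  by (simp add: l2_norm_def l2_inner_def infsum_nonneg power2_eq_square)

lemma l2_add:
  assumes "f \<in> l2 S" "g \<in> l2 S" shows "f + g \<in> l2 S"
proof -
  have "(\<lambda>\<tau>. 2 * (f \<tau>)\<^sup>2 + 2 * (g \<tau>)\<^sup>2) summable_on S"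
    using assms by (intro summable_on_add summable_on_cmult_right) (auto simp: l2_def)
  then have "(\<lambda>\<tau>. (f \<tau> + g \<tau>)\<^sup>2) summable_on S"
  proof (rule summable_on_comparison_test)
    fix \<tau>
    show "(f \<tau> + g \<tau>)\<^sup>2 \<le> 2 * (f \<tau>)\<^sup>2 + 2 * (g \<tau>)\<^sup>2"
      using sum_squares_bound[of "f \<tau>" "g \<tau>"] by (simp add: power2_sum)
  qed auto
  then show ?thesis using assms by (auto simp: l2_def cochains_add)
qed

lemma l2_scale: "f \<in> l2 S \<Longrightarrow> (\<lambda>\<tau>. a * f \<tau>) \<in> l2 S"
  by (auto simp: l2_def cochains_scale power_mult_distrib intro: summable_on_cmult_right)

lemma l2_diff: "f \<in> l2 S \<Longrightarrow> g \<in> l2 S \<Longrightarrow> f - g \<in> l2 S"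
  using l2_add[of f S "\<lambda>\<tau>. - 1 * g \<tau>"] l2_scale[of g S "-1"]
  by (simp add: fun_diff_def plus_fun_def)

lemma l2_zero: "0 \<in> l2 S"
  by (auto simp: l2_def cochains_zero)

lemma l2_prod_summable:
  assumes "f \<in> l2 S" "g \<in> l2 S" shows "(\<lambda>\<tau>. f \<tau> * g \<tau>) summable_on S"
proof -
  have "(\<lambda>\<tau>. (f \<tau>)\<^sup>2 + (g \<tau>)\<^sup>2) summable_on S"
    using assms by (intro summable_on_add) (auto simp: l2_def)
  then have "(\<lambda>\<tau>. norm (f \<tau> * g \<tau>)) summable_on S"
  proof (rule summable_on_comparison_test)
    fix \<tau>
    have "2 * (\<bar>f \<tau>\<bar> * \<bar>g \<tau>\<bar>) \<le> (f \<tau>)\<^sup>2 + (g \<tau>)\<^sup>2"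
      using sum_squares_bound[of "\<bar>f \<tau>\<bar>" "\<bar>g \<tau>\<bar>"] by simp
    moreover have "0 \<le> \<bar>f \<tau>\<bar> * \<bar>g \<tau>\<bar>" by simp
    ultimately show "norm (f \<tau> * g \<tau>) \<le> (f \<tau>)\<^sup>2 + (g \<tau>)\<^sup>2" unfolding real_norm_def abs_mult by linarith
  qed auto
  then show ?thesis by (rule abs_summable_summable)
qed

lemma l2_inner_commute: "l2_inner S f g = l2_inner S g f"
  by (simp add: l2_inner_def mult.commute)

lemma l2_inner_add_left:
  assumes "f \<in> l2 S" "g \<in> l2 S" "h \<in> l2 S"
  shows "l2_inner S (f + g) h = l2_inner S f h + l2_inner S g h"
  using assms by (simp add: l2_inner_def distrib_right infsum_add l2_prod_summable)

lemma l2_inner_scale_left: "l2_inner S (\<lambda>\<tau>. a * f \<tau>) h = a * l2_inner S f h"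
  by (simp add: l2_inner_def mult.assoc infsum_cmult_right')

lemma l2_inner_diff_left:
  assumes "f \<in> l2 S" "g \<in> l2 S" "h \<in> l2 S"
  shows "l2_inner S (f - g) h = l2_inner S f h - l2_inner S g h"
  using l2_inner_add_left[of f S "\<lambda>\<tau>. - 1 * g \<tau>" h] l2_scale[of g S "-1"] assms
    l2_inner_scale_left[of S "-1" g h]
  by (simp add: fun_diff_def plus_fun_def)

lemma l2_inner_add_right:
  "f \<in> l2 S \<Longrightarrow> g \<in> l2 S \<Longrightarrow> h \<in> l2 S \<Longrightarrow> l2_inner S h (f + g) = l2_inner S h f + l2_inner S h g"
  by (metis l2_inner_add_left l2_inner_commute)

lemma l2_inner_diff_right:
  "f \<in> l2 S \<Longrightarrow> g \<in> l2 S \<Longrightarrow> h \<in> l2 S \<Longrightarrow> l2_inner S h (f - g) = l2_inner S h f - l2_inner S h g"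
  by (metis l2_inner_diff_left l2_inner_commute)

lemma l2_inner_scale_right: "l2_inner S h (\<lambda>\<tau>. a * f \<tau>) = a * l2_inner S h f"
  by (metis l2_inner_scale_left l2_inner_commute)

lemma l2_norm_zero_iff:
  assumes "f \<in> l2 S" shows "l2_norm S f = 0 \<longleftrightarrow> f = 0"
proof
  assume "l2_norm S f = 0"
  then show "f = 0" using l2_point_le[OF assms] by (auto simp: fun_eq_iff)
qed (simp add: l2_norm_def)

lemma l2_norm_add_sq:
  "f \<in> l2 S \<Longrightarrow> g \<in> l2 S \<Longrightarrow>
    (l2_norm S (f + g))\<^sup>2 = (l2_norm S f)\<^sup>2 + 2 * l2_inner S f g + (l2_norm S g)\<^sup>2"
  by (simp add: l2_norm_sq l2_inner_add_left l2_inner_add_right l2_add l2_inner_commute)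

lemma l2_norm_diff_sq:
  "f \<in> l2 S \<Longrightarrow> g \<in> l2 S \<Longrightarrow>
    (l2_norm S (f - g))\<^sup>2 = (l2_norm S f)\<^sup>2 - 2 * l2_inner S f g + (l2_norm S g)\<^sup>2"
  by (simp add: l2_norm_sq l2_inner_diff_left l2_inner_diff_right l2_diff l2_inner_commute)

lemma l2_norm_scale: "l2_norm S (\<lambda>\<tau>. a * f \<tau>) = \<bar>a\<bar> * l2_norm S f"
  by (simp add: l2_norm_def power_mult_distrib infsum_cmult_right' real_sqrt_mult)

lemma l2_Cauchy_Schwarz:
  assumes "f \<in> l2 S" "g \<in> l2 S"
  shows "\<bar>l2_inner S f g\<bar> \<le> l2_norm S f * l2_norm S g"
proof (cases "l2_norm S g = 0")
  case True
  then show ?thesis using assms by (simp add: l2_norm_zero_iff) (simp add: l2_inner_def)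
next
  case False
  \<comment> \<open>The coefficient of the orthogonal projection of \<open>f\<close> onto
    \<open>g\<close>, which minimises the norm of \<open>f\<close> minus a multiple of
    \<open>g\<close>.\<close>
  define t where "t = l2_inner S f g / (l2_norm S g)\<^sup>2"
  have "0 \<le> (l2_norm S (f - (\<lambda>\<tau>. t * g \<tau>)))\<^sup>2" by simp
  also have "\<dots> = (l2_norm S f)\<^sup>2 - 2 * (t * l2_inner S f g) + t\<^sup>2 * (l2_norm S g)\<^sup>2"
    using assms by (simp add: l2_norm_diff_sq l2_scale l2_norm_scale l2_inner_scale_right
        power_mult_distrib)
  also have "\<dots> = (l2_norm S f)\<^sup>2 - (l2_inner S f g)\<^sup>2 / (l2_norm S g)\<^sup>2"
    using False by (simp add: t_def field_simps power2_eq_square)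
  finally have "(l2_inner S f g)\<^sup>2 \<le> (l2_norm S f * l2_norm S g)\<^sup>2"
    using False by (simp add: field_simps power_mult_distrib)
  then show ?thesis by (simp only: abs_le_square_iff[symmetric]) (simp add: abs_mult)
qed

lemma l2_norm_triangle:
  assumes "f \<in> l2 S" "g \<in> l2 S"
  shows "l2_norm S (f + g) \<le> l2_norm S f + l2_norm S g"
proof (rule power2_le_imp_le)
  show "(l2_norm S (f + g))\<^sup>2 \<le> (l2_norm S f + l2_norm S g)\<^sup>2"
    using l2_Cauchy_Schwarz[OF assms] assms by (simp add: l2_norm_add_sq power2_sum)
qed simp

lemma l2_norm_minus_commute: "l2_norm S (f - g) = l2_norm S (g - f)"
  by (simp add: l2_norm_def power2_commute)

lemma l2_norm_triangle_diff:
  assumes "f \<in> l2 S" "g \<in> l2 S" "h \<in> l2 S"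
  shows "l2_norm S (f - g) \<le> l2_norm S (f - h) + l2_norm S (g - h)"
  using l2_norm_triangle[of "f - h" S "h - g"] l2_norm_minus_commute[of S g h] assms
  by (simp add: l2_diff)

text \<open>Evaluation at a simplex is bounded by the norm, so a Cauchy sequence converges
  pointwise. That the pointwise limit is a norm limit is seen on finite sets, where the Cauchy
  estimate passes to the limit in \<open>n\<close>.\<close>

lemma l2_complete:
  assumes u: "\<And>n::nat. u n \<in> l2 S"
    and cauchy: "\<And>e. e > 0 \<Longrightarrow> \<exists>N. \<forall>m\<ge>N. \<forall>n\<ge>N. l2_norm S (u m - u n) < e"
  obtains f where "f \<in> l2 S" "(\<lambda>n. l2_norm S (u n - f)) \<longlonglongrightarrow> 0"
proof -
  have "convergent (\<lambda>n. u n \<tau>)" for \<tau>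
  proof (rule Cauchy_convergent, rule CauchyI)
    fix e :: real assume "e > 0"
    then obtain N where "\<forall>m\<ge>N. \<forall>n\<ge>N. l2_norm S (u m - u n) < e" using cauchy by blast
    then show "\<exists>M. \<forall>m\<ge>M. \<forall>n\<ge>M. norm (u m \<tau> - u n \<tau>) < e"
      using l2_point_le[OF l2_diff[OF u u], where \<tau> = \<tau>]
      by (intro exI[of _ N]) (metis le_less_trans real_norm_def minus_apply)
  qed
  then obtain f where f: "\<And>\<tau>. (\<lambda>n. u n \<tau>) \<longlonglongrightarrow> f \<tau>"
    unfolding convergent_def by metis
  have "f \<tau> = 0" if "\<tau> \<notin> S" for \<tau>
  proof -
    have "(\<lambda>n. u n \<tau>) = (\<lambda>n. 0)" using u that by (auto dest: l2_cochain cochain_outside)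
    with f[of \<tau>] show ?thesis by (simp add: LIMSEQ_const_iff)
  qed
  then have fc: "f \<in> cochains S" by (auto simp: cochains_def)
  have close: "u m - f \<in> l2 S \<and> l2_norm S (u m - f) \<le> e"
    if e: "e > 0" and N: "\<forall>m\<ge>N. \<forall>n\<ge>N. l2_norm S (u m - u n) < e" "m \<ge> N" for e N m
  proof -
    have *: "(\<Sum>\<tau>\<in>B. ((u m - f) \<tau>)\<^sup>2) \<le> e\<^sup>2" if "finite B" "B \<subseteq> S" for B
    proof (rule LIMSEQ_le_const2)
      show "(\<lambda>n. \<Sum>\<tau>\<in>B. ((u m - u n) \<tau>)\<^sup>2) \<longlonglongrightarrow> (\<Sum>\<tau>\<in>B. ((u m - f) \<tau>)\<^sup>2)"
        by (auto intro!: tendsto_intros f)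
      have "(\<Sum>\<tau>\<in>B. ((u m - u n) \<tau>)\<^sup>2) \<le> e\<^sup>2" if "n \<ge> N" for n
      proof -
        have "(\<Sum>\<tau>\<in>B. ((u m - u n) \<tau>)\<^sup>2) \<le> (l2_norm S (u m - u n))\<^sup>2"
          by (rule l2_finite_sum_le[OF l2_diff[OF u u] \<open>finite B\<close>])
        also have "\<dots> \<le> e\<^sup>2" using N \<open>n \<ge> N\<close> by (intro power_mono) (auto intro: less_imp_le)
        finally show ?thesis .
      qed
      then show "\<exists>N. \<forall>n\<ge>N. (\<Sum>\<tau>\<in>B. ((u m - u n) \<tau>)\<^sup>2) \<le> e\<^sup>2" by blast
    qed
    have "u m - f \<in> cochains S" using fc u by (simp add: cochains_diff l2_cochain)
    from l2_boundedI[OF this *] e show ?thesis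
      by (metis abs_le_square_iff abs_of_nonneg l2_norm_nonneg less_imp_le)
  qed
  have "f \<in> l2 S"
  proof -
    obtain N where "\<forall>m\<ge>N. \<forall>n\<ge>N. l2_norm S (u m - u n) < 1" using cauchy[of 1] by auto
    from close[OF _ this, of N] have "u N - f \<in> l2 S" by simp
    from l2_diff[OF u[of N] this] show ?thesis by simp
  qed
  moreover have "(\<lambda>n. l2_norm S (u n - f)) \<longlonglongrightarrow> 0"
  proof (rule LIMSEQ_I)
    fix e :: real assume "e > 0"
    then obtain N where "\<forall>m\<ge>N. \<forall>n\<ge>N. l2_norm S (u m - u n) < e/2" using cauchy[of "e/2"] by auto
    from close[OF _ this] \<open>e > 0\<close> have "l2_norm S (u n - f) \<le> e/2" if "n \<ge> N" for n
      using that by simp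
    then show "\<exists>no. \<forall>n\<ge>no. norm (l2_norm S (u n - f) - 0) < e"
      using \<open>e > 0\<close> by (intro exI[of _ N]) (fastforce intro: le_less_trans)
  qed
  ultimately show ?thesis by (rule that)
qed

lemma l2_inner_tendsto:
  assumes "\<And>n::nat. u n \<in> l2 S" "\<And>n. v n \<in> l2 S" "f \<in> l2 S" "g \<in> l2 S"
    and "(\<lambda>n. l2_norm S (u n - f)) \<longlonglongrightarrow> 0" "(\<lambda>n. l2_norm S (v n - g)) \<longlonglongrightarrow> 0"
  shows "(\<lambda>n. l2_inner S (u n) (v n)) \<longlonglongrightarrow> l2_inner S f g"
proof -
  \<comment> \<open>Bounds for the three terms in the expansion of the inner product about
    \<open>f\<close> and \<open>g\<close>.\<close>
  let ?b = "\<lambda>n. l2_norm S (u n - f) * l2_norm S (v n - g) + l2_norm S (u n - f) * l2_norm S g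
      + l2_norm S f * l2_norm S (v n - g)"
  have "?b \<longlonglongrightarrow> 0 * 0 + 0 * l2_norm S g + l2_norm S f * 0"
    by (intro tendsto_intros assms)
  then have b: "?b \<longlonglongrightarrow> 0" by simp
  have "norm (l2_inner S (u n) (v n) - l2_inner S f g) \<le> ?b n" for n
  proof -
    have "l2_inner S (u n) (v n) - l2_inner S f g
        = l2_inner S (u n - f) (v n - g) + l2_inner S (u n - f) g + l2_inner S f (v n - g)"
      using assms by (simp add: l2_inner_diff_left l2_inner_diff_right l2_diff)
    then show ?thesis
      using l2_Cauchy_Schwarz[of "u n - f" S "v n - g"] l2_Cauchy_Schwarz[of "u n - f" S g]
        l2_Cauchy_Schwarz[of f S "v n - g"] assms by (simp add: l2_diff)
  qed
  then have "(\<lambda>n. l2_inner S (u n) (v n) - l2_inner S f g) \<longlonglongrightarrow> 0"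
    by (intro Lim_null_comparison[OF _ b]) auto
  then show ?thesis by (simp add: LIM_zero_iff)
qed

section \<open>Finitely supported cochains as test functions\<close>

lemma fin_cochains_add: "u \<in> fin_cochains S \<Longrightarrow> v \<in> fin_cochains S \<Longrightarrow> u + v \<in> fin_cochains S"
  by (auto simp: fin_cochains_def cochains_add
      intro: finite_subset[where B = "{\<tau>. u \<tau> \<noteq> 0} \<union> {\<tau>. v \<tau> \<noteq> 0}"])

lemma fin_cochains_scale: "u \<in> fin_cochains S \<Longrightarrow> (\<lambda>\<tau>. a * u \<tau>) \<in> fin_cochains S"
  by (auto simp: fin_cochains_def cochains_scale elim: rev_finite_subset)

lemma fin_cochains_diff: "u \<in> fin_cochains S \<Longrightarrow> v \<in> fin_cochains S \<Longrightarrow> u - v \<in> fin_cochains S"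
  by (auto simp: fin_cochains_def cochains_diff
      intro: finite_subset[where B = "{\<tau>. u \<tau> \<noteq> 0} \<union> {\<tau>. v \<tau> \<noteq> 0}"])

lemma fin_cochains_l2: "u \<in> fin_cochains S \<Longrightarrow> u \<in> l2 S"
  by (auto simp: fin_cochains_def l2_def
      intro: summable_on_cong_neutral[where T = "{\<tau>. u \<tau> \<noteq> 0}", THEN iffD2] simp: cochains_def)

lemma indicator_fin_cochain: "\<tau> \<in> S \<Longrightarrow> indicat_real {\<tau>} \<in> fin_cochains S"
  by (auto simp: fin_cochains_def cochains_def indicator_def)

lemma l2_inner_finite:
  assumes "finite B" "\<And>\<tau>. \<tau> \<notin> B \<Longrightarrow> u \<tau> = 0" "u \<in> cochains S"
  shows "l2_inner S u f = (\<Sum>\<tau>\<in>B. u \<tau> * f \<tau>)"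
proof -
  have "l2_inner S u f = infsum (\<lambda>\<tau>. u \<tau> * f \<tau>) B"
    unfolding l2_inner_def using assms by (intro infsum_cong_neutral) (auto simp: cochain_outside)
  then show ?thesis using assms by simp
qed

lemma l2_inner_indicator:
  assumes "\<tau> \<in> S" shows "l2_inner S (indicat_real {\<tau>}) f = f \<tau>"
  using fin_cochain[OF indicator_fin_cochain[OF assms]]
  by (subst l2_inner_finite[where B = "{\<tau>}"]) auto

lemma l2_truncation:
  assumes "f \<in> cochains S" "finite B"
  shows "(\<lambda>\<tau>. if \<tau> \<in> B then f \<tau> else 0) \<in> fin_cochains S"
  using assms by (auto simp: fin_cochains_def cochains_def)

lemma fin_cochains_dense:
  assumes f: "f \<in> l2 S" and e: "e > 0"
  obtains u where "u \<in> fin_cochains S" "l2_norm S (f - u) < e"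
proof -
  let ?I = "infsum (\<lambda>\<tau>. (f \<tau>)\<^sup>2) S"
  have sm: "(\<lambda>\<tau>. (f \<tau>)\<^sup>2) summable_on S" using f by (simp add: l2_def)
  obtain B where B: "finite B" "B \<subseteq> S" "dist (\<Sum>\<tau>\<in>B. (f \<tau>)\<^sup>2) ?I \<le> (e/2)\<^sup>2"
    using infsum_finite_approximation[OF sm, of "(e/2)\<^sup>2"] e by auto
  define u where "u = (\<lambda>\<tau>. if \<tau> \<in> B then f \<tau> else 0)"
  have uF: "u \<in> fin_cochains S" unfolding u_def using f B by (intro l2_truncation l2_cochain)
  \<comment> \<open>The truncation \<open>u\<close> agrees with \<open>f\<close> on
    \<open>B\<close>, so \<open>l2_inner S u f\<close> and the squared norm of \<open>u\<close> both
    equal the partial sum over \<open>B\<close>; what is left is the tail of the series.\<close>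
  have "(l2_norm S (f - u))\<^sup>2 = (l2_norm S f)\<^sup>2 - 2 * l2_inner S u f + (l2_norm S u)\<^sup>2"
    using f uF by (simp add: l2_norm_diff_sq fin_cochains_l2 l2_inner_commute)
  also have "l2_inner S u f = (\<Sum>\<tau>\<in>B. (f \<tau>)\<^sup>2)"
    using B fin_cochain[OF uF]
    by (subst l2_inner_finite[of B]) (auto simp: u_def power2_eq_square)
  also have "(l2_norm S u)\<^sup>2 = (\<Sum>\<tau>\<in>B. (f \<tau>)\<^sup>2)"
    using B fin_cochain[OF uF] unfolding l2_norm_sq
    by (subst l2_inner_finite[of B]) (auto simp: u_def power2_eq_square)
  also have "(l2_norm S f)\<^sup>2 = ?I" by (simp add: l2_norm_def infsum_nonneg)
  finally have "(l2_norm S (f - u))\<^sup>2 \<le> (e/2)\<^sup>2"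
    using B(3) unfolding dist_real_def by linarith
  then have "l2_norm S (f - u) \<le> e/2" using e by (auto intro: power2_le_imp_le)
  then show ?thesis using e uF that by simp
qed

subsection \<open>Essential self-adjointness of nonnegative symmetric operators on finite cochains\<close>

text \<open>\<open>L\<close> acts on all cochains, not just on square summable ones, and
  \<open>L_sym\<close> pairs a finite cochain with an arbitrary one. Thus \<open>L\<close> is its
  own formal adjoint, and the adjoint of its restriction to finite cochains is again given by
  \<open>L\<close>.\<close>

locale nonneg_symmetric =
  fixes S :: "'v set set" and L :: "('v set \<Rightarrow> real) \<Rightarrow> 'v set \<Rightarrow> real"
  assumes L_cochain: "f \<in> cochains S \<Longrightarrow> L f \<in> cochains S"
    and L_add: "f \<in> cochains S \<Longrightarrow> g \<in> cochains S \<Longrightarrow> L (f + g) = L f + L g"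
    and L_scale: "f \<in> cochains S \<Longrightarrow> L (\<lambda>\<tau>. a * f \<tau>) = (\<lambda>\<tau>. a * L f \<tau>)"
    and L_fin: "u \<in> fin_cochains S \<Longrightarrow> L u \<in> fin_cochains S"
    and L_sym: "u \<in> fin_cochains S \<Longrightarrow> f \<in> cochains S \<Longrightarrow> l2_inner S (L u) f = l2_inner S u (L f)"
    and L_nonneg: "u \<in> fin_cochains S \<Longrightarrow> 0 \<le> l2_inner S (L u) u"
begin

definition A :: "'v l2_op" where
  "A = {(u, L u) |u. u \<in> fin_cochains S}"

lemma L_diff: "f \<in> cochains S \<Longrightarrow> g \<in> cochains S \<Longrightarrow> L (f - g) = L f - L g"
  using L_add[of f "\<lambda>\<tau>. - 1 * g \<tau>"] L_scale[of g "-1"] cochains_scale[of g S "-1"]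
  by (simp add: fun_diff_def plus_fun_def)

lemma A_imp: "(u, v) \<in> A \<Longrightarrow> u \<in> fin_cochains S \<and> v = L u \<and> u \<in> l2 S \<and> v \<in> l2 S"
  by (auto simp: A_def fin_cochains_l2 L_fin)

text \<open>The adjoint is the maximal operator: testing with the indicator of \<open>\<tau>\<close>
  reads off the value of the adjoint at \<open>\<tau>\<close>, and symmetry identifies it with that
  of \<open>L f\<close>.\<close>

lemma adjoint_A: "op_adjoint S A = {(f, L f) |f. f \<in> l2 S \<and> L f \<in> l2 S}"
proof (intro set_eqI iffI)
  fix x assume "x \<in> op_adjoint S A"
  then obtain f g where x: "x = (f, g)" and fg: "f \<in> l2 S" "g \<in> l2 S"
    "\<And>u. u \<in> fin_cochains S \<Longrightarrow> l2_inner S (L u) f = l2_inner S u g"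
    by (auto simp: op_adjoint_def A_def)
  have "g \<tau> = L f \<tau>" for \<tau>
  proof (cases "\<tau> \<in> S")
    case True
    then show ?thesis
      using fg(3)[OF indicator_fin_cochain[OF True]] L_sym[OF indicator_fin_cochain[OF True], of f] fg
      by (simp add: l2_inner_indicator l2_cochain)
  next
    case False
    then show ?thesis using fg cochain_outside L_cochain l2_cochain by metis
  qed
  then have "g = L f" by auto
  then show "x \<in> {(f, L f) |f. f \<in> l2 S \<and> L f \<in> l2 S}" using x fg by auto
next
  fix x assume "x \<in> {(f, L f) |f. f \<in> l2 S \<and> L f \<in> l2 S}"
  then show "x \<in> op_adjoint S A" by (auto simp: op_adjoint_def A_def L_sym l2_cochain)
qed

lemma closure_imp_symmetric:
  assumes "(f, g) \<in> op_closure S A" "(f', g') \<in> op_closure S A"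
  shows "l2_inner S g f' = l2_inner S f g'"
proof -
  from assms obtain u v where u: "\<And>n::nat. (u n, v n) \<in> A"
    "(\<lambda>n. l2_norm S (u n - f)) \<longlonglongrightarrow> 0" "(\<lambda>n. l2_norm S (v n - g)) \<longlonglongrightarrow> 0" "f \<in> l2 S" "g \<in> l2 S"
    by (auto simp: op_closure_def)
  from assms obtain u' v' where u': "\<And>n::nat. (u' n, v' n) \<in> A"
    "(\<lambda>n. l2_norm S (u' n - f')) \<longlonglongrightarrow> 0" "(\<lambda>n. l2_norm S (v' n - g')) \<longlonglongrightarrow> 0" "f' \<in> l2 S" "g' \<in> l2 S"
    by (auto simp: op_closure_def)
  have in_l2: "u n \<in> l2 S" "v n \<in> l2 S" "u' n \<in> l2 S" "v' n \<in> l2 S" for n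
    using A_imp[OF u(1)[of n]] A_imp[OF u'(1)[of n]] by blast+
  have "l2_inner S (v n) (u' n) = l2_inner S (u n) (v' n)" for n
    using A_imp[OF u(1)[of n]] A_imp[OF u'(1)[of n]] L_sym[of "u n" "u' n"] by (simp add: fin_cochain)
  then have "(\<lambda>n. l2_inner S (u n) (v' n)) \<longlonglongrightarrow> l2_inner S g f'"
    using l2_inner_tendsto[of v S u' g f'] u(2-) u'(2-) in_l2 by simp
  moreover have "(\<lambda>n. l2_inner S (u n) (v' n)) \<longlonglongrightarrow> l2_inner S f g'"
    using l2_inner_tendsto[of u S v' f g'] u(2-) u'(2-) in_l2 by simp
  ultimately show ?thesis by (rule LIMSEQ_unique)
qed

lemma A_subset_closure: "A \<subseteq> op_closure S A"
proof (rule subrelI)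
  fix u v assume uv: "(u, v) \<in> A"
  have "(\<lambda>n. l2_norm S (w - w)) \<longlonglongrightarrow> 0" for w and S :: "'v set set"
    using l2_norm_zero_iff[OF l2_zero, of S] by simp
  then show "(u, v) \<in> op_closure S A"
    unfolding op_closure_def using uv A_imp[OF uv]
    by (intro CollectI case_prodI conjI exI[of _ "\<lambda>_. u"] exI[of _ "\<lambda>_. v"]) auto
qed

text \<open>Nonnegativity makes L + \<mu> bounded below, so convergence of its values along finite
  cochains forces convergence of the cochains themselves.\<close>

lemma lower_bound:
  assumes "u \<in> fin_cochains S" "\<mu> > 0"
  shows "\<mu> * l2_norm S u \<le> l2_norm S (L u + (\<lambda>\<tau>. \<mu> * u \<tau>))"
proof -
  let ?w = "L u + (\<lambda>\<tau>. \<mu> * u \<tau>)"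
  have u: "u \<in> l2 S" "L u \<in> l2 S" using assms by (auto simp: fin_cochains_l2 L_fin)
  have "\<mu> * (l2_norm S u)\<^sup>2 \<le> l2_inner S (L u) u + \<mu> * l2_inner S u u"
    using L_nonneg[OF assms(1)] by (simp add: l2_norm_sq)
  also have "\<dots> = l2_inner S ?w u"
    using u by (simp add: l2_inner_add_left l2_scale l2_inner_scale_left)
  also have "\<dots> \<le> l2_norm S ?w * l2_norm S u"
    using l2_Cauchy_Schwarz[of ?w S u] u by (simp add: l2_add l2_scale)
  finally have "\<mu> * l2_norm S u * l2_norm S u \<le> l2_norm S ?w * l2_norm S u"
    by (simp add: power2_eq_square mult.assoc)
  then show ?thesis
    using l2_norm_nonneg[of S u] l2_norm_nonneg[of S ?w]
    by (cases "l2_norm S u = 0") (auto simp: mult_le_cancel_right)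
qed

text \<open>A minimising sequence for the distance from \<open>h\<close> to the range is Cauchy by the parallelogram
  law; the residual is orthogonal to the range, hence an eigenfunction for \<open>-\<mu>\<close>.\<close>

lemma range_dense:
  assumes \<mu>: "\<mu> > 0"
    and ker: "\<And>f. f \<in> l2 S \<Longrightarrow> L f = (\<lambda>\<tau>. - \<mu> * f \<tau>) \<Longrightarrow> f = 0"
    and h: "h \<in> l2 S"
  obtains u where "\<And>n::nat. u n \<in> fin_cochains S"
    "(\<lambda>n. l2_norm S (L (u n) + (\<lambda>\<tau>. \<mu> * u n \<tau>) - h)) \<longlonglongrightarrow> 0"
proof -
  define R where "R u = L u + (\<lambda>\<tau>. \<mu> * u \<tau>)" for u
  have R_l2: "R u \<in> l2 S" if "u \<in> fin_cochains S" for u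
    using that by (auto simp: R_def intro!: l2_add l2_scale fin_cochains_l2[of u] fin_cochains_l2[of "L u"] L_fin)
  have R_add: "R (u + v) = R u + R v" if "u \<in> fin_cochains S" "v \<in> fin_cochains S" for u v
    using that by (auto simp: R_def L_add fin_cochain fun_eq_iff algebra_simps)
  have R_scale: "R (\<lambda>\<tau>. a * u \<tau>) = (\<lambda>\<tau>. a * R u \<tau>)" if "u \<in> fin_cochains S" for u a
    using that by (auto simp: R_def L_scale fin_cochain fun_eq_iff algebra_simps)
  define N where "N u = (l2_norm S (h - R u))\<^sup>2" for u
  define d where "d = Inf (N ` fin_cochains S)"
  have ne: "N ` fin_cochains S \<noteq> {}"
    by (auto intro!: exI[of _ 0] simp: fin_cochains_def cochains_zero)
  have bdd: "bdd_below (N ` fin_cochains S)"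
    by (auto simp: N_def intro!: bdd_belowI[of _ 0])
  have d_le: "d \<le> N u" if "u \<in> fin_cochains S" for u
    unfolding d_def using that bdd by (intro cInf_lower) auto
  have "\<exists>u\<in>fin_cochains S. N u < d + 1 / real (Suc n)" for n
    using cInf_lessD[OF ne, of "d + 1 / real (Suc n)"] by (auto simp: d_def)
  then obtain u where uF: "\<And>n. u n \<in> fin_cochains S" and uN: "\<And>n. N (u n) < d + 1 / real (Suc n)"
    by metis
  have para: "(l2_norm S (R (u m) - R (u n)))\<^sup>2 \<le> 2 / real (Suc m) + 2 / real (Suc n)" for m n
  proof -
    let ?a = "h - R (u m)" and ?b = "h - R (u n)"
    \<comment> \<open>The midpoint competes for the infimum as well, so \<open>4 * N ?w\<close> is
      at least \<open>4 * d\<close> and the parallelogram law bounds the difference.\<close>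
    let ?w = "\<lambda>\<tau>. 1/2 * (u m + u n) \<tau>"
    have ab: "?a \<in> l2 S" "?b \<in> l2 S" using h R_l2 uF by (auto intro: l2_diff)
    have wF: "?w \<in> fin_cochains S" using uF by (intro fin_cochains_scale fin_cochains_add)
    have "?a + ?b = (\<lambda>\<tau>. 2 * (h - R ?w) \<tau>)"
    proof -
      have "R ?w = (\<lambda>\<tau>. 1/2 * (R (u m) + R (u n)) \<tau>)"
        using R_scale[of "u m + u n" "1/2"] R_add[of "u m" "u n"] uF by (simp only: fin_cochains_add)
      then have "R ?w \<tau> = (R (u m) \<tau> + R (u n) \<tau>) / 2" for \<tau> by (simp add: fun_eq_iff)
      then show ?thesis by (intro ext) (simp add: field_simps)
    qed
    then have "(l2_norm S (?a + ?b))\<^sup>2 = 4 * N ?w"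
      by (simp only: N_def l2_norm_scale power_mult_distrib) simp
    moreover have "?b - ?a = R (u m) - R (u n)" by auto
    moreover have "(l2_norm S (?b - ?a))\<^sup>2 + (l2_norm S (?a + ?b))\<^sup>2 = 2 * N (u m) + 2 * N (u n)"
      by (simp only: N_def l2_norm_diff_sq[OF ab(2,1)] l2_norm_add_sq[OF ab]
          l2_inner_commute[of S ?a ?b])
    ultimately show ?thesis using d_le[OF wF] uN[of m] uN[of n] by simp
  qed
  have "\<exists>M. \<forall>m\<ge>M. \<forall>n\<ge>M. l2_norm S (R (u m) - R (u n)) < e" if "e > 0" for e
  proof -
    \<comment> \<open>For \<open>m\<close> and \<open>n\<close> from \<open>M\<close> on, the bound
      in \<open>para\<close> is at most four times \<open>inverse (real (Suc M))\<close>, hence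
      below the square of \<open>e\<close>.\<close>
    obtain M where M: "inverse (real (Suc M)) < e\<^sup>2 / 4"
      using reals_Archimedean[of "e\<^sup>2/4"] \<open>e > 0\<close> by auto
    have "l2_norm S (R (u m) - R (u n)) < e" if "m \<ge> M" "n \<ge> M" for m n
    proof -
      have *: "1 / real (Suc k) \<le> inverse (real (Suc M))" if "k \<ge> M" for k
        using that by (simp add: field_simps)
      have "2 * (1 / real (Suc m)) + 2 * (1 / real (Suc n)) < e\<^sup>2"
        using *[OF that(1)] *[OF that(2)] M by linarith
      then have "(l2_norm S (R (u m) - R (u n)))\<^sup>2 < e\<^sup>2"
        using para[of m n] by simp
      then show ?thesis using \<open>e > 0\<close> by (auto intro: power2_less_imp_less)
    qed
    then show ?thesis by blast
  qed
  then obtain w where w: "w \<in> l2 S" and wlim: "(\<lambda>n. l2_norm S (R (u n) - w)) \<longlonglongrightarrow> 0"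
    by (rule l2_complete[of "\<lambda>n. R (u n)" S, OF R_l2[OF uF]])
  define r where "r = h - w"
  have r: "r \<in> l2 S" using h w by (simp add: r_def l2_diff)
  have "(\<lambda>n. l2_norm S (h - R (u n) - r)) \<longlonglongrightarrow> 0"
    using wlim by (simp add: r_def l2_norm_minus_commute[of S w])
  then have "(\<lambda>n. l2_inner S (h - R (u n)) (h - R (u n))) \<longlonglongrightarrow> l2_inner S r r"
    using h r R_l2 uF by (intro l2_inner_tendsto) (auto intro: l2_diff)
  moreover have "(\<lambda>n. d + 1 / real (Suc n)) \<longlonglongrightarrow> d + 0"
    by (intro tendsto_intros LIMSEQ_Suc[OF lim_1_over_n])
  moreover have "l2_inner S (h - R (u n)) (h - R (u n)) \<le> d + 1 / real (Suc n)" for n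
    using uN[of n] by (simp add: N_def l2_norm_sq)
  ultimately have rd: "(l2_norm S r)\<^sup>2 \<le> d"
    unfolding l2_norm_sq by (simp only: add_0_right) (blast intro: LIMSEQ_le)
  \<comment> \<open>\<open>r - R v\<close> is the limit of the residuals of \<open>u n + v\<close>,
    all of which have squared norm at least \<open>d\<close>.\<close>
  have limit_bound: "d \<le> (l2_norm S (r - R v))\<^sup>2" if v: "v \<in> fin_cochains S" for v
  proof -
    have "(\<lambda>n. l2_norm S (h - R (u n + v) - (r - R v))) \<longlonglongrightarrow> 0"
    proof -
      have "h - R (u n + v) - (r - R v) = w - R (u n)" for n
        using uF v by (simp add: R_add r_def)
      then show ?thesis using wlim by (simp only: l2_norm_minus_commute[of S w])
    qed
    then have "(\<lambda>n. l2_inner S (h - R (u n + v)) (h - R (u n + v)))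
        \<longlonglongrightarrow> l2_inner S (r - R v) (r - R v)"
      by (intro l2_inner_tendsto l2_diff R_l2 h r fin_cochains_add uF v)
    moreover have "d \<le> l2_inner S (h - R (u n + v)) (h - R (u n + v))" for n
      using d_le[of "u n + v"] uF v by (simp only: N_def l2_norm_sq fin_cochains_add)
    ultimately show ?thesis
      unfolding l2_norm_sq by (intro LIMSEQ_le_const) auto
  qed
  have orth: "l2_inner S (R v) r = 0" if v: "v \<in> fin_cochains S" for v
  proof (rule ccontr)
    assume nz: "l2_inner S (R v) r \<noteq> 0"
    define i where "i = l2_inner S (R v) r"
    \<comment> \<open>The best step along \<open>R v\<close> would divide by the squared norm of
      \<open>R v\<close>; adding one avoids a zero denominator and still lowers the
      distance.\<close>
    define t where "t = i / ((l2_norm S (R v))\<^sup>2 + 1)"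
    have "0 \<le> (l2_norm S (r - R (\<lambda>\<tau>. t * v \<tau>)))\<^sup>2 - (l2_norm S r)\<^sup>2"
      using limit_bound[OF fin_cochains_scale[OF v, of t]] rd by linarith
    also have "\<dots> = t\<^sup>2 * (l2_norm S (R v))\<^sup>2 - 2 * t * i"
      using v r R_l2[OF v]
      by (simp add: R_scale l2_norm_diff_sq l2_scale l2_norm_scale l2_inner_scale_right
          power_mult_distrib i_def l2_inner_commute)
    also have "\<dots> \<le> t\<^sup>2 * ((l2_norm S (R v))\<^sup>2 + 1) - 2 * t * i"
      by (simp add: algebra_simps)
    also have "\<dots> = - i\<^sup>2 / ((l2_norm S (R v))\<^sup>2 + 1)"
    proof -
      define q where "q = (l2_norm S (R v))\<^sup>2 + 1"
      have "q \<noteq> 0"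
        unfolding q_def by (metis add_nonneg_eq_0_iff zero_le_one zero_le_power2 zero_neq_one)
      then show ?thesis
        unfolding t_def q_def[symmetric] by (simp add: field_simps power2_eq_square)
    qed
    also have "\<dots> < 0"
      using nz by (auto simp: i_def add_nonneg_pos intro!: divide_neg_pos)
    finally show False by simp
  qed
  have "L r = (\<lambda>\<tau>. - \<mu> * r \<tau>)"
  proof
    fix \<tau>
    show "L r \<tau> = - \<mu> * r \<tau>"
    proof (cases "\<tau> \<in> S")
      case True
      note iF = indicator_fin_cochain[OF True]
      have "0 = l2_inner S (L (indicat_real {\<tau>})) r + \<mu> * r \<tau>"
        using orth[OF iF] iF r True
        by (simp add: R_def l2_inner_add_left l2_scale fin_cochains_l2 L_fin l2_inner_scale_left
            l2_inner_indicator)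
      also have "l2_inner S (L (indicat_real {\<tau>})) r = L r \<tau>"
        using L_sym[OF iF] r True by (simp add: l2_cochain l2_inner_indicator)
      finally show ?thesis by simp
    next
      case False
      then show ?thesis using cochain_outside[OF L_cochain[OF l2_cochain[OF r]] False]
          cochain_outside[OF l2_cochain[OF r] False] by simp
    qed
  qed
  then have "r = 0" using ker r by blast
  then have "w = h" by (simp add: r_def)
  then show ?thesis using that[of u] uF wlim by (simp add: R_def)
qed

text \<open>For \<open>f\<close> in the domain of the adjoint, (L + \<mu>) f is approximated by the
  values of L + \<mu> at finite cochains. By \<open>lower_bound\<close> these cochains converge to
  some \<open>f0\<close> in the domain of the closure with the same image, so \<open>f - f0\<close>
  solves the eigenvalue equation for -\<mu> and vanishes.\<close>

theorem essentially_self_adjoint_if_kernel_trivial: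
  assumes \<mu>: "\<mu> > 0"
    and ker: "\<And>f. f \<in> l2 S \<Longrightarrow> L f = (\<lambda>\<tau>. - \<mu> * f \<tau>) \<Longrightarrow> f = 0"
  shows "essentially_self_adjoint S A"
  unfolding essentially_self_adjoint_def self_adjoint_def
proof
  show "densely_defined S (op_closure S A)"
    unfolding densely_defined_def
  proof (intro ballI allI impI)
    fix f and e :: real assume "f \<in> l2 S" "e > 0"
    then obtain u where "u \<in> fin_cochains S" "l2_norm S (f - u) < e" by (rule fin_cochains_dense)
    then show "\<exists>u\<in>Domain (op_closure S A). l2_norm S (f - u) < e"
      using A_subset_closure by (intro bexI[of _ u]) (auto simp: A_def)
  qed
  show "op_closure S A = op_adjoint S (op_closure S A)"
  proof (intro equalityI subsetI)
    fix x assume "x \<in> op_closure S A"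
    moreover obtain f g where "x = (f, g)" by (cases x)
    moreover have "f \<in> l2 S" "g \<in> l2 S" if "(f, g) \<in> op_closure S A" for f g
      using that by (auto simp: op_closure_def)
    ultimately show "x \<in> op_adjoint S (op_closure S A)"
      using closure_imp_symmetric by (auto simp: op_adjoint_def)
  next
    have mem: "(f0, g0) \<in> op_adjoint S A" if "(f0, g0) \<in> op_closure S A" for f0 g0
      using that closure_imp_symmetric[OF set_mp[OF A_subset_closure] that]
      by (auto simp: op_adjoint_def op_closure_def)
    fix x assume "x \<in> op_adjoint S (op_closure S A)"
    then have "x \<in> op_adjoint S A" using A_subset_closure by (auto simp: op_adjoint_def)
    then obtain f where x: "x = (f, L f)" and f: "f \<in> l2 S" "L f \<in> l2 S"
      by (auto simp: adjoint_A)
    define h where "h = L f + (\<lambda>\<tau>. \<mu> * f \<tau>)"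
    have h: "h \<in> l2 S" using f by (simp add: h_def l2_add l2_scale)
    from range_dense[OF \<mu> ker h] obtain u where uF: "\<And>n::nat. u n \<in> fin_cochains S"
      and lim: "(\<lambda>n. l2_norm S (L (u n) + (\<lambda>\<tau>. \<mu> * u n \<tau>) - h)) \<longlonglongrightarrow> 0" by blast
    define R where "R n = L (u n) + (\<lambda>\<tau>. \<mu> * u n \<tau>)" for n
    have R_l2: "R n \<in> l2 S" for n
      unfolding R_def by (intro l2_add l2_scale fin_cochains_l2 L_fin uF)
    have "\<exists>N. \<forall>m\<ge>N. \<forall>n\<ge>N. l2_norm S (u m - u n) < e" if e: "e > 0" for e
    proof -
      obtain N where N: "\<And>n. n \<ge> N \<Longrightarrow> l2_norm S (R n - h) < \<mu> * e / 2"
        using LIMSEQ_D[OF lim, of "\<mu> * e / 2"] e \<mu> by (auto simp: R_def)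
      have "l2_norm S (u m - u n) < e" if "m \<ge> N" "n \<ge> N" for m n
      proof -
        have "\<mu> * l2_norm S (u m - u n) \<le> l2_norm S (L (u m - u n) + (\<lambda>\<tau>. \<mu> * (u m - u n) \<tau>))"
          by (intro lower_bound fin_cochains_diff uF \<mu>)
        also have "L (u m - u n) + (\<lambda>\<tau>. \<mu> * (u m - u n) \<tau>) = R m - R n"
          using uF by (auto simp: R_def L_diff fin_cochain fun_eq_iff algebra_simps)
        also have "l2_norm S (R m - R n) \<le> l2_norm S (R m - h) + l2_norm S (R n - h)"
          by (rule l2_norm_triangle_diff) (auto simp: R_l2 h)
        also have "\<dots> < \<mu> * e" using N[OF that(1)] N[OF that(2)] by simp
        finally have "\<mu> * l2_norm S (u m - u n) < \<mu> * e" .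
        then show ?thesis using \<mu> by (simp only: mult_less_cancel_left_pos)
      qed
      then show ?thesis by blast
    qed
    then obtain f0 where f0: "f0 \<in> l2 S" "(\<lambda>n. l2_norm S (u n - f0)) \<longlonglongrightarrow> 0"
      by (rule l2_complete[of u S, OF fin_cochains_l2[OF uF]])
    \<comment> \<open>The only possible limit of \<open>L (u n)\<close>, which is \<open>R n\<close>
      minus \<mu> times \<open>u n\<close>.\<close>
    define g0 where "g0 = h - (\<lambda>\<tau>. \<mu> * f0 \<tau>)"
    have g0: "g0 \<in> l2 S" by (simp add: g0_def l2_diff l2_scale h f0)
    have "(\<lambda>n. l2_norm S (R n - h) + \<mu> * l2_norm S (u n - f0)) \<longlonglongrightarrow> 0 + \<mu> * 0"
      using lim f0 by (intro tendsto_intros) (auto simp: R_def)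
    then have "(\<lambda>n. l2_norm S (R n - h) + \<mu> * l2_norm S (u n - f0)) \<longlonglongrightarrow> 0" by simp
    then have "(\<lambda>n. l2_norm S (L (u n) - g0)) \<longlonglongrightarrow> 0"
    proof (rule Lim_null_comparison[rotated], intro always_eventually allI)
      fix n
      have eq: "L (u n) - g0 = (R n - h) - (\<lambda>\<tau>. \<mu> * (u n - f0) \<tau>)"
        by (auto simp: R_def g0_def algebra_simps)
      have "l2_norm S (L (u n) - g0)
          \<le> l2_norm S (R n - h - 0) + l2_norm S ((\<lambda>\<tau>. \<mu> * (u n - f0) \<tau>) - 0)"
        unfolding eq
        by (rule l2_norm_triangle_diff)
          (intro l2_diff l2_scale R_l2 h f0 l2_zero fin_cochains_l2 uF)+
      then show "norm (l2_norm S (L (u n) - g0)) \<le> l2_norm S (R n - h) + \<mu> * l2_norm S (u n - f0)"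
        using \<mu> l2_norm_scale[of S \<mu> "u n - f0"] by simp
    qed
    then have clos: "(f0, g0) \<in> op_closure S A"
      using f0 g0 uF unfolding op_closure_def A_def
      by (intro CollectI case_prodI conjI exI[of _ u] exI[of _ "\<lambda>n. L (u n)"]) auto
    from mem[OF clos] have Lf0: "L f0 = g0" by (auto simp: adjoint_A)
    have "L (f - f0) = (\<lambda>\<tau>. - \<mu> * (f - f0) \<tau>)"
      using f f0 Lf0 by (auto simp: L_diff l2_cochain g0_def h_def fun_eq_iff algebra_simps)
    with ker[OF l2_diff[OF f(1) f0(1)]] have "f - f0 = 0" .
    then have "f = f0" by simp
    then show "x \<in> op_closure S A" using clos Lf0 x by simp
  qed
qed

end

subsection \<open>Row- and column-finite matrices and the operators of their energy forms\<close>

text \<open>Finite rows define the operator on every function without any convergence, finite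
  columns make it preserve finite support, and vanishing entries off \<open>S\<close> make its
  values cochains.\<close>

definition row_col_finite :: "'v set set \<Rightarrow> ('v set \<Rightarrow> 'v set \<Rightarrow> real) \<Rightarrow> bool" where
  "row_col_finite S a \<longleftrightarrow> (\<forall>\<sigma>. finite {\<tau>. a \<sigma> \<tau> \<noteq> 0}) \<and> (\<forall>\<tau>. finite {\<sigma>. a \<sigma> \<tau> \<noteq> 0}) \<and>
     (\<forall>\<sigma> \<tau>. a \<sigma> \<tau> \<noteq> 0 \<longrightarrow> \<sigma> \<in> S \<and> \<tau> \<in> S)"

definition mat_op :: "('v set \<Rightarrow> 'v set \<Rightarrow> real) \<Rightarrow> ('v set \<Rightarrow> real) \<Rightarrow> 'v set \<Rightarrow> real" where
  "mat_op a f \<sigma> = (\<Sum>\<tau> | a \<sigma> \<tau> \<noteq> 0. a \<sigma> \<tau> * f \<tau>)"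

text \<open>An abbreviation and not a constant, so that transposing twice gives back
  \<open>a\<close> by reduction alone.\<close>

abbreviation (input) flip :: "('v set \<Rightarrow> 'v set \<Rightarrow> real) \<Rightarrow> 'v set \<Rightarrow> 'v set \<Rightarrow> real" where
  "flip a \<equiv> (\<lambda>\<sigma> \<tau>. a \<tau> \<sigma>)"

lemma row_col_finite_flip: "row_col_finite S a \<Longrightarrow> row_col_finite S (flip a)"
  by (auto simp: row_col_finite_def)

lemma row_finite: "row_col_finite S a \<Longrightarrow> finite {\<tau>. a \<sigma> \<tau> \<noteq> 0}"
  and col_finite: "row_col_finite S a \<Longrightarrow> finite {\<sigma>. a \<sigma> \<tau> \<noteq> 0}"
  by (auto simp: row_col_finite_def)

lemma mat_op_sum:
  "finite N \<Longrightarrow> {\<tau>. a \<sigma> \<tau> \<noteq> 0} \<subseteq> N \<Longrightarrow> mat_op a f \<sigma> = (\<Sum>\<tau>\<in>N. a \<sigma> \<tau> * f \<tau>)"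
  unfolding mat_op_def by (rule sum.mono_neutral_left) auto

lemma mat_op_add: "mat_op a (f + g) = mat_op a f + mat_op a g"
  by (auto simp: mat_op_def fun_eq_iff distrib_left sum.distrib)

lemma mat_op_diff: "mat_op a (f - g) = mat_op a f - mat_op a g"
  by (auto simp: mat_op_def fun_eq_iff right_diff_distrib sum_subtractf)

lemma mat_op_scale: "mat_op a (\<lambda>\<tau>. c * f \<tau>) = (\<lambda>\<tau>. c * mat_op a f \<tau>)"
  by (auto simp: mat_op_def fun_eq_iff sum_distrib_left intro!: sum.cong)

lemma mat_op_zero [simp]: "mat_op a 0 = 0"
  by (auto simp: mat_op_def fun_eq_iff)

lemma mat_op_cochain: "row_col_finite S a \<Longrightarrow> mat_op a f \<in> cochains S"
  by (auto simp: cochains_def mat_op_def row_col_finite_def intro!: sum.neutral)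

lemma mat_op_support:
  "{\<sigma>. mat_op a u \<sigma> \<noteq> 0} \<subseteq> (\<Union>\<tau>\<in>{\<tau>. u \<tau> \<noteq> 0}. {\<sigma>. a \<sigma> \<tau> \<noteq> 0})"
proof
  fix \<sigma> assume "\<sigma> \<in> {\<sigma>. mat_op a u \<sigma> \<noteq> 0}"
  then obtain \<tau> where "a \<sigma> \<tau> * u \<tau> \<noteq> 0"
    unfolding mat_op_def by (metis (mono_tags, lifting) mem_Collect_eq sum.neutral)
  then show "\<sigma> \<in> (\<Union>\<tau>\<in>{\<tau>. u \<tau> \<noteq> 0}. {\<sigma>. a \<sigma> \<tau> \<noteq> 0})" by auto
qed

lemma mat_op_fin:
  assumes "row_col_finite S a" "u \<in> fin_cochains S"
  shows "mat_op a u \<in> fin_cochains S"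
proof -
  have "finite (\<Union>\<tau>\<in>{\<tau>. u \<tau> \<noteq> 0}. {\<sigma>. a \<sigma> \<tau> \<noteq> 0})"
    using assms by (auto simp: fin_cochains_def row_col_finite_def)
  then have "finite {\<sigma>. mat_op a u \<sigma> \<noteq> 0}" by (rule rev_finite_subset) (rule mat_op_support)
  then show ?thesis using mat_op_cochain[OF assms(1)] by (auto simp: fin_cochains_def)
qed

text \<open>Only finitely many entries meet the support of \<open>u\<close>, so the exchange
  concerns finite sums and \<open>f\<close> may be arbitrary.\<close>

lemma mat_op_flip:
  assumes a: "row_col_finite S a" and u: "u \<in> fin_cochains S"
  shows "l2_inner S (mat_op a u) f = l2_inner S u (mat_op (flip a) f)"
proof -
  let ?B = "{\<tau>. u \<tau> \<noteq> 0}" let ?B' = "\<Union>\<tau>\<in>?B. {\<sigma>. a \<sigma> \<tau> \<noteq> 0}"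
  have fin: "finite ?B" using u by (auto simp: fin_cochains_def)
  then have fin': "finite ?B'" using a by (auto simp: row_col_finite_def)
  have "l2_inner S (mat_op a u) f = (\<Sum>\<sigma>\<in>?B'. mat_op a u \<sigma> * f \<sigma>)"
    using mat_op_support[of a u] mat_op_cochain[OF a] fin' by (intro l2_inner_finite) auto
  also have "\<dots> = (\<Sum>\<sigma>\<in>?B'. (\<Sum>\<tau>\<in>?B. a \<sigma> \<tau> * u \<tau>) * f \<sigma>)"
    unfolding mat_op_def using fin row_finite[OF a]
    by (intro sum.cong arg_cong2[of _ _ _ _ "(*)"] sum.mono_neutral_cong) auto
  also have "\<dots> = (\<Sum>\<tau>\<in>?B. \<Sum>\<sigma>\<in>?B'. a \<sigma> \<tau> * u \<tau> * f \<sigma>)"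
    by (subst sum.swap) (simp add: sum_distrib_right)
  also have "\<dots> = (\<Sum>\<tau>\<in>?B. u \<tau> * mat_op (flip a) f \<tau>)"
  proof (rule sum.cong)
    fix \<tau> assume "\<tau> \<in> ?B"
    then have "mat_op (flip a) f \<tau> = (\<Sum>\<sigma>\<in>?B'. a \<sigma> \<tau> * f \<sigma>)"
      using fin' by (intro mat_op_sum) auto
    then show "(\<Sum>\<sigma>\<in>?B'. a \<sigma> \<tau> * u \<tau> * f \<sigma>) = u \<tau> * mat_op (flip a) f \<tau>"
      by (auto simp: sum_distrib_left intro!: sum.cong)
  qed simp
  also have "\<dots> = l2_inner S u (mat_op (flip a) f)"
    using u fin by (intro l2_inner_finite[symmetric]) (auto simp: fin_cochain)
  finally show ?thesis .
qed

text \<open>Cauchy-Schwarz in a row costs a factor \<open>N\<close>; afterwards every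
  \<open>\<tau>\<close> is counted by at most \<open>N\<close> rows, which costs the second
  one.\<close>

lemma Schur_bound:
  assumes a: "row_col_finite S a" and le: "\<And>\<sigma> \<tau>. \<bar>a \<sigma> \<tau>\<bar> \<le> c"
    and row: "\<And>\<sigma>. \<sigma> \<in> S \<Longrightarrow> card {\<tau>. a \<sigma> \<tau> \<noteq> 0} \<le> N"
    and col: "\<And>\<tau>. \<tau> \<in> S \<Longrightarrow> card {\<sigma>. a \<sigma> \<tau> \<noteq> 0} \<le> N"
    and f: "f \<in> l2 S"
  shows "(l2_norm S (mat_op a f))\<^sup>2 \<le> (c * real N)\<^sup>2 * (l2_norm S f)\<^sup>2"
proof (rule l2_boundedI(2)[OF mat_op_cochain[OF a]])
  fix B assume B: "finite B" "B \<subseteq> S"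
  have csq: "(a \<sigma> \<tau>)\<^sup>2 \<le> c\<^sup>2" for \<sigma> \<tau>
    using power_mono[OF le[of \<sigma> \<tau>] abs_ge_zero, of 2] by simp
  let ?T = "\<Union>\<sigma>\<in>B. {\<tau>. a \<sigma> \<tau> \<noteq> 0}"
  have T: "finite ?T" "?T \<subseteq> S" using B a by (auto simp: row_col_finite_def)
  have "(\<Sum>\<sigma>\<in>B. (mat_op a f \<sigma>)\<^sup>2)
      \<le> (\<Sum>\<sigma>\<in>B. real N * c\<^sup>2 * (\<Sum>\<tau> | a \<sigma> \<tau> \<noteq> 0. (f \<tau>)\<^sup>2))"
  proof (rule sum_mono)
    fix \<sigma> assume "\<sigma> \<in> B"
    have "(mat_op a f \<sigma>)\<^sup>2 \<le> (\<Sum>\<tau> | a \<sigma> \<tau> \<noteq> 0. 1\<^sup>2) * (\<Sum>\<tau> | a \<sigma> \<tau> \<noteq> 0. (a \<sigma> \<tau> * f \<tau>)\<^sup>2)"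
      unfolding mat_op_def using Cauchy_Schwarz_ineq_sum[of "\<lambda>_. 1"] by simp
    also have "\<dots> \<le> real N * (\<Sum>\<tau> | a \<sigma> \<tau> \<noteq> 0. c\<^sup>2 * (f \<tau>)\<^sup>2)"
      using row[of \<sigma>] \<open>\<sigma> \<in> B\<close> B csq
      by (intro mult_mono sum_mono) (auto intro!: sum_nonneg mult_right_mono simp: power_mult_distrib)
    finally show "(mat_op a f \<sigma>)\<^sup>2 \<le> real N * c\<^sup>2 * (\<Sum>\<tau> | a \<sigma> \<tau> \<noteq> 0. (f \<tau>)\<^sup>2)"
      by (simp add: sum_distrib_left[symmetric] mult.assoc)
  qed
  also have "\<dots> = real N * c\<^sup>2 * (\<Sum>\<sigma>\<in>B. \<Sum>\<tau> | \<tau> \<in> ?T \<and> a \<sigma> \<tau> \<noteq> 0. (f \<tau>)\<^sup>2)"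
    by (auto simp: sum_distrib_left[symmetric] intro!: sum.cong)
  also have "(\<Sum>\<sigma>\<in>B. \<Sum>\<tau> | \<tau> \<in> ?T \<and> a \<sigma> \<tau> \<noteq> 0. (f \<tau>)\<^sup>2)
      = (\<Sum>\<tau>\<in>?T. \<Sum>\<sigma> | \<sigma> \<in> B \<and> a \<sigma> \<tau> \<noteq> 0. (f \<tau>)\<^sup>2)"
    by (rule sum.swap_restrict) (use T B in auto)
  also have "\<dots> \<le> (\<Sum>\<tau>\<in>?T. real N * (f \<tau>)\<^sup>2)"
  proof (rule sum_mono)
    fix \<tau> assume "\<tau> \<in> ?T"
    then have "card {\<sigma>. \<sigma> \<in> B \<and> a \<sigma> \<tau> \<noteq> 0} \<le> N"
      using T col[of \<tau>] card_mono[OF col_finite[OF a], of "{\<sigma>. \<sigma> \<in> B \<and> a \<sigma> \<tau> \<noteq> 0}" \<tau>] by fastforce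
    then show "(\<Sum>\<sigma> | \<sigma> \<in> B \<and> a \<sigma> \<tau> \<noteq> 0. (f \<tau>)\<^sup>2) \<le> real N * (f \<tau>)\<^sup>2"
      by (simp add: mult_right_mono)
  qed
  also have "\<dots> \<le> real N * (l2_norm S f)\<^sup>2"
    using l2_finite_sum_le[OF f T(1)] by (simp add: sum_distrib_left[symmetric] mult_left_mono)
  finally have "(\<Sum>\<sigma>\<in>B. (mat_op a f \<sigma>)\<^sup>2) \<le> real N * c\<^sup>2 * (real N * (l2_norm S f)\<^sup>2)"
    by (simp add: mult_left_mono)
  then show "(\<Sum>\<sigma>\<in>B. (mat_op a f \<sigma>)\<^sup>2) \<le> (c * real N)\<^sup>2 * (l2_norm S f)\<^sup>2"
    by (simp add: power_mult_distrib power2_eq_square mult_ac)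
qed

text \<open>These are the properties of a Laplacian that enter below: a closed form whose domain
  contains the finite cochains and whose value is the energy of the matrix \<open>a\<close>. Which
  boundary condition the domain encodes is left open.\<close>

locale matrix_form =
  fixes S :: "'v set set" and a :: "'v set \<Rightarrow> 'v set \<Rightarrow> real" and Q :: "'v form"
  assumes rcf: "row_col_finite S a"
    and closed: "closed_form S Q"
    and fin_dom: "fin_cochains S \<subseteq> fst Q"
    and dom_l2: "f \<in> fst Q \<Longrightarrow> mat_op a f \<in> l2 S"
    and form_eq: "f \<in> fst Q \<Longrightarrow> snd Q f = (l2_norm S (mat_op a f))\<^sup>2"
begin

definition L :: "('v set \<Rightarrow> real) \<Rightarrow> 'v set \<Rightarrow> real" where
  "L f = mat_op (flip a) (mat_op a f)"

lemma dom_in_l2: "f \<in> fst Q \<Longrightarrow> f \<in> l2 S"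
  using closed by (auto simp: closed_form_def nonneg_quadratic_form_def)

lemma dom_add: "f \<in> fst Q \<Longrightarrow> g \<in> fst Q \<Longrightarrow> f + g \<in> fst Q"
  using closed by (auto simp: closed_form_def nonneg_quadratic_form_def)

lemma dom_diff: "f \<in> fst Q \<Longrightarrow> g \<in> fst Q \<Longrightarrow> f - g \<in> fst Q"
proof -
  assume "f \<in> fst Q" "g \<in> fst Q"
  then have "f + (\<lambda>\<tau>. - 1 * g \<tau>) \<in> fst Q"
    using closed dom_add unfolding closed_form_def nonneg_quadratic_form_def by blast
  then show ?thesis by (simp add: fun_diff_def plus_fun_def)
qed

lemma polar_eq:
  assumes "f \<in> fst Q" "h \<in> fst Q"
  shows "form_polar Q f h = l2_inner S (mat_op a f) (mat_op a h)"
  using assms by (simp add: form_polar_def form_eq dom_add dom_diff mat_op_add mat_op_diff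
      l2_norm_add_sq l2_norm_diff_sq dom_l2)

lemma L_fin: "u \<in> fin_cochains S \<Longrightarrow> L u \<in> fin_cochains S"
  by (simp add: L_def mat_op_fin rcf row_col_finite_flip)

text \<open>The matrix acting on \<open>h\<close> is transposed onto \<open>mat_op a u\<close>,
  which has finite support, so the same \<open>L u\<close> represents the form whatever its domain
  is; uniqueness follows by testing with indicators.\<close>

lemma form_operator_fin:
  assumes u: "u \<in> fin_cochains S"
  shows "(u, g) \<in> form_operator S Q \<longleftrightarrow> g = L u"
proof -
  have Lu: "form_polar Q u h = l2_inner S (L u) h" if "h \<in> fst Q" for h
    using polar_eq[of u h] that u fin_dom mat_op_flip[OF row_col_finite_flip[OF rcf] mat_op_fin[OF rcf u]]
    by (auto simp: L_def)
  show ?thesis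
  proof
    assume g: "(u, g) \<in> form_operator S Q"
    show "g = L u"
    proof
      fix \<tau>
      show "g \<tau> = L u \<tau>"
      proof (cases "\<tau> \<in> S")
        case True
        then have "indicat_real {\<tau>} \<in> fst Q" using fin_dom indicator_fin_cochain by auto
        then have "l2_inner S g (indicat_real {\<tau>}) = l2_inner S (L u) (indicat_real {\<tau>})"
          using g Lu by (auto simp: form_operator_def)
        then show ?thesis
          using True by (simp add: l2_inner_commute[of S _ "indicat_real {\<tau>}"] l2_inner_indicator)
      next
        case False
        moreover have "g \<in> cochains S" using g by (auto simp: form_operator_def l2_cochain)
        ultimately show ?thesis using cochain_outside[OF fin_cochain[OF L_fin[OF u]]] cochain_outside
          by metis
      qed
    qed
  next
    assume "g = L u"
    then show "(u, g) \<in> form_operator S Q"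
      using u fin_dom fin_cochains_l2[OF L_fin[OF u]] by (auto simp: form_operator_def Lu)
  qed
qed

lemma fin_cochains_in_domain: "fin_cochains S \<subseteq> Domain (form_operator S Q)"
proof
  fix u assume "u \<in> fin_cochains S"
  from form_operator_fin[OF this, of "L u"] show "u \<in> Domain (form_operator S Q)" by auto
qed

lemma restrict_fin_eq: "restrict_fin S (form_operator S Q) = {(u, L u) |u. u \<in> fin_cochains S}"
proof (intro set_eqI)
  fix x :: "('v set \<Rightarrow> real) \<times> ('v set \<Rightarrow> real)"
  show "x \<in> restrict_fin S (form_operator S Q) \<longleftrightarrow> x \<in> {(u, L u) |u. u \<in> fin_cochains S}"
    using form_operator_fin[of "fst x" "snd x"] by (cases x) (auto simp: restrict_fin_def)
qed

lemma essentially_self_adjoint_restrict: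
  assumes "\<mu> > 0" and "\<And>f. f \<in> l2 S \<Longrightarrow> L f = (\<lambda>\<tau>. - \<mu> * f \<tau>) \<Longrightarrow> f = 0"
  shows "essentially_self_adjoint S (restrict_fin S (form_operator S Q))"
proof -
  interpret nonneg_symmetric S L
  proof
    fix u f assume u: "u \<in> fin_cochains S"
    note tr = mat_op_flip[OF row_col_finite_flip[OF rcf] mat_op_fin[OF rcf u]]
    show "l2_inner S (L u) f = l2_inner S u (L f)"
      by (simp add: L_def tr mat_op_flip[OF rcf u])
    show "0 \<le> l2_inner S (L u) u"
      by (simp add: L_def tr l2_norm_sq[symmetric])
  qed (auto simp: L_def mat_op_add mat_op_scale mat_op_cochain mat_op_fin row_col_finite_flip rcf)
  show ?thesis
    using essentially_self_adjoint_if_kernel_trivial[OF assms] by (simp add: A_def restrict_fin_eq)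
qed

lemma bounded_imp_form_bounded:
  assumes "bounded_op S (form_operator S Q)"
  obtains C where "\<And>u. u \<in> fin_cochains S \<Longrightarrow> (l2_norm S (mat_op a u))\<^sup>2 \<le> C * (l2_norm S u)\<^sup>2"
proof -
  obtain C where C: "\<And>f g. (f, g) \<in> form_operator S Q \<Longrightarrow> l2_norm S g \<le> C * l2_norm S f"
    using assms by (auto simp: bounded_op_def)
  have "(l2_norm S (mat_op a u))\<^sup>2 \<le> C * (l2_norm S u)\<^sup>2" if u: "u \<in> fin_cochains S" for u
  proof -
    have "(l2_norm S (mat_op a u))\<^sup>2 = l2_inner S (L u) u"
      by (simp add: L_def mat_op_flip[OF row_col_finite_flip[OF rcf] mat_op_fin[OF rcf u]]
          l2_norm_sq)
    also have "\<dots> \<le> l2_norm S (L u) * l2_norm S u"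
      using l2_Cauchy_Schwarz[of "L u" S u] u L_fin by (simp add: fin_cochains_l2)
    also have "\<dots> \<le> C * l2_norm S u * l2_norm S u"
      using C[of u "L u"] form_operator_fin[OF u] by (intro mult_right_mono) auto
    finally show ?thesis by (simp add: power2_eq_square mult.assoc)
  qed
  then show ?thesis by (rule that)
qed

text \<open>The image \<open>g\<close> is known only through its pairing with the form domain.
  Truncations \<open>h\<close> of \<open>g\<close> to finite sets lie there and satisfy
  \<open>l2_inner S g h = l2_inner S h h\<close>, so each of them, hence \<open>g\<close>, has norm
  at most \<open>C\<^sup>2 * l2_norm S f\<close>.\<close>

lemma form_bounded_imp_bounded:
  assumes C: "C \<ge> 0" and bd: "\<And>f. f \<in> l2 S \<Longrightarrow> (l2_norm S (mat_op a f))\<^sup>2 \<le> C\<^sup>2 * (l2_norm S f)\<^sup>2"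
  shows "bounded_op S (form_operator S Q)"
  unfolding bounded_op_def
proof (intro exI[of _ "C\<^sup>2"] ballI, clarify)
  fix f g assume fg: "(f, g) \<in> form_operator S Q"
  then have f: "f \<in> fst Q" "f \<in> l2 S" and g: "g \<in> l2 S" by (auto simp: form_operator_def dom_in_l2)
  have bd': "l2_norm S (mat_op a h) \<le> C * l2_norm S h" if "h \<in> l2 S" for h
    by (rule power2_le_imp_le) (use bd[OF that] C in \<open>auto simp: power_mult_distrib\<close>)
  have key: "l2_norm S h \<le> C\<^sup>2 * l2_norm S f" if h: "h \<in> fin_cochains S" "l2_inner S g h = l2_inner S h h" for h
  proof -
    have hQ: "h \<in> fst Q" using h fin_dom by auto
    have "(l2_norm S h)\<^sup>2 = l2_inner S (mat_op a f) (mat_op a h)"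
      using fg h hQ polar_eq[OF f(1) hQ] by (auto simp: form_operator_def l2_norm_sq)
    also have "\<dots> \<le> l2_norm S (mat_op a f) * l2_norm S (mat_op a h)"
      using l2_Cauchy_Schwarz[OF dom_l2[OF f(1)] dom_l2[OF hQ]] by simp
    also have "\<dots> \<le> (C * l2_norm S f) * (C * l2_norm S h)"
      using bd'[OF f(2)] bd'[OF dom_in_l2[OF hQ]] C by (intro mult_mono) auto
    finally have "l2_norm S h * l2_norm S h \<le> C\<^sup>2 * l2_norm S f * l2_norm S h"
      by (simp add: power2_eq_square mult_ac)
    then show ?thesis
      using l2_norm_nonneg[of S h] C by (cases "l2_norm S h = 0") (auto simp: mult_le_cancel_right)
  qed
  have "(l2_norm S g)\<^sup>2 \<le> (C\<^sup>2 * l2_norm S f)\<^sup>2"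
  proof (rule l2_boundedI(2)[OF l2_cochain[OF g]])
    fix B :: "'v set set" assume B: "finite B" "B \<subseteq> S"
    let ?h = "\<lambda>\<tau>. if \<tau> \<in> B then g \<tau> else 0"
    have h: "?h \<in> fin_cochains S" using B g by (intro l2_truncation l2_cochain)
    have eq: "l2_inner S ?h k = (\<Sum>\<tau>\<in>B. g \<tau> * k \<tau>)" for k
      using B fin_cochain[OF h] by (subst l2_inner_finite[of B]) auto
    have "l2_norm S ?h \<le> C\<^sup>2 * l2_norm S f"
      using key[OF h] eq[of g] eq[of ?h] by (simp add: l2_inner_commute[of S g])
    then have "(l2_norm S ?h)\<^sup>2 \<le> (C\<^sup>2 * l2_norm S f)\<^sup>2" by (intro power_mono) auto
    moreover have "l2_inner S ?h ?h = (\<Sum>\<tau>\<in>B. (g \<tau>)\<^sup>2)"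
      unfolding eq by (intro sum.cong) (auto simp: power2_eq_square)
    ultimately show "(\<Sum>\<tau>\<in>B. (g \<tau>)\<^sup>2) \<le> (C\<^sup>2 * l2_norm S f)\<^sup>2"
      by (simp only: l2_norm_sq)
  qed
  then show "l2_norm S g \<le> C\<^sup>2 * l2_norm S f" by (rule power2_le_imp_le) simp
qed

end

subsection \<open>Incidence matrices\<close>

lemma covered_iff: "\<tau> \<lessdot> \<sigma> \<longleftrightarrow> (\<exists>x. x \<notin> \<tau> \<and> \<sigma> = insert x \<tau>)"
proof
  assume "\<tau> \<lessdot> \<sigma>"
  then obtain x where "\<tau> \<subseteq> \<sigma>" "\<sigma> - \<tau> = {x}" by (auto simp: covered_def card_1_singleton_iff)
  then show "\<exists>x. x \<notin> \<tau> \<and> \<sigma> = insert x \<tau>" by (intro exI[of _ x]) auto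
next
  assume "\<exists>x. x \<notin> \<tau> \<and> \<sigma> = insert x \<tau>"
  then obtain x where "x \<notin> \<tau>" "\<sigma> = insert x \<tau>" by auto
  then have "\<sigma> - \<tau> = {x}" "\<tau> \<subseteq> \<sigma>" by auto
  then show "\<tau> \<lessdot> \<sigma>" by (simp add: covered_def)
qed

lemma covered_card: "\<tau> \<lessdot> \<sigma> \<Longrightarrow> finite \<tau> \<Longrightarrow> card \<sigma> = Suc (card \<tau>)"
  by (auto simp: covered_iff)

lemma mat_op_plus:
  assumes "row_col_finite S a" "row_col_finite S b"
  shows "mat_op (\<lambda>\<sigma> \<tau>. a \<sigma> \<tau> + b \<sigma> \<tau>) f = mat_op a f + mat_op b f"
proof
  fix \<sigma>
  let ?N = "{\<tau>. a \<sigma> \<tau> \<noteq> 0} \<union> {\<tau>. b \<sigma> \<tau> \<noteq> 0}"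
  have N: "finite ?N" using assms by (simp add: row_finite)
  have "mat_op (\<lambda>\<sigma> \<tau>. a \<sigma> \<tau> + b \<sigma> \<tau>) f \<sigma> = (\<Sum>\<tau>\<in>?N. (a \<sigma> \<tau> + b \<sigma> \<tau>) * f \<tau>)"
    by (rule mat_op_sum[OF N]) auto
  also have "\<dots> = mat_op a f \<sigma> + mat_op b f \<sigma>"
    by (subst (1 2) mat_op_sum[OF N]) (auto simp: distrib_right sum.distrib)
  finally show "mat_op (\<lambda>\<sigma> \<tau>. a \<sigma> \<tau> + b \<sigma> \<tau>) f \<sigma> = (mat_op a f + mat_op b f) \<sigma>" by simp
qed

locale unit_weight_complex =
  fixes V :: "'v set" and K S :: "'v set set"
    and \<delta> :: "('v set \<Rightarrow> real) \<Rightarrow> 'v set \<Rightarrow> real"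
  assumes complex: "abstract_simplicial_complex V K"
    and S_def: "S = simplices K"
    and findim: "finite_dimensional K"
    and locsum: "locally_summable S"
    and cobd: "coboundary S \<delta>"
begin

section \<open>Finiteness of faces, cofaces and dimension\<close>

lemma S_subset_K: "S \<subseteq> K"
  by (auto simp: S_def simplices_def)

lemma S_finite: "\<tau> \<in> S \<Longrightarrow> finite \<tau>"
  using complex S_subset_K by (auto simp: abstract_simplicial_complex_def)

lemma S_subset: "\<tau> \<in> S \<Longrightarrow> \<rho> \<subseteq> \<tau> \<Longrightarrow> \<rho> \<noteq> {} \<Longrightarrow> \<rho> \<in> S"
  using complex unfolding S_def simplices_def abstract_simplicial_complex_def
  by (metis Diff_iff singletonD)

text \<open>Finitely many vertices leave room for only finitely many simplices, and the empty
  simplex is kept in no other case. Later arguments split along this dichotomy: either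
  \<open>S\<close> is finite or every simplex has a vertex.\<close>

lemma finite_or_no_empty: "finite S \<or> {} \<notin> S"
proof (cases "finite {\<tau>\<in>K. sdim \<tau> = 0}")
  case True
  have "\<tau> \<subseteq> \<Union> {\<tau>\<in>K. sdim \<tau> = 0}" if "\<tau> \<in> K" for \<tau>
  proof
    fix x assume "x \<in> \<tau>"
    then have "{x} \<in> K" using complex that unfolding abstract_simplicial_complex_def by blast
    then show "x \<in> \<Union> {\<tau>\<in>K. sdim \<tau> = 0}" by (auto simp: sdim_def)
  qed
  then have "K \<subseteq> Pow (\<Union> {\<tau>\<in>K. sdim \<tau> = 0})" by auto
  moreover have "finite (\<Union> {\<tau>\<in>K. sdim \<tau> = 0})"
    using True complex by (auto simp: abstract_simplicial_complex_def)
  ultimately have "finite K" by (meson finite_Pow_iff finite_subset)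
  then show ?thesis using S_subset_K finite_subset by auto
next
  case False
  then show ?thesis by (auto simp: S_def simplices_def)
qed

lemma card_bound: obtains d where "\<And>\<tau>. \<tau> \<in> S \<Longrightarrow> card \<tau> \<le> d"
proof -
  from findim obtain M where M: "\<And>\<tau>. \<tau> \<in> K \<Longrightarrow> sdim \<tau> \<le> M"
    by (auto simp: finite_dimensional_def bdd_above_def)
  have "card \<tau> \<le> nat (M + 1)" if "\<tau> \<in> S" for \<tau>
    using M[of \<tau>] that S_subset_K by (auto simp: sdim_def)
  then show ?thesis by (rule that)
qed

lemma finite_faces: "\<sigma> \<in> S \<Longrightarrow> finite (faces S \<sigma>)"
  by (rule finite_subset[of _ "Pow \<sigma>"]) (auto simp: faces_def covered_def S_finite)

lemma finite_cofaces: "\<tau> \<in> S \<Longrightarrow> finite (cofaces S \<tau>)"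
  using locsum by (auto simp: locally_summable_def)

text \<open>A face arises by deleting one vertex. Equality may fail for a vertex, whose face
  \<open>{}\<close> need not be in \<open>S\<close>.\<close>

lemma card_faces_le: "\<sigma> \<in> S \<Longrightarrow> card (faces S \<sigma>) \<le> card \<sigma>"
proof -
  assume "\<sigma> \<in> S"
  moreover have "faces S \<sigma> \<subseteq> (\<lambda>x. \<sigma> - {x}) ` \<sigma>" by (auto simp: faces_def covered_iff)
  ultimately show ?thesis by (meson S_finite card_image_le card_mono finite_imageI le_trans)
qed

text \<open>Outside \<open>S\<close> nothing is known about \<open>theta\<close>, hence the
  extension by zero. Rows are indexed by the smaller simplex, so this is the matrix of the boundary
  operator, and its transpose is that of \<delta>.\<close>

definition inc :: "'v set \<Rightarrow> 'v set \<Rightarrow> real" where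
  "inc \<rho> \<tau> = (if \<rho> \<in> S \<and> \<tau> \<in> S then theta \<delta> \<rho> \<tau> else 0)"

lemma inc_nonzero_iff: "inc \<rho> \<tau> \<noteq> 0 \<longleftrightarrow> \<rho> \<in> S \<and> \<tau> \<in> S \<and> \<rho> \<lessdot> \<tau>"
  using cobd by (auto simp: inc_def coboundary_def)

lemma inc_values: "inc \<rho> \<tau> \<in> {-1, 0, 1}"
  using cobd by (auto simp: inc_def coboundary_def)

lemma abs_inc_le: "\<bar>inc \<rho> \<tau>\<bar> \<le> 1"
  using inc_values[of \<rho> \<tau>] by auto

lemma inc_sq: "\<rho> \<in> S \<Longrightarrow> \<tau> \<in> S \<Longrightarrow> \<rho> \<lessdot> \<tau> \<Longrightarrow> inc \<rho> \<tau> * inc \<rho> \<tau> = 1"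
  using inc_values[of \<rho> \<tau>] inc_nonzero_iff[of \<rho> \<tau>] by auto

text \<open>Covering holds in at most one direction, so an entry of the Hodge matrix is a single
  incidence number and not a sum of two signs.\<close>

lemma inc_antisym: "inc \<rho> \<tau> \<noteq> 0 \<Longrightarrow> inc \<tau> \<rho> = 0"
  using inc_nonzero_iff[of \<rho> \<tau>] inc_nonzero_iff[of \<tau> \<rho>] by (auto simp: covered_iff)

lemma inc_row: "\<rho> \<in> S \<Longrightarrow> {\<tau>. inc \<rho> \<tau> \<noteq> 0} = cofaces S \<rho>"
  by (auto simp: inc_nonzero_iff cofaces_def)

lemma inc_col: "\<tau> \<in> S \<Longrightarrow> {\<rho>. inc \<rho> \<tau> \<noteq> 0} = faces S \<tau>"
  by (auto simp: inc_nonzero_iff faces_def)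

text \<open>A row lists the cofaces of a simplex and is finite by local summability; a column lists
  its faces and is finite because simplices are.\<close>

lemma inc_rcf: "row_col_finite S inc"
proof -
  have "finite {\<tau>. inc \<rho> \<tau> \<noteq> 0}" for \<rho>
    using finite_cofaces[of \<rho>] by (cases "\<rho> \<in> S") (simp_all only: inc_row, simp add: inc_nonzero_iff)
  moreover have "finite {\<rho>. inc \<rho> \<tau> \<noteq> 0}" for \<tau>
    using finite_faces[of \<tau>] by (cases "\<tau> \<in> S") (simp_all only: inc_col, simp add: inc_nonzero_iff)
  ultimately show ?thesis by (auto simp: row_col_finite_def inc_nonzero_iff)
qed

abbreviation cob :: "('v set \<Rightarrow> real) \<Rightarrow> 'v set \<Rightarrow> real" where
  "cob \<equiv> mat_op (\<lambda>\<sigma> \<tau>. inc \<tau> \<sigma>)"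

abbreviation bdr :: "('v set \<Rightarrow> real) \<Rightarrow> 'v set \<Rightarrow> real" where
  "bdr \<equiv> mat_op inc"

lemma cob_cochain: "cob f \<in> cochains S"
  by (rule mat_op_cochain[OF row_col_finite_flip[OF inc_rcf]])

lemma bdr_cochain: "bdr f \<in> cochains S"
  by (rule mat_op_cochain[OF inc_rcf])

lemma cob_eq:
  assumes "f \<in> cochains S" shows "\<delta> f = cob f"
proof
  fix \<sigma>
  show "\<delta> f \<sigma> = cob f \<sigma>"
  proof (cases "\<sigma> \<in> S")
    case True
    then have "\<delta> f \<sigma> = (\<Sum>\<tau>\<in>faces S \<sigma>. f \<tau> * theta \<delta> \<tau> \<sigma>)"
      using cobd assms by (auto simp: coboundary_def)
    also have "\<dots> = cob f \<sigma>"
      unfolding mat_op_def inc_col[OF True]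
      using True by (intro sum.cong) (auto simp: inc_def faces_def)
    finally show ?thesis .
  next
    case False
    moreover have "\<delta> f \<in> cochains S" using cobd assms by (auto simp: coboundary_def)
    ultimately show ?thesis using False by (simp add: cochain_outside[of _ S] cob_cochain)
  qed
qed

lemma bdr_eq: "boundary S \<delta> f = bdr f"
proof
  fix \<rho>
  show "boundary S \<delta> f \<rho> = bdr f \<rho>"
  proof (cases "\<rho> \<in> S")
    case True
    then have "boundary S \<delta> f \<rho> = (\<Sum>\<tau>\<in>cofaces S \<rho>. f \<tau> * theta \<delta> \<rho> \<tau>)"
      by (simp add: boundary_def finite_cofaces)
    also have "\<dots> = bdr f \<rho>"
      unfolding mat_op_def inc_row[OF True]
      using True by (intro sum.cong) (auto simp: inc_def cofaces_def)
    finally show ?thesis .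
  next
    case False
    then show ?thesis by (simp add: cochain_outside[OF bdr_cochain] boundary_def)
  qed
qed

lemma cob_cob:
  assumes "f \<in> cochains S" shows "cob (cob f) = 0"
proof -
  have "\<delta> (\<delta> f) = 0" using cobd assms by (auto simp: coboundary_def)
  then show ?thesis using assms by (simp add: cob_eq cob_cochain)
qed

text \<open>Only \<delta>\<delta> = 0 is given. Pairing with the indicator of \<open>\<tau>\<close>
  and transposing twice moves the claim to the coboundary side; this works for every
  \<open>f\<close>, as the indicator has finite support.\<close>

lemma bdr_bdr: "bdr (bdr f) = 0"
proof
  fix \<tau>
  show "bdr (bdr f) \<tau> = 0 \<tau>"
  proof (cases "\<tau> \<in> S")
    case True
    note iF = indicator_fin_cochain[OF True]
    note rcf' = row_col_finite_flip[OF inc_rcf]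
    have "bdr (bdr f) \<tau> = l2_inner S (indicat_real {\<tau>}) (bdr (bdr f))"
      using True by (simp add: l2_inner_indicator)
    also have "\<dots> = l2_inner S (cob (cob (indicat_real {\<tau>}))) f"
      by (simp add: mat_op_flip[OF rcf' iF] mat_op_flip[OF rcf' mat_op_fin[OF rcf' iF]])
    also have "\<dots> = 0" by (simp add: cob_cob fin_cochain[OF iF] l2_inner_def)
    finally show ?thesis by simp
  next
    case False
    then show ?thesis by (simp add: cochain_outside[OF bdr_cochain])
  qed
qed

text \<open>The matrix whose operator is \<open>energy_op\<close>; with it the three kinds of
  Laplacian become instances of \<open>matrix_form\<close>.\<close>

definition ent :: "lap_kind \<Rightarrow> 'v set \<Rightarrow> 'v set \<Rightarrow> real" where
  "ent k = (case k of Plus \<Rightarrow> (\<lambda>\<sigma> \<tau>. inc \<tau> \<sigma>) | Minus \<Rightarrow> inc | Hodge \<Rightarrow> (\<lambda>\<sigma> \<tau>. inc \<tau> \<sigma> + inc \<sigma> \<tau>))"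

lemma ent_nonzero: "ent k \<sigma> \<tau> \<noteq> 0 \<Longrightarrow> inc \<tau> \<sigma> \<noteq> 0 \<or> inc \<sigma> \<tau> \<noteq> 0"
  by (cases k) (auto simp: ent_def)

lemma ent_rcf: "row_col_finite S (ent k)"
proof -
  have "finite ({\<tau>. inc \<tau> \<sigma> \<noteq> 0} \<union> {\<tau>. inc \<sigma> \<tau> \<noteq> 0})" for \<sigma>
    using inc_rcf by (simp add: row_finite col_finite)
  then have "finite {\<tau>. ent k \<sigma> \<tau> \<noteq> 0}" "finite {\<tau>. ent k \<tau> \<sigma> \<noteq> 0}" for \<sigma>
    by (rule rev_finite_subset, use ent_nonzero[of k] in blast)+
  then show ?thesis
    using ent_nonzero[of k] inc_nonzero_iff unfolding row_col_finite_def by blast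
qed

lemma hodge_ent: "mat_op (\<lambda>\<sigma> \<tau>. inc \<tau> \<sigma> + inc \<sigma> \<tau>) f = cob f + bdr f"
  by (rule mat_op_plus[OF row_col_finite_flip[OF inc_rcf] inc_rcf])

lemma energy_op_eq: "f \<in> cochains S \<Longrightarrow> energy_op S \<delta> k f = mat_op (ent k) f"
  by (cases k) (simp_all add: ent_def cob_eq bdr_eq hodge_ent)

text \<open>Local summability makes each family of cofaces finite, so summability over it is
  automatic.\<close>

lemma energy_dom_eq: "energy_dom S k = cochains S"
  by (cases k) (auto simp: cochains1_def finite_cofaces)

lemma neumann_dom: "fst (neumann_form S \<delta> k) = {f \<in> l2 S. mat_op (ent k) f \<in> l2 S}"
  by (auto simp: neumann_form_def energy_dom_eq energy_op_eq l2_cochain)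

lemma neumann_form_val: "f \<in> cochains S \<Longrightarrow> snd (neumann_form S \<delta> k) f = (l2_norm S (mat_op (ent k) f))\<^sup>2"
  by (simp add: neumann_form_def energy_op_eq)

lemma fin_in_dirichlet: "fin_cochains S \<subseteq> fst (dirichlet_form S \<delta> k)"
proof
  fix u assume u: "u \<in> fin_cochains S"
  have "form_norm S (neumann_form S \<delta> k) (u - u) = 0"
    using l2_norm_zero_iff[OF l2_zero, of S] by (simp add: form_norm_def neumann_form_val cochains_zero)
  then show "u \<in> fst (dirichlet_form S \<delta> k)"
    using u neumann_dom[of k] fin_cochains_l2[OF u] fin_cochains_l2[OF mat_op_fin[OF ent_rcf u]]
    unfolding dirichlet_form_def by (auto intro!: exI[of _ "\<lambda>_. u"])
qed

text \<open>The two inclusions play different roles: the Dirichlet form puts the finite cochains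
  into the domain of \<open>Q\<close>, the Neumann form fixes the values of \<open>Q\<close> and
  makes the energy finite.\<close>

lemma laplacian_matrix_form:
  assumes "is_laplacian S \<delta> k \<Delta>"
  obtains Q where "matrix_form S (ent k) Q" "\<Delta> = form_operator S Q"
proof -
  from assms obtain Q where Q: "closed_form S Q" "form_sub (dirichlet_form S \<delta> k) Q"
    "form_sub Q (neumann_form S \<delta> k)" "\<Delta> = form_operator S Q" by (auto simp: is_laplacian_def)
  have "matrix_form S (ent k) Q"
  proof
    show "fin_cochains S \<subseteq> fst Q" using fin_in_dirichlet Q by (auto simp: form_sub_def)
    fix f assume "f \<in> fst Q"
    then have f: "f \<in> fst (neumann_form S \<delta> k)" "snd Q f = snd (neumann_form S \<delta> k) f"
      using Q by (auto simp: form_sub_def)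
    then show "mat_op (ent k) f \<in> l2 S" by (simp add: neumann_dom)
    show "snd Q f = (l2_norm S (mat_op (ent k) f))\<^sup>2"
      using f by (simp add: neumann_dom neumann_form_val l2_cochain)
  qed (use ent_rcf Q in auto)
  with Q show ?thesis using that by blast
qed

subsection \<open>Boundedness and the vertex degree\<close>

lemma deg_eq: "deg S v = card (cofaces S {v})"
  unfolding deg_def cofaces_def ksimplices_def
  by (rule arg_cong[of _ _ card]) (auto simp: sdim_def dest: covered_card)

lemma vertex_iff: "v \<in> vertices S \<longleftrightarrow> {v} \<in> S"
  by (auto simp: vertices_def ksimplices_def sdim_def)

lemma vertex_of: "\<tau> \<in> S \<Longrightarrow> v \<in> \<tau> \<Longrightarrow> v \<in> vertices S"
  by (auto simp: vertex_iff intro: S_subset)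

text \<open>A coface of \<open>\<tau>\<close> adds one vertex x, and then {v, x} is an edge; the
  edge determines the coface as its union with \<open>\<tau>\<close>.\<close>

lemma card_cofaces_le_deg:
  assumes "\<tau> \<in> S" "v \<in> \<tau>" shows "card (cofaces S \<tau>) \<le> deg S v"
  unfolding deg_eq
proof (rule card_inj_on_le)
  show "inj_on (\<lambda>\<sigma>. insert v (\<sigma> - \<tau>)) (cofaces S \<tau>)"
    using assms by (intro inj_on_inverseI[of _ "\<lambda>e. e \<union> \<tau>"]) (auto simp: cofaces_def covered_iff)
  show "(\<lambda>\<sigma>. insert v (\<sigma> - \<tau>)) ` cofaces S \<tau> \<subseteq> cofaces S {v}"
  proof clarify
    fix \<sigma> assume "\<sigma> \<in> cofaces S \<tau>"
    then obtain x where x: "x \<notin> \<tau>" "\<sigma> = insert x \<tau>" "\<sigma> \<in> S" by (auto simp: cofaces_def covered_iff)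
    then have "insert v (\<sigma> - \<tau>) = insert x {v}" using assms by auto
    moreover have "insert x {v} \<in> S" using x assms by (intro S_subset[OF x(3)]) auto
    ultimately show "insert v (\<sigma> - \<tau>) \<in> cofaces S {v}"
      using x assms by (auto simp: cofaces_def covered_iff)
  qed
  show "finite (cofaces S {v})"
    using assms by (intro finite_cofaces) (auto intro: S_subset)
qed

lemma deg_bounded_imp_form_bounded:
  assumes "bdd_above (deg S ` vertices S)"
  obtains C where "C \<ge> 0" "\<And>f. f \<in> l2 S \<Longrightarrow> (l2_norm S (mat_op (ent k) f))\<^sup>2 \<le> C\<^sup>2 * (l2_norm S f)\<^sup>2"
proof -
  from assms obtain D where D: "\<And>v. v \<in> vertices S \<Longrightarrow> deg S v \<le> D" by (auto simp: bdd_above_def)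
  obtain d where d: "\<And>\<tau>. \<tau> \<in> S \<Longrightarrow> card \<tau> \<le> d" using card_bound by blast
  \<comment> \<open>The term \<open>card S\<close> serves the empty simplex, whose cofaces are the
    vertices: it can occur only if \<open>S\<close> is finite. For infinite \<open>S\<close> the
    value of \<open>card S\<close> is 0.\<close>
  have co: "card (cofaces S \<tau>) \<le> D + card S" if "\<tau> \<in> S" for \<tau>
  proof (cases "\<tau> = {}")
    case True
    then have "finite S" using that finite_or_no_empty by auto
    then have "card (cofaces S \<tau>) \<le> card S" by (intro card_mono) (auto simp: cofaces_def)
    then show ?thesis by simp
  next
    case False
    then obtain v where "v \<in> \<tau>" by auto
    then show ?thesis using card_cofaces_le_deg[OF that] D[OF vertex_of[OF that]] le_trans by fastforce
  qed
  let ?N = "d + D + card S"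
  have nb: "card A \<le> ?N" if "\<sigma> \<in> S" "A \<subseteq> faces S \<sigma> \<union> cofaces S \<sigma>" for \<sigma> A
  proof -
    have "card A \<le> card (faces S \<sigma> \<union> cofaces S \<sigma>)"
      using that by (intro card_mono) (auto simp: finite_faces finite_cofaces)
    also have "\<dots> \<le> card (faces S \<sigma>) + card (cofaces S \<sigma>)" by (rule card_Un_le)
    finally show ?thesis using co[OF that(1)] d[OF that(1)] card_faces_le[OF that(1)] by linarith
  qed
  have ab: "\<bar>ent k \<sigma> \<tau>\<bar> \<le> 2" for \<sigma> \<tau>
    using abs_inc_le[of \<sigma> \<tau>] abs_inc_le[of \<tau> \<sigma>] by (cases k) (auto simp: ent_def)
  have "(l2_norm S (mat_op (ent k) f))\<^sup>2 \<le> (2 * real ?N)\<^sup>2 * (l2_norm S f)\<^sup>2" if "f \<in> l2 S" for f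
  proof (rule Schur_bound[OF ent_rcf ab _ _ that])
    fix \<sigma> assume "\<sigma> \<in> S"
    then have sub: "{\<tau>. inc \<tau> \<sigma> \<noteq> 0 \<or> inc \<sigma> \<tau> \<noteq> 0} \<subseteq> faces S \<sigma> \<union> cofaces S \<sigma>"
      by (auto simp: inc_nonzero_iff faces_def cofaces_def)
    show "card {\<tau>. ent k \<sigma> \<tau> \<noteq> 0} \<le> ?N" "card {\<tau>. ent k \<tau> \<sigma> \<noteq> 0} \<le> ?N"
      using sub ent_nonzero by (auto intro!: nb[OF \<open>\<sigma> \<in> S\<close>])
  qed
  then show ?thesis using that[of "2 * real ?N"] by simp
qed

text \<open>If the energy contains \<delta>, the indicator of a vertex has norm one and its image
  has value 1 or -1 on every edge at it. For \<partial> the roles change: the signed star of edges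
  at \<open>v\<close> has squared norm \<open>deg S v\<close>, and its boundary has value
  \<open>deg S v\<close> at \<open>v\<close>.\<close>

lemma form_bounded_imp_deg_bounded:
  assumes C: "\<And>u. u \<in> fin_cochains S \<Longrightarrow> (l2_norm S (mat_op (ent k) u))\<^sup>2 \<le> C * (l2_norm S u)\<^sup>2"
  shows "bdd_above (deg S ` vertices S)"
proof -
  have "real (deg S v) \<le> C" if v: "v \<in> vertices S" for v
  proof -
    let ?N = "cofaces S {v}"
    have vS: "{v} \<in> S" using v by (simp add: vertex_iff)
    have N: "finite ?N" by (rule finite_cofaces[OF vS])
    show ?thesis
    proof (cases "k = Minus")
      case True
      \<comment> \<open>Weighting each edge by its own sign prevents cancellation in the boundary at
        \<open>v\<close>.\<close>
      define u where "u = (\<lambda>\<sigma>. if \<sigma> \<in> ?N then inc {v} \<sigma> else 0)"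
      have u: "u \<in> fin_cochains S"
        unfolding u_def using N by (intro l2_truncation) (auto simp: cochains_def inc_def)
      have "(l2_norm S u)\<^sup>2 = (\<Sum>\<sigma>\<in>?N. inc {v} \<sigma> * inc {v} \<sigma>)"
        unfolding l2_norm_sq
        using N fin_cochain[OF u] by (subst l2_inner_finite[of ?N]) (auto simp: u_def)
      also have "\<dots> = real (deg S v)"
        unfolding deg_eq using vS by (simp add: inc_sq cofaces_def)
      finally have norm: "(l2_norm S u)\<^sup>2 = real (deg S v)" .
      have "mat_op (ent k) u {v} = (\<Sum>\<sigma>\<in>?N. inc {v} \<sigma> * inc {v} \<sigma>)"
        using True vS by (simp add: ent_def mat_op_def inc_row) (simp add: u_def)
      also have "\<dots> = real (deg S v)"
        unfolding deg_eq using vS by (simp add: inc_sq cofaces_def)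
      finally have "(real (deg S v))\<^sup>2 \<le> (l2_norm S (mat_op (ent k) u))\<^sup>2"
        using l2_finite_sum_le[OF fin_cochains_l2[OF mat_op_fin[OF ent_rcf u]], of "{{v}}" k] by simp
      also have "\<dots> \<le> C * real (deg S v)" using C[OF u] norm by simp
      finally have "real (deg S v) * real (deg S v) \<le> C * real (deg S v)"
        by (simp add: power2_eq_square)
      \<comment> \<open>Needed for a vertex without edges, where the degree cannot be
        cancelled.\<close>
      moreover have "0 \<le> C"
      proof -
        have "0 \<le> C * (l2_norm S (indicat_real {{v}}))\<^sup>2"
          using C[OF indicator_fin_cochain[OF vS]] by (meson order_trans zero_le_power2)
        then show ?thesis by (simp add: l2_norm_sq l2_inner_indicator[OF vS])
      qed
      ultimately show ?thesis
        by (cases "deg S v = 0") (auto simp: mult_le_cancel_right)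
    next
      case False
      let ?u = "indicat_real {{v}}"
      note u = indicator_fin_cochain[OF vS]
      have sq: "(mat_op (ent k) ?u \<sigma>)\<^sup>2 = 1" if "\<sigma> \<in> ?N" for \<sigma>
      proof -
        have \<sigma>: "\<sigma> \<in> S" "{v} \<lessdot> \<sigma>" using that by (auto simp: cofaces_def)
        have nz: "inc {v} \<sigma> \<noteq> 0" using \<sigma> vS by (simp add: inc_nonzero_iff)
        have e: "ent k \<sigma> {v} = inc {v} \<sigma>"
          using False inc_antisym[OF nz] by (cases k) (auto simp: ent_def)
        have "mat_op (ent k) ?u \<sigma> = (\<Sum>\<tau>\<in>{{v}}. ent k \<sigma> \<tau> * ?u \<tau>)"
          unfolding mat_op_def using row_finite[OF ent_rcf] nz e
          by (intro sum.mono_neutral_right) auto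
        then show ?thesis using e inc_sq[OF vS \<sigma>] by (simp add: power2_eq_square)
      qed
      have "real (deg S v) = (\<Sum>\<sigma>\<in>?N. (mat_op (ent k) ?u \<sigma>)\<^sup>2)"
        by (simp add: deg_eq sq)
      also have "\<dots> \<le> (l2_norm S (mat_op (ent k) ?u))\<^sup>2"
        by (rule l2_finite_sum_le[OF fin_cochains_l2[OF mat_op_fin[OF ent_rcf u]] N])
      also have "\<dots> \<le> C" using C[OF u] by (simp add: l2_norm_sq l2_inner_indicator[OF vS])
      finally show ?thesis .
    qed
  qed
  then have "deg S v \<le> nat \<lfloor>C\<rfloor>" if "v \<in> vertices S" for v
    using that by (simp add: le_nat_floor)
  then show ?thesis by (auto simp: bdd_above_def)
qed

subsection \<open>Reduction of the kernel conditions to the Hodge case\<close>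

text \<open>The Hodge matrix equals its transpose, and in its square the terms \<delta>\<delta> and
  \<partial>\<partial> drop out.\<close>

lemma ent_square:
  assumes "f \<in> cochains S"
  shows "mat_op (flip (ent Plus)) (mat_op (ent Plus) f) = bdr (cob f)"
    and "mat_op (flip (ent Minus)) (mat_op (ent Minus) f) = cob (bdr f)"
    and "mat_op (flip (ent Hodge)) (mat_op (ent Hodge) f) = bdr (cob f) + cob (bdr f)"
proof -
  have "flip (ent Hodge) = (\<lambda>\<sigma> \<tau>. inc \<tau> \<sigma> + inc \<sigma> \<tau>)" by (auto simp: ent_def fun_eq_iff)
  then show "mat_op (flip (ent Hodge)) (mat_op (ent Hodge) f) = bdr (cob f) + cob (bdr f)"
    using cob_cob[OF assms] bdr_bdr[of f] by (simp add: ent_def hodge_ent mat_op_add)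
qed (simp_all add: ent_def)

text \<open>For \<open>\<mu> \<noteq> 0\<close> an eigenfunction of \<open>\<partial>\<delta>\<close> is in the range of \<open>\<partial>\<close>, hence killed by \<open>\<partial>\<close>; likewise
  with \<open>\<delta>\<close> and \<open>\<partial>\<close> exchanged.\<close>

lemma kernel_from_hodge:
  assumes hodge: "bdr (cob f) + cob (bdr f) = (\<lambda>\<tau>. - \<mu> * f \<tau>) \<Longrightarrow> f = 0"
    and f: "f \<in> cochains S" and \<mu>: "\<mu> > 0"
    and eq: "mat_op (flip (ent k)) (mat_op (ent k) f) = (\<lambda>\<tau>. - \<mu> * f \<tau>)"
  shows "f = 0"
proof (cases k)
  case Plus
  then have e: "bdr (cob f) = (\<lambda>\<tau>. - \<mu> * f \<tau>)" using eq ent_square(1)[OF f] by simp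
  have "bdr (\<lambda>\<tau>. - \<mu> * f \<tau>) = 0" using bdr_bdr[of "cob f"] by (simp only: e)
  then have "bdr f = 0" using \<mu> by (simp only: mat_op_scale) (auto simp: fun_eq_iff)
  then show ?thesis using hodge e by simp
next
  case Minus
  then have e: "cob (bdr f) = (\<lambda>\<tau>. - \<mu> * f \<tau>)" using eq ent_square(2)[OF f] by simp
  have "cob (\<lambda>\<tau>. - \<mu> * f \<tau>) = 0" using cob_cob[OF bdr_cochain[of f]] by (simp only: e)
  then have "cob f = 0" using \<mu> by (simp only: mat_op_scale) (auto simp: fun_eq_iff)
  then show ?thesis using hodge e by simp
next
  case Hodge
  then show ?thesis using hodge eq ent_square(3)[OF f] by simp
qed

lemma essentially_self_adjoint_from_hodge:
  assumes lap: "is_laplacian S \<delta> k \<Delta>" and \<mu>: "\<mu> > 0"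
    and hodge: "\<And>f. f \<in> l2 S \<Longrightarrow> bdr (cob f) + cob (bdr f) = (\<lambda>\<tau>. - \<mu> * f \<tau>) \<Longrightarrow> f = 0"
  shows "essentially_self_adjoint S (restrict_fin S \<Delta>)"
proof -
  obtain Q where Q: "matrix_form S (ent k) Q" "\<Delta> = form_operator S Q"
    by (rule laplacian_matrix_form[OF lap])
  interpret matrix_form S "ent k" Q by (rule Q)
  show ?thesis unfolding Q(2)
  proof (rule essentially_self_adjoint_restrict[OF \<mu>])
    fix f assume f: "f \<in> l2 S" "L f = (\<lambda>\<tau>. - \<mu> * f \<tau>)"
    then show "f = 0"
      using kernel_from_hodge[OF hodge[OF f(1)] l2_cochain[OF f(1)] \<mu>, of k] by (simp add: L_def)
  qed
qed

end

subsection \<open>Forman curvature bounded from below\<close>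

text \<open>A Chebyshev count: each simplex with
  \<open>\<bar>f \<tau>0\<bar> \<le> \<bar>f \<tau>\<bar>\<close> contributes at least the square of
  \<open>f \<tau>0\<close> to the squared norm, so there are finitely many of them, and a maximum
  over this finite set is a global one.\<close>

lemma l2_max_attained:
  assumes f: "f \<in> l2 S" and nz: "f \<noteq> 0"
  obtains \<tau> where "\<tau> \<in> S" "f \<tau> \<noteq> 0" "\<And>\<tau>'. \<tau>' \<in> S \<Longrightarrow> \<bar>f \<tau>'\<bar> \<le> \<bar>f \<tau>\<bar>"
proof -
  obtain \<tau>0 where \<tau>0: "f \<tau>0 \<noteq> 0" using nz by (auto simp: fun_eq_iff)
  then have \<tau>0S: "\<tau>0 \<in> S" using cochain_outside[OF l2_cochain[OF f]] by blast
  define A where "A = {\<tau>\<in>S. \<bar>f \<tau>0\<bar> \<le> \<bar>f \<tau>\<bar>}"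
  have "finite A"
  proof (rule ccontr)
    assume inf: "infinite A"
    obtain n :: nat where n: "(l2_norm S f)\<^sup>2 / (f \<tau>0)\<^sup>2 < real n" using reals_Archimedean2 by blast
    obtain B where B: "finite B" "card B = n" "B \<subseteq> A"
      using infinite_arbitrarily_large[OF inf] by blast
    have "real n * (f \<tau>0)\<^sup>2 = (\<Sum>\<tau>\<in>B. (f \<tau>0)\<^sup>2)" using B by simp
    also have "\<dots> \<le> (\<Sum>\<tau>\<in>B. (f \<tau>)\<^sup>2)"
      using B by (intro sum_mono) (auto simp: A_def abs_le_square_iff)
    also have "\<dots> \<le> (l2_norm S f)\<^sup>2" by (rule l2_finite_sum_le[OF f B(1)])
    finally show False using n \<tau>0 by (simp add: field_simps)
  qed
  moreover have \<tau>0A: "\<tau>0 \<in> A" using \<tau>0S by (simp add: A_def)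
  ultimately obtain \<tau> where \<tau>: "\<tau> \<in> A" "\<bar>f \<tau>\<bar> = Max ((\<lambda>\<tau>. \<bar>f \<tau>\<bar>) ` A)"
    using Max_in[of "(\<lambda>\<tau>. \<bar>f \<tau>\<bar>) ` A"] by fastforce
  have max: "\<bar>f \<tau>'\<bar> \<le> \<bar>f \<tau>\<bar>" if "\<tau>' \<in> A" for \<tau>'
    unfolding \<tau>(2) using that \<open>finite A\<close> by simp
  show ?thesis
  proof (rule that)
    show "\<tau> \<in> S" "f \<tau> \<noteq> 0" using \<tau>(1) \<tau>0 by (auto simp: A_def)
    fix \<tau>' assume "\<tau>' \<in> S"
    then show "\<bar>f \<tau>'\<bar> \<le> \<bar>f \<tau>\<bar>" using max[of \<tau>'] max[OF \<tau>0A] by (cases "\<tau>' \<in> A") (auto simp: A_def)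
  qed
qed

section \<open>The diamond of two simplices, their meet and their join\<close>

lemma covered_pair:
  assumes "\<tau> \<lessdot> \<sigma>" "\<tau>' \<lessdot> \<sigma>" "\<tau> \<noteq> \<tau>'"
  obtains x y where "x \<notin> \<tau>" "y \<notin> \<tau>'" "\<sigma> = insert x \<tau>" "\<sigma> = \<tau> \<union> \<tau>'"
    "insert y (\<tau> \<inter> \<tau>') = \<tau>" "insert x (\<tau> \<inter> \<tau>') = \<tau>'"
proof -
  obtain x y where xy: "x \<notin> \<tau>" "\<sigma> = insert x \<tau>" "y \<notin> \<tau>'" "\<sigma> = insert y \<tau>'"
    using assms by (auto simp: covered_iff)
  with \<open>\<tau> \<noteq> \<tau>'\<close> have "x \<noteq> y" by (metis insert_ident)
  have eq: "z = x \<or> z \<in> \<tau> \<longleftrightarrow> z = y \<or> z \<in> \<tau>'" for z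
    using xy(2,4) by (metis insert_iff)
  have "insert y (\<tau> \<inter> \<tau>') = \<tau>" "insert x (\<tau> \<inter> \<tau>') = \<tau>'" "\<tau> \<union> \<tau>' = insert x \<tau>"
    by (intro set_eqI; metis eq \<open>x \<noteq> y\<close> xy(1,3) Int_iff Un_iff insert_iff)+
  then show ?thesis using that[of x y] xy by simp
qed

lemma covered_meet:
  assumes "\<tau> \<lessdot> \<sigma>" "\<tau>' \<lessdot> \<sigma>" "\<tau> \<noteq> \<tau>'"
  shows "\<tau> \<inter> \<tau>' \<lessdot> \<tau>" "\<tau> \<inter> \<tau>' \<lessdot> \<tau>'" "\<sigma> = \<tau> \<union> \<tau>'"
proof -
  obtain x y where xy: "x \<notin> \<tau>" "y \<notin> \<tau>'" "\<sigma> = \<tau> \<union> \<tau>'"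
    "insert y (\<tau> \<inter> \<tau>') = \<tau>" "insert x (\<tau> \<inter> \<tau>') = \<tau>'"
    using covered_pair[OF assms] by metis
  show "\<tau> \<inter> \<tau>' \<lessdot> \<tau>" unfolding covered_iff by (rule exI[of _ y]) (simp add: xy)
  show "\<tau> \<inter> \<tau>' \<lessdot> \<tau>'" unfolding covered_iff by (rule exI[of _ x]) (simp add: xy)
  show "\<sigma> = \<tau> \<union> \<tau>'" by (rule xy)
qed

lemma covered_both_meet:
  assumes "\<rho> \<lessdot> \<tau>" "\<rho> \<lessdot> \<tau>'" "\<tau> \<noteq> \<tau>'"
  shows "\<rho> = \<tau> \<inter> \<tau>'"
proof -
  obtain x y where "x \<notin> \<rho>" "\<tau> = insert x \<rho>" "y \<notin> \<rho>" "\<tau>' = insert y \<rho>"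
    using assms by (auto simp: covered_iff)
  moreover from this have "x \<noteq> y" using assms by auto
  ultimately show ?thesis by blast
qed

text \<open>An intermediate simplex adds exactly one of the two vertices that
  \<open>\<sigma>\<close> has beyond the meet. Hence between simplices that differ by two vertices
  \<delta>\<delta> has only two terms.\<close>

lemma covered_between:
  assumes "\<tau> \<lessdot> \<sigma>" "\<tau>' \<lessdot> \<sigma>" "\<tau> \<noteq> \<tau>'" "\<tau> \<inter> \<tau>' \<lessdot> \<kappa>" "\<kappa> \<lessdot> \<sigma>"
  shows "\<kappa> = \<tau> \<or> \<kappa> = \<tau>'"
proof -
  obtain x y where xy: "\<sigma> = insert x \<tau>"
    "insert y (\<tau> \<inter> \<tau>') = \<tau>" "insert x (\<tau> \<inter> \<tau>') = \<tau>'"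
    using covered_pair[OF assms(1-3)] by metis
  obtain z where z: "z \<notin> \<tau> \<inter> \<tau>'" "\<kappa> = insert z (\<tau> \<inter> \<tau>')"
    using assms(4) by (auto simp: covered_iff)
  have "z \<in> \<sigma>" using z assms(5) by (auto simp: covered_iff)
  then have "z = x \<or> z \<in> insert y (\<tau> \<inter> \<tau>')" using xy by auto
  with z(1) have "z = x \<or> z = y" by blast
  with xy z(2) show ?thesis by auto
qed

context unit_weight_complex
begin

text \<open>Evaluate \<delta>\<delta> = 0 on the indicator of \<open>\<rho>\<close> at
  \<open>\<sigma>\<close>: the only paths run through \<open>\<tau>\<close> and
  \<open>\<tau>'\<close>, so their signs are opposite, and the factors may be regrouped because each
  is 1 or -1.\<close>

lemma signs_cancel:
  assumes S: "\<tau> \<in> S" "\<tau>' \<in> S" "\<sigma> \<in> S" "\<rho> \<in> S"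
    and cov: "\<tau> \<lessdot> \<sigma>" "\<tau>' \<lessdot> \<sigma>" "\<rho> \<lessdot> \<tau>" "\<rho> \<lessdot> \<tau>'" and ne: "\<tau> \<noteq> \<tau>'"
  shows "inc \<rho> \<tau> * inc \<rho> \<tau>' = - (inc \<tau> \<sigma> * inc \<tau>' \<sigma>)"
proof -
  let ?i = "indicat_real {\<rho>}"
  have \<rho>: "\<rho> = \<tau> \<inter> \<tau>'" by (rule covered_both_meet) fact+
  have cob_i: "cob ?i \<kappa> = inc \<rho> \<kappa>" for \<kappa>
  proof (cases "inc \<rho> \<kappa> = 0")
    case True
    then show ?thesis unfolding mat_op_def by (simp add: indicator_def, intro sum.neutral) auto
  next
    case False
    then have "cob ?i \<kappa> = (\<Sum>\<tau>\<in>{\<rho>}. inc \<tau> \<kappa> * ?i \<tau>)"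
      unfolding mat_op_def using col_finite[OF inc_rcf] by (intro sum.mono_neutral_right) auto
    then show ?thesis by simp
  qed
  have "0 = cob (cob ?i) \<sigma>" by (simp add: cob_cob fin_cochain[OF indicator_fin_cochain] S)
  also have "\<dots> = (\<Sum>\<kappa>\<in>{\<tau>, \<tau>'}. inc \<kappa> \<sigma> * inc \<rho> \<kappa>)"
    unfolding mat_op_def[of "flip inc" "cob ?i"] cob_i
  proof (rule sum.mono_neutral_right)
    show "finite {\<tau>. inc \<tau> \<sigma> \<noteq> 0}" by (rule col_finite[OF inc_rcf])
    show "{\<tau>, \<tau>'} \<subseteq> {\<tau>. inc \<tau> \<sigma> \<noteq> 0}" using S cov by (auto simp: inc_nonzero_iff)
    show "\<forall>\<kappa>\<in>{\<tau>. inc \<tau> \<sigma> \<noteq> 0} - {\<tau>, \<tau>'}. inc \<kappa> \<sigma> * inc \<rho> \<kappa> = 0"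
    proof
      fix \<kappa> assume \<kappa>: "\<kappa> \<in> {\<tau>. inc \<tau> \<sigma> \<noteq> 0} - {\<tau>, \<tau>'}"
      then have "\<not> \<tau> \<inter> \<tau>' \<lessdot> \<kappa>"
        using covered_between[OF cov(1,2) ne, of \<kappa>] by (auto simp: inc_nonzero_iff)
      then show "inc \<kappa> \<sigma> * inc \<rho> \<kappa> = 0" using inc_nonzero_iff[of \<rho> \<kappa>] \<rho> by auto
    qed
  qed
  also have "\<dots> = inc \<tau> \<sigma> * inc \<rho> \<tau> + inc \<tau>' \<sigma> * inc \<rho> \<tau>'" using ne by simp
  finally have "inc \<tau> \<sigma> * inc \<rho> \<tau> + inc \<tau>' \<sigma> * inc \<rho> \<tau>' = 0" by simp
  moreover have "inc \<tau> \<sigma> \<noteq> 0" "inc \<rho> \<tau> \<noteq> 0" "inc \<tau>' \<sigma> \<noteq> 0" "inc \<rho> \<tau>' \<noteq> 0"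
    using S cov by (auto simp: inc_nonzero_iff)
  ultimately show ?thesis
    using inc_values[of \<tau> \<sigma>] inc_values[of \<tau>' \<sigma>] inc_values[of \<rho> \<tau>] inc_values[of \<rho> \<tau>'] by auto
qed

section \<open>Diagonal and off-diagonal parts of the Hodge Laplacian\<close>

definition up_off :: "('v set \<Rightarrow> real) \<Rightarrow> 'v set \<Rightarrow> real" where
  "up_off f \<tau> = (\<Sum>\<sigma>\<in>cofaces S \<tau>. \<Sum>\<tau>'\<in>faces S \<sigma> - {\<tau>}. inc \<tau> \<sigma> * inc \<tau>' \<sigma> * f \<tau>')"

definition down_off :: "('v set \<Rightarrow> real) \<Rightarrow> 'v set \<Rightarrow> real" where
  "down_off f \<tau> = (\<Sum>\<rho>\<in>faces S \<tau>. \<Sum>\<tau>'\<in>cofaces S \<rho> - {\<tau>}. inc \<rho> \<tau> * inc \<rho> \<tau>' * f \<tau>')"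

text \<open>The path from \<open>\<tau>\<close> up to a coface and back contributes the square of a
  sign, so the diagonal entry counts cofaces.\<close>

lemma bdr_cob_split:
  assumes \<tau>: "\<tau> \<in> S"
  shows "bdr (cob f) \<tau> = real (card (cofaces S \<tau>)) * f \<tau> + up_off f \<tau>"
proof -
  have "inc \<tau> \<sigma> * cob f \<sigma> = f \<tau> + (\<Sum>\<tau>'\<in>faces S \<sigma> - {\<tau>}. inc \<tau> \<sigma> * inc \<tau>' \<sigma> * f \<tau>')"
    if "\<sigma> \<in> cofaces S \<tau>" for \<sigma>
  proof -
    have \<sigma>: "\<sigma> \<in> S" "\<tau> \<lessdot> \<sigma>" "\<tau> \<in> faces S \<sigma>" using that \<tau> by (auto simp: cofaces_def faces_def)
    have "inc \<tau> \<sigma> * cob f \<sigma> = (\<Sum>\<tau>'\<in>faces S \<sigma>. inc \<tau> \<sigma> * inc \<tau>' \<sigma> * f \<tau>')"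
      unfolding mat_op_def inc_col[OF \<sigma>(1)] by (simp add: sum_distrib_left mult.assoc)
    also have "\<dots> = inc \<tau> \<sigma> * inc \<tau> \<sigma> * f \<tau> + (\<Sum>\<tau>'\<in>faces S \<sigma> - {\<tau>}. inc \<tau> \<sigma> * inc \<tau>' \<sigma> * f \<tau>')"
      by (rule sum.remove[OF finite_faces[OF \<sigma>(1)] \<sigma>(3)])
    finally show ?thesis using inc_sq[OF \<tau> \<sigma>(1,2)] by simp
  qed
  then show ?thesis
    unfolding up_off_def mat_op_def[of inc] inc_row[OF \<tau>] by (simp add: sum.distrib)
qed

lemma cob_bdr_split:
  assumes \<tau>: "\<tau> \<in> S"
  shows "cob (bdr f) \<tau> = real (card (faces S \<tau>)) * f \<tau> + down_off f \<tau>"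
proof -
  have "inc \<rho> \<tau> * bdr f \<rho> = f \<tau> + (\<Sum>\<tau>'\<in>cofaces S \<rho> - {\<tau>}. inc \<rho> \<tau> * inc \<rho> \<tau>' * f \<tau>')"
    if "\<rho> \<in> faces S \<tau>" for \<rho>
  proof -
    have \<rho>: "\<rho> \<in> S" "\<rho> \<lessdot> \<tau>" "\<tau> \<in> cofaces S \<rho>" using that \<tau> by (auto simp: cofaces_def faces_def)
    have "inc \<rho> \<tau> * bdr f \<rho> = (\<Sum>\<tau>'\<in>cofaces S \<rho>. inc \<rho> \<tau> * inc \<rho> \<tau>' * f \<tau>')"
      unfolding mat_op_def inc_row[OF \<rho>(1)] by (simp add: sum_distrib_left mult.assoc)
    also have "\<dots> = inc \<rho> \<tau> * inc \<rho> \<tau> * f \<tau> + (\<Sum>\<tau>'\<in>cofaces S \<rho> - {\<tau>}. inc \<rho> \<tau> * inc \<rho> \<tau>' * f \<tau>')"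
      by (rule sum.remove[OF finite_cofaces[OF \<rho>(1)] \<rho>(3)])
    finally show ?thesis using inc_sq[OF \<rho>(1) \<tau> \<rho>(2)] by simp
  qed
  then show ?thesis
    unfolding down_off_def mat_op_def[of "flip inc"] inc_col[OF \<tau>] by (simp add: sum.distrib)
qed

abbreviation common_cofaces :: "'v set \<Rightarrow> 'v set \<Rightarrow> 'v set set" where
  "common_cofaces \<tau> \<tau>' \<equiv> {\<sigma>\<in>S. \<tau> \<lessdot> \<sigma> \<and> \<tau>' \<lessdot> \<sigma>}"

text \<open>A common coface must be the union, so the cardinality in the Forman curvature is 0 or
  1.\<close>

lemma common_cofaces_cases:
  assumes "\<tau> \<noteq> \<tau>'"
  obtains "common_cofaces \<tau> \<tau>' = {}"
    | "\<tau> \<union> \<tau>' \<in> S" "\<tau> \<lessdot> \<tau> \<union> \<tau>'" "\<tau>' \<lessdot> \<tau> \<union> \<tau>'" "common_cofaces \<tau> \<tau>' = {\<tau> \<union> \<tau>'}"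
proof -
  have sub: "common_cofaces \<tau> \<tau>' \<subseteq> {\<tau> \<union> \<tau>'}" using covered_meet(3)[OF _ _ assms] by auto
  show ?thesis
  proof (cases "common_cofaces \<tau> \<tau>' = {}")
    case False
    then have "common_cofaces \<tau> \<tau>' = {\<tau> \<union> \<tau>'}" using sub by blast
    moreover from this have "\<tau> \<union> \<tau>' \<in> common_cofaces \<tau> \<tau>'" by simp
    ultimately show ?thesis using that(2) by blast
  qed (rule that(1))
qed

text \<open>A pair of simplices with a common coface also shares the face \<open>\<tau> \<inter> \<tau>'\<close>, so the up-down paths
  can be summed along the down-up paths.\<close>

lemma up_off_reindex:
  assumes \<tau>: "\<tau> \<in> S"
    and meet: "\<And>\<sigma> \<tau>'. \<sigma> \<in> cofaces S \<tau> \<Longrightarrow> \<tau>' \<in> faces S \<sigma> - {\<tau>} \<Longrightarrow> \<tau> \<inter> \<tau>' \<in> S"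
  shows "up_off f \<tau> = (\<Sum>\<rho>\<in>faces S \<tau>. \<Sum>\<tau>'\<in>cofaces S \<rho> - {\<tau>}. \<Sum>\<sigma>\<in>common_cofaces \<tau> \<tau>'.
      inc \<tau> \<sigma> * inc \<tau>' \<sigma> * f \<tau>')"
proof -
  have fin_cc: "finite (common_cofaces \<tau> \<tau>')" for \<tau>'
    by (rule finite_subset[OF _ finite_cofaces[OF \<tau>]]) (auto simp: cofaces_def)
  have fin_cf: "finite (cofaces S \<rho> - {\<tau>})" if "\<rho> \<in> faces S \<tau>" for \<rho>
    using that finite_cofaces by (auto simp: faces_def)
  have fin_f: "finite (faces S \<sigma> - {\<tau>})" if "\<sigma> \<in> cofaces S \<tau>" for \<sigma>
    using that finite_faces by (auto simp: cofaces_def)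
  have "up_off f \<tau> = (\<Sum>(\<sigma>, \<tau>')\<in>Sigma (cofaces S \<tau>) (\<lambda>\<sigma>. faces S \<sigma> - {\<tau>}). inc \<tau> \<sigma> * inc \<tau>' \<sigma> * f \<tau>')"
    unfolding up_off_def using fin_f finite_cofaces[OF \<tau>] by (subst sum.Sigma) auto
  also have "\<dots> = (\<Sum>(\<rho>, \<tau>', \<sigma>)\<in>Sigma (faces S \<tau>) (\<lambda>\<rho>. Sigma (cofaces S \<rho> - {\<tau>}) (common_cofaces \<tau>)).
      inc \<tau> \<sigma> * inc \<tau>' \<sigma> * f \<tau>')"
  proof (rule sum.reindex_bij_witness[where j = "\<lambda>(\<sigma>, \<tau>'). (\<tau> \<inter> \<tau>', \<tau>', \<sigma>)"
        and i = "\<lambda>(\<rho>, \<tau>', \<sigma>). (\<sigma>, \<tau>')"])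
    fix p assume "p \<in> Sigma (cofaces S \<tau>) (\<lambda>\<sigma>. faces S \<sigma> - {\<tau>})"
    then obtain \<sigma> \<tau>' where p: "p = (\<sigma>, \<tau>')" "\<sigma> \<in> cofaces S \<tau>" "\<tau>' \<in> faces S \<sigma> - {\<tau>}" by auto
    then have c: "\<tau> \<lessdot> \<sigma>" "\<tau>' \<lessdot> \<sigma>" "\<tau> \<noteq> \<tau>'" "\<sigma> \<in> S" "\<tau>' \<in> S" by (auto simp: cofaces_def faces_def)
    show "(case p of (\<sigma>, \<tau>') \<Rightarrow> (\<tau> \<inter> \<tau>', \<tau>', \<sigma>))
        \<in> Sigma (faces S \<tau>) (\<lambda>\<rho>. Sigma (cofaces S \<rho> - {\<tau>}) (common_cofaces \<tau>))"
      using p c covered_meet[OF c(1-3)] meet[OF p(2,3)] by (auto simp: cofaces_def faces_def)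
  next
    fix q assume "q \<in> Sigma (faces S \<tau>) (\<lambda>\<rho>. Sigma (cofaces S \<rho> - {\<tau>}) (common_cofaces \<tau>))"
    then obtain \<rho> \<tau>' \<sigma> where q: "q = (\<rho>, \<tau>', \<sigma>)" "\<rho> \<in> faces S \<tau>" "\<tau>' \<in> cofaces S \<rho> - {\<tau>}"
      "\<sigma> \<in> common_cofaces \<tau> \<tau>'" by auto
    then show "(case case q of (\<rho>, \<tau>', \<sigma>) \<Rightarrow> (\<sigma>, \<tau>') of (\<sigma>, \<tau>') \<Rightarrow> (\<tau> \<inter> \<tau>', \<tau>', \<sigma>)) = q"
      using covered_both_meet[of \<rho> \<tau> \<tau>'] by (auto simp: cofaces_def faces_def)
    show "(case q of (\<rho>, \<tau>', \<sigma>) \<Rightarrow> (\<sigma>, \<tau>')) \<in> Sigma (cofaces S \<tau>) (\<lambda>\<sigma>. faces S \<sigma> - {\<tau>})"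
      using q by (auto simp: cofaces_def faces_def)
  qed auto
  also have "\<dots> = (\<Sum>\<rho>\<in>faces S \<tau>. \<Sum>(\<tau>', \<sigma>)\<in>Sigma (cofaces S \<rho> - {\<tau>}) (common_cofaces \<tau>).
      inc \<tau> \<sigma> * inc \<tau>' \<sigma> * f \<tau>')"
    using fin_cf fin_cc finite_faces[OF \<tau>] by (subst sum.Sigma) (auto intro!: finite_SigmaI)
  also have "\<dots> = (\<Sum>\<rho>\<in>faces S \<tau>. \<Sum>\<tau>'\<in>cofaces S \<rho> - {\<tau>}. \<Sum>\<sigma>\<in>common_cofaces \<tau> \<tau>'.
      inc \<tau> \<sigma> * inc \<tau>' \<sigma> * f \<tau>')"
    using fin_cf fin_cc by (intro sum.cong refl) (subst sum.Sigma, auto)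
  finally show ?thesis .
qed

text \<open>Without a common coface only the path through \<open>\<rho>\<close> remains, with value
  1 or -1; with one, the two paths cancel by \<open>signs_cancel\<close>. So the summands of the
  Forman curvature are absolute values of off-diagonal entries of the Hodge Laplacian.\<close>

lemma off_diagonal_entry:
  assumes \<tau>: "\<tau> \<in> S" and \<rho>: "\<rho> \<in> faces S \<tau>" and \<tau>': "\<tau>' \<in> cofaces S \<rho> - {\<tau>}"
  shows "\<bar>inc \<rho> \<tau> * inc \<rho> \<tau>' + (\<Sum>\<sigma>\<in>common_cofaces \<tau> \<tau>'. inc \<tau> \<sigma> * inc \<tau>' \<sigma>)\<bar>
    = real_of_int \<bar>1 - int (card (common_cofaces \<tau> \<tau>'))\<bar>"
proof -
  have c: "\<rho> \<in> S" "\<tau>' \<in> S" "\<rho> \<lessdot> \<tau>" "\<rho> \<lessdot> \<tau>'" "\<tau> \<noteq> \<tau>'" using \<rho> \<tau>' by (auto simp: faces_def cofaces_def)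
  from c(5) show ?thesis
  proof (cases rule: common_cofaces_cases)
    case 1
    have "\<bar>inc \<rho> \<tau> * inc \<rho> \<tau>'\<bar> = 1"
      using inc_values[of \<rho> \<tau>] inc_values[of \<rho> \<tau>'] inc_nonzero_iff[of \<rho> \<tau>] inc_nonzero_iff[of \<rho> \<tau>'] c \<tau>
      by auto
    then show ?thesis unfolding 1 by simp
  next
    case 2
    then show ?thesis using signs_cancel[OF \<tau> c(2) 2(1) c(1) 2(2,3) c(3,4,5)] by simp
  qed
qed

text \<open>The double sum over \<open>\<rho>\<close> and \<open>\<tau>'\<close> meets each
  \<open>\<tau>'\<close> once, as \<open>\<rho>\<close> must be
  \<open>\<tau> \<inter> \<tau>'\<close>; it is the off-diagonal part of one matrix row. The
  hypothesis \<open>meet\<close> can fail only where that intersection is empty and the empty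
  simplex is absent from \<open>S\<close>.\<close>

lemma off_diagonal_bound:
  assumes \<tau>: "\<tau> \<in> S"
    and meet: "\<And>\<sigma> \<tau>'. \<sigma> \<in> cofaces S \<tau> \<Longrightarrow> \<tau>' \<in> faces S \<sigma> - {\<tau>} \<Longrightarrow> \<tau> \<inter> \<tau>' \<in> S"
    and max: "\<And>\<tau>'. \<tau>' \<in> S \<Longrightarrow> \<bar>f \<tau>'\<bar> \<le> \<bar>f \<tau>\<bar>"
  shows "\<bar>up_off f \<tau> + down_off f \<tau>\<bar>
    \<le> (real (card (faces S \<tau>)) + real (card (cofaces S \<tau>)) - real_of_int (forman S \<tau>)) * \<bar>f \<tau>\<bar>"
proof -
  let ?c = "\<lambda>\<tau>'. real_of_int \<bar>1 - int (card (common_cofaces \<tau> \<tau>'))\<bar>"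
  have up: "up_off f \<tau> = (\<Sum>\<rho>\<in>faces S \<tau>. \<Sum>\<tau>'\<in>cofaces S \<rho> - {\<tau>}. \<Sum>\<sigma>\<in>common_cofaces \<tau> \<tau>'.
      inc \<tau> \<sigma> * inc \<tau>' \<sigma> * f \<tau>')"
    by (rule up_off_reindex[OF \<tau> meet])
  have eq: "up_off f \<tau> + down_off f \<tau> = (\<Sum>\<rho>\<in>faces S \<tau>. \<Sum>\<tau>'\<in>cofaces S \<rho> - {\<tau>}.
      (inc \<rho> \<tau> * inc \<rho> \<tau>' + (\<Sum>\<sigma>\<in>common_cofaces \<tau> \<tau>'. inc \<tau> \<sigma> * inc \<tau>' \<sigma>)) * f \<tau>')"
    by (simp add: up down_off_def sum.distrib distrib_right sum_distrib_right)
  have "\<bar>up_off f \<tau> + down_off f \<tau>\<bar>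
      \<le> (\<Sum>\<rho>\<in>faces S \<tau>. \<Sum>\<tau>'\<in>cofaces S \<rho> - {\<tau>}. ?c \<tau>' * \<bar>f \<tau>\<bar>)"
    unfolding eq
  proof (rule order_trans[OF sum_abs sum_mono], rule order_trans[OF sum_abs sum_mono])
    fix \<rho> \<tau>' assume r: "\<rho> \<in> faces S \<tau>" and t: "\<tau>' \<in> cofaces S \<rho> - {\<tau>}"
    have "\<bar>f \<tau>'\<bar> \<le> \<bar>f \<tau>\<bar>" using t by (intro max) (auto simp: cofaces_def)
    then show "\<bar>(inc \<rho> \<tau> * inc \<rho> \<tau>' + (\<Sum>\<sigma>\<in>common_cofaces \<tau> \<tau>'. inc \<tau> \<sigma> * inc \<tau>' \<sigma>)) * f \<tau>'\<bar>
        \<le> ?c \<tau>' * \<bar>f \<tau>\<bar>"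
      unfolding abs_mult[of _ "f \<tau>'"] off_diagonal_entry[OF \<tau> r t] by (intro mult_left_mono) auto
  qed
  also have "\<dots> = (\<Sum>\<rho>\<in>faces S \<tau>. \<Sum>\<tau>'\<in>cofaces S \<rho> - {\<tau>}. ?c \<tau>') * \<bar>f \<tau>\<bar>"
    by (simp only: sum_distrib_right)
  also have "(\<Sum>\<rho>\<in>faces S \<tau>. \<Sum>\<tau>'\<in>cofaces S \<rho> - {\<tau>}. ?c \<tau>')
      = real (card (faces S \<tau>)) + real (card (cofaces S \<tau>)) - real_of_int (forman S \<tau>)"
    by (simp only: forman_def of_int_diff of_int_add of_int_sum of_int_of_nat_eq)
  finally show ?thesis .
qed

text \<open>Without the empty simplex two vertices of an edge have no common face; there the row sums of the
  Laplacian are bounded by its diagonal.\<close>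

lemma off_diagonal_bound_vertex:
  assumes \<tau>: "\<tau> \<in> S" and \<sigma>0: "\<sigma>0 \<in> cofaces S \<tau>" "\<tau>0 \<in> faces S \<sigma>0 - {\<tau>}" "\<tau> \<inter> \<tau>0 \<notin> S"
    and max: "\<And>\<tau>'. \<tau>' \<in> S \<Longrightarrow> \<bar>f \<tau>'\<bar> \<le> \<bar>f \<tau>\<bar>"
  shows "\<bar>up_off f \<tau> + down_off f \<tau>\<bar> \<le> real (card (cofaces S \<tau>)) * \<bar>f \<tau>\<bar>"
proof -
  have c: "\<tau> \<lessdot> \<sigma>0" "\<tau>0 \<lessdot> \<sigma>0" "\<tau> \<noteq> \<tau>0" using \<sigma>0 by (auto simp: cofaces_def faces_def)
  have empty: "\<tau> \<inter> \<tau>0 = {}" using S_subset[OF \<tau>, of "\<tau> \<inter> \<tau>0"] \<sigma>0(3) by auto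
  then have "{} \<notin> S" using \<sigma>0(3) by auto
  have "{} \<lessdot> \<tau>" using covered_meet(1)[OF c] empty by simp
  then obtain v where v: "\<tau> = {v}" by (auto simp: covered_iff)
  have "\<rho> = {}" if "\<rho> \<lessdot> \<tau>" for \<rho> using that unfolding v by (auto simp: covered_iff)
  then have "faces S \<tau> = {}" using \<open>{} \<notin> S\<close> by (auto simp: faces_def)
  then have down: "down_off f \<tau> = 0" by (simp add: down_off_def)
  have "\<bar>up_off f \<tau>\<bar> \<le> (\<Sum>\<sigma>\<in>cofaces S \<tau>. \<bar>f \<tau>\<bar>)"
    unfolding up_off_def
  proof (rule order_trans[OF sum_abs sum_mono])
    fix \<sigma> assume "\<sigma> \<in> cofaces S \<tau>"
    then have \<sigma>: "\<sigma> \<in> S" "\<tau> \<lessdot> \<sigma>" by (auto simp: cofaces_def)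
    have "card \<sigma> = 2" using covered_card[OF \<sigma>(2)] v by simp
    moreover have "\<tau> \<in> faces S \<sigma>" using \<sigma> \<tau> by (simp add: faces_def)
    \<comment> \<open>An edge at the vertex \<open>\<tau>\<close> has just one further endpoint, so
      each coface contributes at most one neighbour.\<close>
    ultimately have le: "card (faces S \<sigma> - {\<tau>}) \<le> 1"
      using card_faces_le[OF \<sigma>(1)] by simp
    have "\<bar>\<Sum>\<tau>'\<in>faces S \<sigma> - {\<tau>}. inc \<tau> \<sigma> * inc \<tau>' \<sigma> * f \<tau>'\<bar> \<le> (\<Sum>\<tau>'\<in>faces S \<sigma> - {\<tau>}. \<bar>f \<tau>\<bar>)"
    proof (rule order_trans[OF sum_abs sum_mono])
      fix \<tau>' assume "\<tau>' \<in> faces S \<sigma> - {\<tau>}"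
      then have "\<bar>f \<tau>'\<bar> \<le> \<bar>f \<tau>\<bar>" by (intro max) (auto simp: faces_def)
      moreover have "\<bar>inc \<tau> \<sigma>\<bar> * \<bar>inc \<tau>' \<sigma>\<bar> \<le> 1"
        using abs_inc_le[of \<tau> \<sigma>] abs_inc_le[of \<tau>' \<sigma>] by (simp add: mult_le_one)
      ultimately have "\<bar>inc \<tau> \<sigma>\<bar> * \<bar>inc \<tau>' \<sigma>\<bar> * \<bar>f \<tau>'\<bar> \<le> 1 * \<bar>f \<tau>\<bar>"
        by (intro mult_mono) auto
      then show "\<bar>inc \<tau> \<sigma> * inc \<tau>' \<sigma> * f \<tau>'\<bar> \<le> \<bar>f \<tau>\<bar>" by (simp add: abs_mult)
    qed
    also have "\<dots> \<le> 1 * \<bar>f \<tau>\<bar>"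
      using le unfolding sum_constant by (intro mult_right_mono) auto
    finally show "\<bar>\<Sum>\<tau>'\<in>faces S \<sigma> - {\<tau>}. inc \<tau> \<sigma> * inc \<tau>' \<sigma> * f \<tau>'\<bar> \<le> \<bar>f \<tau>\<bar>" by simp
  qed
  then show ?thesis by (simp add: down)
qed

text \<open>With D the number of faces and cofaces of \<open>\<tau>\<close>, the equation makes (D +
  \<mu>) |f| at \<open>\<tau>\<close> equal to the modulus of the off-diagonal part, which is at
  most (D - c^H) |f| there; so (\<mu> + c^H) |f| \<le> 0. In the exceptional case at a vertex the
  cofaces alone bound the row, and \<mu> > 0 suffices.\<close>

lemma hodge_maximum_principle:
  assumes \<tau>: "\<tau> \<in> S" and max: "\<And>\<tau>'. \<tau>' \<in> S \<Longrightarrow> \<bar>f \<tau>'\<bar> \<le> \<bar>f \<tau>\<bar>"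
    and eq: "bdr (cob f) \<tau> + cob (bdr f) \<tau> = - \<mu> * f \<tau>"
    and \<mu>: "\<mu> > 0" "- \<mu> < real_of_int (forman S \<tau>)"
  shows "f \<tau> = 0"
proof -
  let ?F = "real (card (faces S \<tau>))" and ?C = "real (card (cofaces S \<tau>))"
  have "(?F + ?C + \<mu>) * f \<tau> = - (up_off f \<tau> + down_off f \<tau>)"
    using eq by (simp add: bdr_cob_split[OF \<tau>] cob_bdr_split[OF \<tau>] algebra_simps)
  then have "\<bar>(?F + ?C + \<mu>) * f \<tau>\<bar> = \<bar>up_off f \<tau> + down_off f \<tau>\<bar>" by simp
  then have e: "(?F + ?C + \<mu>) * \<bar>f \<tau>\<bar> = \<bar>up_off f \<tau> + down_off f \<tau>\<bar>"
    using \<mu> by (simp add: abs_mult)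
  show ?thesis
  proof (cases "\<forall>\<sigma>\<in>cofaces S \<tau>. \<forall>\<tau>'\<in>faces S \<sigma> - {\<tau>}. \<tau> \<inter> \<tau>' \<in> S")
    case True
    then have "(?F + ?C + \<mu>) * \<bar>f \<tau>\<bar> \<le> (?F + ?C - real_of_int (forman S \<tau>)) * \<bar>f \<tau>\<bar>"
      unfolding e using max by (intro off_diagonal_bound[OF \<tau>]) auto
    then have "(\<mu> + real_of_int (forman S \<tau>)) * \<bar>f \<tau>\<bar> \<le> 0" by (simp add: algebra_simps)
    then show ?thesis using \<mu> by (simp add: mult_le_0_iff)
  next
    case False
    then obtain \<sigma>0 \<tau>0 where "\<sigma>0 \<in> cofaces S \<tau>" "\<tau>0 \<in> faces S \<sigma>0 - {\<tau>}" "\<tau> \<inter> \<tau>0 \<notin> S" by blast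
    from off_diagonal_bound_vertex[OF \<tau> this, of f] max have "(?F + \<mu>) * \<bar>f \<tau>\<bar> \<le> 0"
      unfolding e[symmetric] by (simp add: algebra_simps)
    moreover have "0 < ?F + \<mu>" using \<mu> by simp
    ultimately show ?thesis by (simp add: mult_le_0_iff)
  qed
qed

lemma essentially_self_adjoint_forman:
  assumes lap: "is_laplacian S \<delta> k \<Delta>" and forman: "bdd_below (forman S ` S)"
  shows "essentially_self_adjoint S (restrict_fin S \<Delta>)"
proof -
  from forman obtain M where M: "\<And>\<tau>. \<tau> \<in> S \<Longrightarrow> M \<le> forman S \<tau>" by (auto simp: bdd_below_def)
  \<comment> \<open>The absolute value plus one makes \<open>\<mu>\<close> positive and larger than
    \<open>- M\<close>, whatever the sign of \<open>M\<close>.\<close>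
  define \<mu> where "\<mu> = real_of_int \<bar>M\<bar> + 1"
  have \<mu>: "\<mu> > 0" by (simp add: \<mu>_def)
  have M': "- \<mu> < real_of_int (forman S \<tau>)" if "\<tau> \<in> S" for \<tau>
    using M[OF that] by (simp add: \<mu>_def)
  show ?thesis
  proof (rule essentially_self_adjoint_from_hodge[OF lap \<mu>], rule ccontr)
    fix f assume f: "f \<in> l2 S" "bdr (cob f) + cob (bdr f) = (\<lambda>\<tau>. - \<mu> * f \<tau>)" "f \<noteq> 0"
    obtain \<tau> where \<tau>: "\<tau> \<in> S" "f \<tau> \<noteq> 0" "\<And>\<tau>'. \<tau>' \<in> S \<Longrightarrow> \<bar>f \<tau>'\<bar> \<le> \<bar>f \<tau>\<bar>"
      using l2_max_attained[OF f(1,3)] by blast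
    have "bdr (cob f) \<tau> + cob (bdr f) \<tau> = - \<mu> * f \<tau>" using fun_cong[OF f(2), of \<tau>] by simp
    with hodge_maximum_principle[of \<tau> f \<mu>] \<tau> \<mu> M'[OF \<tau>(1)] show False by blast
  qed
qed

end

subsection \<open>The degree path metric\<close>

abbreviation edge_length :: "'v set set \<Rightarrow> 'v \<Rightarrow> 'v \<Rightarrow> real" where
  "edge_length S v w \<equiv> real (max (deg S w) (deg S v)) powr (-1/2)"

definition edge_path :: "'v set set \<Rightarrow> 'v \<Rightarrow> 'v \<Rightarrow> nat \<Rightarrow> (nat \<Rightarrow> 'v) \<Rightarrow> bool" where
  "edge_path S v w n p \<longleftrightarrow> p 0 = v \<and> p n = w \<and> (\<forall>k\<in>{1..n}. adj S (p (k - 1)) (p k))"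

definition path_length :: "'v set set \<Rightarrow> nat \<Rightarrow> (nat \<Rightarrow> 'v) \<Rightarrow> real" where
  "path_length S n p = (\<Sum>k=1..n. edge_length S (p (k - 1)) (p k))"

lemma path_lengths_eq: "path_lengths S v w = {path_length S n p |n p. edge_path S v w n p}"
  by (simp only: path_lengths_def path_length_def edge_path_def)

lemma path_lengths_refl: "0 \<in> path_lengths S v v"
  unfolding path_lengths_def by (rule CollectI, rule exI[of _ 0], rule exI[of _ "\<lambda>_. v"]) simp

lemma path_lengths_nonneg: "L \<in> path_lengths S v w \<Longrightarrow> 0 \<le> L"
  by (auto simp: path_lengths_def intro!: sum_nonneg)

text \<open>Together with \<open>path_lengths_cases\<close> this replaces indexed paths by recursion
  on the first edge.\<close>

lemma path_lengths_Cons: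
  assumes "L \<in> path_lengths S u w" "adj S v u"
  shows "edge_length S v u + L \<in> path_lengths S v w"
proof -
  let ?g = "\<lambda>p k. real (max (deg S (p k)) (deg S (p (k - 1)))) powr (-1/2)"
  obtain n p where np: "L = path_length S n p" "edge_path S u w n p"
    using assms(1) unfolding path_lengths_eq by blast
  have p: "L = (\<Sum>k=1..n. ?g p k)" "p 0 = u" "p n = w" "\<forall>k\<in>{1..n}. adj S (p (k - 1)) (p k)"
    using np unfolding path_length_def edge_path_def by blast+
  define q where "q k = (case k of 0 \<Rightarrow> v | Suc j \<Rightarrow> p j)" for k
  have "(\<Sum>k=1..Suc n. ?g q k) = ?g q 1 + (\<Sum>k=1..n. ?g q (Suc k))"
    by (subst sum.atLeast_Suc_atMost) (simp_all add: sum.shift_bounds_cl_Suc_ivl del: sum.cl_ivl_Suc)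
  also have "(\<Sum>k=1..n. ?g q (Suc k)) = L"
    unfolding p(1) by (rule sum.cong) (auto simp: q_def split: nat.split)
  also have "?g q 1 = edge_length S v u" using p(2) by (simp add: q_def)
  finally have "edge_length S v u + L = (\<Sum>k=1..Suc n. ?g q k)" by simp
  moreover have "adj S (q (k - 1)) (q k)" if "k \<in> {1..Suc n}" for k
    using bspec[OF p(4), of "k - 1"] that p(2) assms(2)
    by (cases k) (auto simp: q_def split: nat.split)
  moreover have "q 0 = v" "q (Suc n) = w" using p by (auto simp: q_def)
  ultimately have "edge_path S v w (Suc n) q" "edge_length S v u + L = path_length S (Suc n) q"
    by (auto simp only: edge_path_def path_length_def)
  then show ?thesis unfolding path_lengths_eq by blast
qed

lemma path_lengths_cases:
  assumes "L \<in> path_lengths S v w"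
  obtains "v = w" "L = 0"
    | u L' where "adj S v u" "L' \<in> path_lengths S u w" "L = edge_length S v u + L'"
proof -
  let ?g = "\<lambda>p k. real (max (deg S (p k)) (deg S (p (k - 1)))) powr (-1/2)"
  obtain n p where np: "L = path_length S n p" "edge_path S v w n p"
    using assms(1) unfolding path_lengths_eq by blast
  have p: "L = (\<Sum>k=1..n. ?g p k)" "p 0 = v" "p n = w" "\<forall>k\<in>{1..n}. adj S (p (k - 1)) (p k)"
    using np unfolding path_length_def edge_path_def by blast+
  show ?thesis
  proof (cases n)
    case 0
    then show ?thesis using p that(1) by simp
  next
    case (Suc m)
    define q where "q k = p (Suc k)" for k
    have "L = ?g p 1 + (\<Sum>k=1..m. ?g p (Suc k))"
      unfolding p(1) Suc
      by (subst sum.atLeast_Suc_atMost) (simp_all add: sum.shift_bounds_cl_Suc_ivl del: sum.cl_ivl_Suc)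
    moreover have "(\<Sum>k=1..m. ?g p (Suc k)) = (\<Sum>k=1..m. ?g q k)"
      by (rule sum.cong) (auto simp: q_def)
    ultimately have "L = edge_length S v (q 0) + (\<Sum>k=1..m. ?g q k)"
      using p(2) by (simp add: q_def)
    moreover have "adj S (q (k - 1)) (q k)" if "k \<in> {1..m}" for k
      using bspec[OF p(4), of "Suc k"] that Suc by (cases k) (auto simp: q_def)
    then have "edge_path S (q 0) w m q" using p(3) Suc by (simp add: edge_path_def q_def)
    then have "(\<Sum>k=1..m. ?g q k) \<in> path_lengths S (q 0) w"
      unfolding path_lengths_eq path_length_def[symmetric] by blast
    moreover have "adj S v (q 0)" using bspec[OF p(4), of 1] Suc p(2) by (simp add: q_def)
    ultimately show ?thesis using that(2) by blast
  qed
qed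

lemma deg_dist_le: "L \<in> path_lengths S v w \<Longrightarrow> deg_dist S v w \<le> L"
  unfolding deg_dist_def
  by (auto intro!: cInf_lower bdd_belowI[of _ 0] path_lengths_nonneg)

lemma deg_dist_le_edge: "adj S v w \<Longrightarrow> deg_dist S v w \<le> edge_length S v w"
  using deg_dist_le[OF path_lengths_Cons[OF path_lengths_refl]] by fastforce

text \<open>Defined by actual paths instead of \<open>deg_dist\<close>, so that the ball can be
  decomposed along first edges; it is empty for \<open>s \<le> 0\<close>.\<close>

definition path_ball :: "'v set set \<Rightarrow> 'v \<Rightarrow> real \<Rightarrow> 'v set" where
  "path_ball S v s = {w. \<exists>L\<in>path_lengths S v w. L < s}"

text \<open>The branching step of a Koenig type argument: a path is trivial, or it moves to a
  neighbour and the length of that edge is deducted from the radius.\<close>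

lemma path_ball_subset:
  "path_ball S v s \<subseteq> insert v (\<Union>u\<in>{u. adj S v u}. path_ball S u (s - edge_length S v u))"
proof
  fix w assume "w \<in> path_ball S v s"
  then obtain L where L: "L \<in> path_lengths S v w" "L < s" by (auto simp: path_ball_def)
  from L(1) show "w \<in> insert v (\<Union>u\<in>{u. adj S v u}. path_ball S u (s - edge_length S v u))"
  proof (cases rule: path_lengths_cases)
    case (2 u L')
    then have "w \<in> path_ball S u (s - edge_length S v u)"
      using L(2) unfolding path_ball_def by (intro CollectI bexI[of _ L']) auto
    then show ?thesis using 2 by blast
  qed simp
qed

context unit_weight_complex
begin

lemma adj_iff: "adj S v w \<longleftrightarrow> v \<noteq> w \<and> {v, w} \<in> S"
  by (auto simp: adj_def ksimplices_def sdim_def)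

lemma adj_vertex: "adj S v w \<Longrightarrow> v \<in> vertices S \<and> w \<in> vertices S"
  by (auto simp: adj_iff intro: vertex_of)

lemma finite_neighbours: "finite {w. adj S v w}"
proof (cases "v \<in> vertices S")
  case True
  have "{w. adj S v w} \<subseteq> \<Union> (cofaces S {v})"
    by (auto simp: adj_iff cofaces_def covered_iff intro!: exI[of _ "{v, _}"])
  moreover have "finite (\<Union> (cofaces S {v}))"
    using True finite_cofaces[of "{v}"] S_finite
    by (intro finite_Union) (auto simp: vertex_iff cofaces_def)
  ultimately show ?thesis by (rule finite_subset)
next
  case False
  then have "{w. adj S v w} = {}" using adj_vertex by auto
  then show ?thesis by simp
qed

text \<open>Guards the use of \<open>powr\<close>: since \<open>0 powr x = 0\<close>, edge lengths
  would degenerate at degree 0.\<close>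

lemma deg_pos: "adj S v w \<Longrightarrow> 0 < deg S v"
  unfolding deg_eq
proof -
  assume a: "adj S v w"
  then have "{v, w} \<in> cofaces S {v}" by (auto simp: adj_iff cofaces_def covered_iff)
  moreover have "finite (cofaces S {v})" using a adj_vertex by (auto simp: vertex_iff finite_cofaces)
  ultimately show "0 < card (cofaces S {v})" by (auto simp: card_gt_0_iff)
qed

lemma edge_length_pos: "adj S v w \<Longrightarrow> 0 < edge_length S v w"
  using deg_pos[of v w] by (simp add: powr_gt_zero max_def)

lemma edge_length_le: "adj S v w \<Longrightarrow> edge_length S v w \<le> real (deg S v) powr (-1/2)"
  using deg_pos[of v w] by (intro powr_mono2') auto

lemma path_lengths_nonempty:
  assumes "(adj S)\<^sup>*\<^sup>* v w" shows "path_lengths S v w \<noteq> {}"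
  using assms
proof (induction rule: converse_rtranclp_induct)
  case base
  show ?case using path_lengths_refl[of S w] by blast
next
  case (step v u)
  then obtain L where "L \<in> path_lengths S u w" by blast
  from path_lengths_Cons[OF this step(1)] show ?case by blast
qed

text \<open>A path to another vertex has to start with one of the finitely many edges at
  \<open>v\<close>, and the shortest of these has positive length. So the topology is discrete, and
  convergent sequences are eventually constant.\<close>

lemma deg_dist_gap:
  assumes conn: "connected_complex S" and v: "v \<in> vertices S"
  obtains e where "e > 0" "\<And>w. w \<in> vertices S \<Longrightarrow> deg_dist S v w < e \<Longrightarrow> w = v"
proof -
  \<comment> \<open>The element 1 keeps the set nonempty when \<open>v\<close> has no
    neighbour.\<close>
  define E where "E = insert 1 (edge_length S v ` {u. adj S v u})"
  have E: "finite E" "E \<noteq> {}" by (auto simp: E_def finite_neighbours)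
  show ?thesis
  proof (rule that[of "Min E"])
    show "Min E > 0" using E edge_length_pos by (auto simp: E_def)
    fix w assume w: "w \<in> vertices S" and less: "deg_dist S v w < Min E"
    show "w = v"
    proof (rule ccontr)
      assume ne: "w \<noteq> v"
      have pl: "path_lengths S v w \<noteq> {}"
        using conn v w by (intro path_lengths_nonempty) (auto simp: connected_complex_def)
      have "Min E \<le> Inf (path_lengths S v w)"
      proof (rule cInf_greatest[OF pl])
        fix L assume "L \<in> path_lengths S v w"
        then show "Min E \<le> L"
        proof (cases rule: path_lengths_cases)
          case (2 u L')
          then have "Min E \<le> edge_length S v u" using E by (intro Min_le) (auto simp: E_def)
          then show ?thesis using 2 path_lengths_nonneg[OF 2(2)] by simp
        qed (use ne in simp)
      qed
      then show False using less pl by (simp add: deg_dist_def)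
    qed
  qed
qed

text \<open>An infinite ball would contain a path of finite total length whose remaining balls are all
  infinite; by completeness the path converges, hence is eventually constant.\<close>

lemma finite_path_ball:
  assumes conn: "connected_complex S"
    and ms: "Metric_space (vertices S) (deg_dist S)"
    and complete: "Metric_space.mcomplete (vertices S) (deg_dist S)"
    and b: "b \<in> vertices S"
  shows "finite (path_ball S b R)"
proof (rule ccontr)
  assume inf: "infinite (path_ball S b R)"
  interpret Metric_space "vertices S" "deg_dist S" by (rule ms)
  \<comment> \<open>The state is a vertex together with the radius still available; an infinite ball
    and finitely many neighbours force an infinite ball around some neighbour.\<close>
  let ?P = "\<lambda>(n::nat) (x::'v \<times> real). fst x \<in> vertices S \<and> infinite (path_ball S (fst x) (snd x))"
  let ?Q = "\<lambda>(n::nat) (x::'v \<times> real) y. adj S (fst x) (fst y) \<and> snd y = snd x - edge_length S (fst x) (fst y)"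
  have "\<exists>x. \<forall>n. ?P n (x n) \<and> ?Q n (x n) (x (Suc n))"
  proof (rule dependent_nat_choice)
    show "\<exists>x. ?P 0 x" using b inf by (intro exI[of _ "(b, R)"]) simp
  next
    fix x n assume P: "?P n x"
    have "\<exists>u. adj S (fst x) u \<and> infinite (path_ball S u (snd x - edge_length S (fst x) u))"
    proof (rule ccontr)
      assume "\<not> ?thesis"
      then have "finite (insert (fst x) (\<Union>u\<in>{u. adj S (fst x) u}.
          path_ball S u (snd x - edge_length S (fst x) u)))"
        using finite_neighbours by auto
      then show False using path_ball_subset[of S "fst x" "snd x"] P finite_subset by blast
    qed
    then obtain u where u: "adj S (fst x) u" "infinite (path_ball S u (snd x - edge_length S (fst x) u))"
      by blast
    then show "\<exists>y. ?P (Suc n) y \<and> ?Q n x y"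
      using adj_vertex[OF u(1)] by (intro exI[of _ "(u, snd x - edge_length S (fst x) u)"]) simp
  qed
  then obtain x where x: "\<And>n. ?P n (x n)" "\<And>n. ?Q n (x n) (x (Suc n))" by blast
  define v where "v n = fst (x n)" for n
  define s where "s n = snd (x n)" for n
  have vV: "v n \<in> vertices S" and vadj: "adj S (v n) (v (Suc n))"
    and s_Suc: "s (Suc n) = s n - edge_length S (v n) (v (Suc n))"
    and v_inf: "infinite (path_ball S (v n) (s n))" for n
    using x(1)[of n] x(2)[of n] by (auto simp: v_def s_def)
  have s_pos: "0 \<le> s n" for n
  proof -
    have "path_ball S (v n) (s n) \<noteq> {}" using v_inf[of n] by auto
    then obtain w L where "L \<in> path_lengths S (v n) w" "L < s n" by (auto simp: path_ball_def)
    then show ?thesis using path_lengths_nonneg by force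
  qed
  \<comment> \<open>The distance travelled is at most the radius used up; as the radii decrease and
    stay nonnegative, the vertices form a Cauchy sequence.\<close>
  have step: "deg_dist S (v m) (v (m + k)) \<le> s m - s (m + k)" for m k
  proof (induction k)
    case 0
    then show ?case using vV by simp
  next
    case (Suc k)
    have "deg_dist S (v m) (v (m + Suc k))
        \<le> deg_dist S (v m) (v (m + k)) + deg_dist S (v (m + k)) (v (Suc (m + k)))"
      using triangle vV by simp
    also have "\<dots> \<le> s m - s (m + Suc k)"
      using Suc deg_dist_le_edge[OF vadj[of "m + k"]] s_Suc[of "m + k"] by simp
    finally show ?case .
  qed
  have "decseq s" by (rule decseq_SucI) (simp add: s_Suc)
  then have "convergent s"
    using decseq_bounded[of s 0] s_pos by (metis Bseq_monoseq_convergent decseq_imp_monoseq)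
  then have "Cauchy s" by (rule convergent_Cauchy)
  have "MCauchy v"
    unfolding MCauchy_def
  proof (intro conjI allI impI)
    show "range v \<subseteq> vertices S" using vV by auto
    fix e :: real assume "e > 0"
    then obtain N where N: "\<And>m n. m \<ge> N \<Longrightarrow> n \<ge> N \<Longrightarrow> \<bar>s m - s n\<bar> < e"
      using CauchyD[OF \<open>Cauchy s\<close>, of e] by auto
    have le: "deg_dist S (v m) (v n) < e" if "N \<le> m" "m \<le> n" for m n
      using step[of m "n - m"] N[of m n] that by simp
    have "deg_dist S (v m) (v n) < e" if "N \<le> m" "N \<le> n" for m n
      using le[of m n] le[of n m] that commute by (cases "m \<le> n") auto
    then show "\<exists>N. \<forall>n n'. N \<le> n \<longrightarrow> N \<le> n' \<longrightarrow> deg_dist S (v n) (v n') < e" by blast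
  qed
  then obtain y where "limitin mtopology v y sequentially"
    using complete by (auto simp: mcomplete_def)
  then have y: "y \<in> vertices S" and lim: "\<And>e. e > 0 \<Longrightarrow> \<exists>N. \<forall>n\<ge>N. deg_dist S (v n) y < e"
    unfolding limit_metric_sequentially by (simp, meson)
  obtain e where "e > 0" and e: "\<And>w. w \<in> vertices S \<Longrightarrow> deg_dist S y w < e \<Longrightarrow> w = y"
    using deg_dist_gap[OF conn y] by blast
  obtain N where "\<And>n. n \<ge> N \<Longrightarrow> deg_dist S (v n) y < e" using lim[OF \<open>e > 0\<close>] by blast
  then have "v n = y" if "n \<ge> N" for n using e[OF vV] commute that by metis
  then have "v N = v (Suc N)" by simp
  then show False using vadj[of N] by (simp add: adj_def)
qed

end

subsection \<open>Cutoff functions\<close>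

text \<open>Symmetrised in \<open>(\<tau>, \<tau>')\<close>, the product is \<open>(\<Sum>\<phi>x)\<^sup>2 + 1/2 \<Sum>\<Sum> x\<^sub>\<tau> x\<^sub>\<tau>' (\<phi>\<^sub>\<tau> - \<phi>\<^sub>\<tau>')\<^sup>2\<close>.\<close>

lemma cutoff_product_ge:
  fixes x \<phi> f :: "'a \<Rightarrow> real"
  assumes "\<And>\<tau>. \<bar>x \<tau>\<bar> \<le> \<bar>f \<tau>\<bar>"
  shows "- (\<Sum>\<tau>\<in>N. (f \<tau>)\<^sup>2 * (\<Sum>\<tau>'\<in>N. (\<phi> \<tau> - \<phi> \<tau>')\<^sup>2)) \<le> 2 * ((\<Sum>\<tau>\<in>N. (\<phi> \<tau>)\<^sup>2 * x \<tau>) * (\<Sum>\<tau>\<in>N. x \<tau>))"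
proof -
  let ?D = "\<lambda>\<tau> \<tau>'. (\<phi> \<tau> - \<phi> \<tau>')\<^sup>2"
  have swap: "(\<Sum>\<tau>\<in>N. \<Sum>\<tau>'\<in>N. ?D \<tau> \<tau>' * (f \<tau>')\<^sup>2) = (\<Sum>\<tau>\<in>N. \<Sum>\<tau>'\<in>N. ?D \<tau> \<tau>' * (f \<tau>)\<^sup>2)"
    by (subst sum.swap) (simp add: power2_commute)
  have pq: "(\<Sum>\<tau>\<in>N. g \<tau>) * (\<Sum>\<tau>\<in>N. h \<tau>) = (\<Sum>\<tau>\<in>N. \<Sum>\<tau>'\<in>N. g \<tau> * h \<tau>')" for g h :: "'a \<Rightarrow> real"
    by (rule sum_product)
  have a: "(\<Sum>\<tau>\<in>N. (\<phi> \<tau>)\<^sup>2 * x \<tau>) * (\<Sum>\<tau>\<in>N. x \<tau>) = (\<Sum>\<tau>\<in>N. \<Sum>\<tau>'\<in>N. (\<phi> \<tau>)\<^sup>2 * x \<tau> * x \<tau>')"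
    by (rule pq)
  have b: "(\<Sum>\<tau>\<in>N. (\<phi> \<tau>)\<^sup>2 * x \<tau>) * (\<Sum>\<tau>\<in>N. x \<tau>) = (\<Sum>\<tau>\<in>N. \<Sum>\<tau>'\<in>N. x \<tau> * ((\<phi> \<tau>')\<^sup>2 * x \<tau>'))"
    by (subst mult.commute) (rule pq)
  have c: "(\<Sum>\<tau>\<in>N. \<phi> \<tau> * x \<tau>) * (\<Sum>\<tau>\<in>N. \<phi> \<tau> * x \<tau>) = (\<Sum>\<tau>\<in>N. \<Sum>\<tau>'\<in>N. \<phi> \<tau> * x \<tau> * (\<phi> \<tau>' * x \<tau>'))"
    by (rule pq)
  have "2 * ((\<Sum>\<tau>\<in>N. (\<phi> \<tau>)\<^sup>2 * x \<tau>) * (\<Sum>\<tau>\<in>N. x \<tau>)) - 2 * ((\<Sum>\<tau>\<in>N. \<phi> \<tau> * x \<tau>) * (\<Sum>\<tau>\<in>N. \<phi> \<tau> * x \<tau>))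
      = (\<Sum>\<tau>\<in>N. \<Sum>\<tau>'\<in>N. (\<phi> \<tau>)\<^sup>2 * x \<tau> * x \<tau>' + x \<tau> * ((\<phi> \<tau>')\<^sup>2 * x \<tau>') - 2 * (\<phi> \<tau> * x \<tau> * (\<phi> \<tau>' * x \<tau>')))"
    by (simp only: sum_subtractf sum.distrib sum_distrib_left[symmetric, where r = 2]
        a[symmetric] b[symmetric] c[symmetric])
  also have "\<dots> = (\<Sum>\<tau>\<in>N. \<Sum>\<tau>'\<in>N. ?D \<tau> \<tau>' * (x \<tau> * x \<tau>'))"
    by (intro sum.cong refl) (simp add: power2_eq_square algebra_simps)
  \<comment> \<open>\<open>?D\<close> is nonnegative, so products of values of \<open>x\<close> may
    be replaced by their lower bound from the arithmetic-geometric mean inequality; the two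
    resulting sums agree by symmetry of \<open>?D\<close>.\<close>
  also have "\<dots> \<ge> (\<Sum>\<tau>\<in>N. \<Sum>\<tau>'\<in>N. ?D \<tau> \<tau>' * (- ((f \<tau>)\<^sup>2 + (f \<tau>')\<^sup>2) / 2))"
  proof (intro sum_mono mult_left_mono)
    fix \<tau> \<tau>'
    have "\<bar>x \<tau> * x \<tau>'\<bar> \<le> \<bar>f \<tau>\<bar> * \<bar>f \<tau>'\<bar>" unfolding abs_mult by (intro mult_mono assms) auto
    also have "\<dots> \<le> ((f \<tau>)\<^sup>2 + (f \<tau>')\<^sup>2) / 2"
      using sum_squares_bound[of "\<bar>f \<tau>\<bar>" "\<bar>f \<tau>'\<bar>"] by simp
    finally show "- ((f \<tau>)\<^sup>2 + (f \<tau>')\<^sup>2) / 2 \<le> x \<tau> * x \<tau>'"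
      unfolding minus_divide_left[symmetric] by (simp only: abs_le_iff minus_le_iff)
  qed simp
  also have "(\<Sum>\<tau>\<in>N. \<Sum>\<tau>'\<in>N. ?D \<tau> \<tau>' * (- ((f \<tau>)\<^sup>2 + (f \<tau>')\<^sup>2) / 2))
      = - ((\<Sum>\<tau>\<in>N. \<Sum>\<tau>'\<in>N. ?D \<tau> \<tau>' * (f \<tau>)\<^sup>2) + (\<Sum>\<tau>\<in>N. \<Sum>\<tau>'\<in>N. ?D \<tau> \<tau>' * (f \<tau>')\<^sup>2)) / 2"
    by (simp add: sum.distrib[symmetric] sum_negf[symmetric] sum_divide_distrib algebra_simps)
  also have "\<dots> = - (\<Sum>\<tau>\<in>N. (f \<tau>)\<^sup>2 * (\<Sum>\<tau>'\<in>N. ?D \<tau> \<tau>'))"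
    unfolding swap by (simp add: sum_distrib_left mult.commute)
  finally have "- (\<Sum>\<tau>\<in>N. (f \<tau>)\<^sup>2 * (\<Sum>\<tau>'\<in>N. ?D \<tau> \<tau>'))
      \<le> 2 * ((\<Sum>\<tau>\<in>N. (\<phi> \<tau>)\<^sup>2 * x \<tau>) * (\<Sum>\<tau>\<in>N. x \<tau>)) - 2 * ((\<Sum>\<tau>\<in>N. \<phi> \<tau> * x \<tau>) * (\<Sum>\<tau>\<in>N. \<phi> \<tau> * x \<tau>))" .
  moreover have "0 \<le> (\<Sum>\<tau>\<in>N. \<phi> \<tau> * x \<tau>) * (\<Sum>\<tau>\<in>N. \<phi> \<tau> * x \<tau>)" by simp
  ultimately show ?thesis by linarith
qed

text \<open>\<open>cutoff_product_ge\<close> is applied in each row of \<open>a\<close>, and the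
  errors are regrouped by \<open>\<tau>\<close>, where \<open>\<epsilon>\<close> bounds their total.
  Only the norm of \<open>f\<close> enters: \<open>mat_op a f\<close> need not be square summable,
  as the tested cochain has finite support.\<close>

lemma cutoff_energy_ge:
  assumes a: "row_col_finite S a" "\<And>\<sigma> \<tau>. \<bar>a \<sigma> \<tau>\<bar> \<le> 1"
    and \<phi>: "\<phi> \<in> fin_cochains S" and f: "f \<in> l2 S"
    and eps: "\<And>\<tau>. \<tau> \<in> S \<Longrightarrow> (\<Sum>\<sigma> | a \<sigma> \<tau> \<noteq> 0. \<Sum>\<tau>' | a \<sigma> \<tau>' \<noteq> 0. (\<phi> \<tau> - \<phi> \<tau>')\<^sup>2) \<le> \<epsilon>"
  shows "- \<epsilon> * (l2_norm S f)\<^sup>2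
    \<le> 2 * l2_inner S (\<lambda>\<tau>. (\<phi> \<tau>)\<^sup>2 * f \<tau>) (mat_op (flip a) (mat_op a f))"
proof -
  let ?u = "\<lambda>\<tau>. (\<phi> \<tau>)\<^sup>2 * f \<tau>"
  have u: "?u \<in> fin_cochains S"
    using \<phi> by (auto simp: fin_cochains_def cochains_def elim: rev_finite_subset)
  define B where "B = {\<sigma>. mat_op a ?u \<sigma> \<noteq> 0}"
  have B: "finite B" using mat_op_fin[OF a(1) u] by (simp add: B_def fin_cochains_def)
  let ?N = "\<lambda>\<sigma>. {\<tau>. a \<sigma> \<tau> \<noteq> 0}"
  let ?T = "\<Union>\<sigma>\<in>B. ?N \<sigma>"
  have T: "finite ?T" "?T \<subseteq> S" using B a(1) by (auto simp: row_col_finite_def)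
  let ?d = "\<lambda>\<sigma> \<tau>. \<Sum>\<tau>' | a \<sigma> \<tau>' \<noteq> 0. (\<phi> \<tau> - \<phi> \<tau>')\<^sup>2"
  have "(\<Sum>\<sigma>\<in>B. \<Sum>\<tau>\<in>?N \<sigma>. (f \<tau>)\<^sup>2 * ?d \<sigma> \<tau>) = (\<Sum>\<sigma>\<in>B. \<Sum>\<tau> | \<tau> \<in> ?T \<and> a \<sigma> \<tau> \<noteq> 0. (f \<tau>)\<^sup>2 * ?d \<sigma> \<tau>)"
    by (intro sum.cong) auto
  also have "\<dots> = (\<Sum>\<tau>\<in>?T. \<Sum>\<sigma> | \<sigma> \<in> B \<and> a \<sigma> \<tau> \<noteq> 0. (f \<tau>)\<^sup>2 * ?d \<sigma> \<tau>)"
    by (rule sum.swap_restrict[OF B T(1)])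
  also have "\<dots> \<le> (\<Sum>\<tau>\<in>?T. \<epsilon> * (f \<tau>)\<^sup>2)"
  proof (rule sum_mono)
    fix \<tau> assume "\<tau> \<in> ?T"
    have "(\<Sum>\<sigma> | \<sigma> \<in> B \<and> a \<sigma> \<tau> \<noteq> 0. ?d \<sigma> \<tau>) \<le> (\<Sum>\<sigma> | a \<sigma> \<tau> \<noteq> 0. ?d \<sigma> \<tau>)"
      by (intro sum_mono2 col_finite[OF a(1)]) (auto intro!: sum_nonneg)
    also have "\<dots> \<le> \<epsilon>" using \<open>\<tau> \<in> ?T\<close> T(2) by (intro eps) blast
    finally show "(\<Sum>\<sigma> | \<sigma> \<in> B \<and> a \<sigma> \<tau> \<noteq> 0. (f \<tau>)\<^sup>2 * ?d \<sigma> \<tau>) \<le> \<epsilon> * (f \<tau>)\<^sup>2"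
      unfolding sum_distrib_left[symmetric] mult.commute[of \<epsilon>] by (rule mult_left_mono) simp
  qed
  also have "\<dots> \<le> \<epsilon> * (l2_norm S f)\<^sup>2"
  \<comment> \<open>That \<open>\<epsilon>\<close> is nonnegative follows from \<open>eps\<close>
    only if there is a simplex at all; if there is none, \<open>f\<close> is zero.\<close>
  proof (cases "?T = {}")
    case True
    moreover have "0 \<le> \<epsilon>" if "\<epsilon> * (l2_norm S f)\<^sup>2 < 0" using that
    proof -
      from that have "f \<noteq> 0" using l2_norm_zero_iff[OF l2_zero, of S] by (intro notI) simp
      then obtain \<tau> where "\<tau> \<in> S" using cochain_outside[OF l2_cochain[OF f]] by (auto simp: fun_eq_iff)
      from order_trans[OF _ eps[OF this]] show ?thesis by (simp add: sum_nonneg)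
    qed
    ultimately have "0 \<le> \<epsilon> * (l2_norm S f)\<^sup>2"
      by (metis mult_nonneg_nonneg not_le zero_le_power2)
    then show ?thesis unfolding True by simp
  next
    case False
    then obtain \<tau> where "\<tau> \<in> S" using T(2) by blast
    from order_trans[OF _ eps[OF this]] have "0 \<le> \<epsilon>" by (simp add: sum_nonneg)
    then show ?thesis
      using l2_finite_sum_le[OF f T(1)] by (simp add: sum_distrib_left[symmetric] mult_left_mono)
  qed
  finally have le: "(\<Sum>\<sigma>\<in>B. \<Sum>\<tau>\<in>?N \<sigma>. (f \<tau>)\<^sup>2 * ?d \<sigma> \<tau>) \<le> \<epsilon> * (l2_norm S f)\<^sup>2" .
  have "l2_inner S ?u (mat_op (flip a) (mat_op a f)) = l2_inner S (mat_op a ?u) (mat_op a f)"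
    by (rule mat_op_flip[OF a(1) u, symmetric])
  also have "\<dots> = (\<Sum>\<sigma>\<in>B. mat_op a ?u \<sigma> * mat_op a f \<sigma>)"
    using B by (intro l2_inner_finite) (auto simp: B_def mat_op_cochain[OF a(1)])
  finally have eq: "l2_inner S ?u (mat_op (flip a) (mat_op a f)) = (\<Sum>\<sigma>\<in>B. mat_op a ?u \<sigma> * mat_op a f \<sigma>)" .
  have "(\<Sum>\<sigma>\<in>B. - (\<Sum>\<tau>\<in>?N \<sigma>. (f \<tau>)\<^sup>2 * ?d \<sigma> \<tau>)) \<le> (\<Sum>\<sigma>\<in>B. 2 * (mat_op a ?u \<sigma> * mat_op a f \<sigma>))"
  proof (rule sum_mono)
    fix \<sigma>
    have "\<bar>a \<sigma> \<tau> * f \<tau>\<bar> \<le> \<bar>f \<tau>\<bar>" for \<tau>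
      using mult_right_mono[OF a(2)[of \<sigma> \<tau>], of "\<bar>f \<tau>\<bar>"] by (simp add: abs_mult)
    from cutoff_product_ge[where N = "?N \<sigma>" and \<phi> = \<phi>, OF this]
    show "- (\<Sum>\<tau>\<in>?N \<sigma>. (f \<tau>)\<^sup>2 * ?d \<sigma> \<tau>) \<le> 2 * (mat_op a ?u \<sigma> * mat_op a f \<sigma>)"
      unfolding mat_op_def by (simp only: mult.left_commute)
  qed
  then have "- (\<Sum>\<sigma>\<in>B. \<Sum>\<tau>\<in>?N \<sigma>. (f \<tau>)\<^sup>2 * ?d \<sigma> \<tau>) \<le> 2 * (\<Sum>\<sigma>\<in>B. mat_op a ?u \<sigma> * mat_op a f \<sigma>)"
    unfolding sum_negf by (simp only: sum_distrib_left[of 2])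
  with le show ?thesis unfolding eq by linarith
qed

context unit_weight_complex
begin

text \<open>Tested with the square of \<phi> times f, the equation yields -\<mu> times the squared
  norm of \<phi> f, while each of its two terms is at least -\<epsilon>/2 times that of f. At a
  fixed simplex the cutoffs tend to 1 and the bound tends to 0.\<close>

lemma kernel_trivial_by_cutoffs:
  assumes f: "f \<in> l2 S" and \<mu>: "\<mu> > 0"
    and eq: "bdr (cob f) + cob (bdr f) = (\<lambda>\<tau>. - \<mu> * f \<tau>)"
    and \<phi>: "\<And>n::nat. \<phi> n \<in> fin_cochains S" and lim: "\<And>\<tau>. \<tau> \<in> S \<Longrightarrow> (\<lambda>n. \<phi> n \<tau>) \<longlonglongrightarrow> 1"
    and eps: "\<epsilon> \<longlonglongrightarrow> 0"
    and up: "\<And>n \<tau>. \<tau> \<in> S \<Longrightarrow> (\<Sum>\<sigma>\<in>cofaces S \<tau>. \<Sum>\<tau>'\<in>faces S \<sigma>. (\<phi> n \<tau> - \<phi> n \<tau>')\<^sup>2) \<le> \<epsilon> n"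
    and down: "\<And>n \<tau>. \<tau> \<in> S \<Longrightarrow> (\<Sum>\<rho>\<in>faces S \<tau>. \<Sum>\<tau>'\<in>cofaces S \<rho>. (\<phi> n \<tau> - \<phi> n \<tau>')\<^sup>2) \<le> \<epsilon> n"
  shows "f = 0"
proof
  fix \<tau>
  show "f \<tau> = 0 \<tau>"
  proof (cases "\<tau> \<in> S")
    case False
    then show ?thesis by (simp add: cochain_outside[OF l2_cochain[OF f]])
  next
    case True
    have bound: "\<mu> * (\<phi> n \<tau> * f \<tau>)\<^sup>2 \<le> \<epsilon> n * (l2_norm S f)\<^sup>2" for n
    proof -
      let ?u = "\<lambda>\<tau>. (\<phi> n \<tau>)\<^sup>2 * f \<tau>"
      define B where "B = {\<tau>. \<phi> n \<tau> \<noteq> 0}"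
      have B: "finite B" using \<phi>[of n] by (simp add: B_def fin_cochains_def)
      have "?u \<in> cochains S" using l2_cochain[OF f] by (auto simp: cochains_def)
      then have inner: "l2_inner S ?u g = (\<Sum>\<tau>\<in>B. ?u \<tau> * g \<tau>)" for g
        using B by (intro l2_inner_finite) (auto simp: B_def)
      have "(\<Sum>\<sigma> | inc \<kappa> \<sigma> \<noteq> 0. \<Sum>\<tau>' | inc \<tau>' \<sigma> \<noteq> 0. (\<phi> n \<kappa> - \<phi> n \<tau>')\<^sup>2) \<le> \<epsilon> n" if \<kappa>: "\<kappa> \<in> S" for \<kappa>
      proof -
        have "(\<Sum>\<sigma> | inc \<kappa> \<sigma> \<noteq> 0. \<Sum>\<tau>' | inc \<tau>' \<sigma> \<noteq> 0. (\<phi> n \<kappa> - \<phi> n \<tau>')\<^sup>2)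
            = (\<Sum>\<sigma>\<in>cofaces S \<kappa>. \<Sum>\<tau>'\<in>faces S \<sigma>. (\<phi> n \<kappa> - \<phi> n \<tau>')\<^sup>2)"
          unfolding inc_row[OF \<kappa>] by (intro sum.cong refl) (auto simp: inc_col cofaces_def)
        then show ?thesis using up[OF \<kappa>] by simp
      qed
      from cutoff_energy_ge[OF row_col_finite_flip[OF inc_rcf] abs_inc_le \<phi> f this]
      have 1: "- \<epsilon> n * (l2_norm S f)\<^sup>2 \<le> 2 * l2_inner S ?u (bdr (cob f))" .
      have "(\<Sum>\<rho> | inc \<rho> \<kappa> \<noteq> 0. \<Sum>\<tau>' | inc \<rho> \<tau>' \<noteq> 0. (\<phi> n \<kappa> - \<phi> n \<tau>')\<^sup>2) \<le> \<epsilon> n" if \<kappa>: "\<kappa> \<in> S" for \<kappa>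
      proof -
        have "(\<Sum>\<rho> | inc \<rho> \<kappa> \<noteq> 0. \<Sum>\<tau>' | inc \<rho> \<tau>' \<noteq> 0. (\<phi> n \<kappa> - \<phi> n \<tau>')\<^sup>2)
            = (\<Sum>\<rho>\<in>faces S \<kappa>. \<Sum>\<tau>'\<in>cofaces S \<rho>. (\<phi> n \<kappa> - \<phi> n \<tau>')\<^sup>2)"
          unfolding inc_col[OF \<kappa>] by (intro sum.cong refl) (auto simp: inc_row faces_def)
        then show ?thesis using down[OF \<kappa>] by simp
      qed
      from cutoff_energy_ge[OF inc_rcf abs_inc_le \<phi> f this]
      have 2: "- \<epsilon> n * (l2_norm S f)\<^sup>2 \<le> 2 * l2_inner S ?u (cob (bdr f))" .
      have "l2_inner S ?u (bdr (cob f)) + l2_inner S ?u (cob (bdr f))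
          = l2_inner S ?u (bdr (cob f) + cob (bdr f))"
        by (simp add: inner sum.distrib[symmetric] distrib_left)
      also have "\<dots> = - \<mu> * (\<Sum>\<tau>\<in>B. (\<phi> n \<tau> * f \<tau>)\<^sup>2)"
        unfolding eq inner sum_distrib_left by (intro sum.cong) (auto simp: power2_eq_square)
      finally have "\<mu> * (\<Sum>\<tau>\<in>B. (\<phi> n \<tau> * f \<tau>)\<^sup>2) \<le> \<epsilon> n * (l2_norm S f)\<^sup>2" using 1 2 by simp
      moreover have "(\<phi> n \<tau> * f \<tau>)\<^sup>2 \<le> (\<Sum>\<tau>\<in>B. (\<phi> n \<tau> * f \<tau>)\<^sup>2)"
      proof (cases "\<tau> \<in> B")
        case True
        then show ?thesis using B by (intro member_le_sum) auto
      next
        case False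
        then show ?thesis by (simp add: B_def sum_nonneg)
      qed
      ultimately show ?thesis using \<mu> by (meson mult_left_mono less_imp_le order_trans)
    qed
    have "(\<lambda>n. \<mu> * (\<phi> n \<tau> * f \<tau>)\<^sup>2) \<longlonglongrightarrow> \<mu> * (1 * f \<tau>)\<^sup>2"
      by (intro tendsto_intros lim True)
    moreover have "(\<lambda>n. \<epsilon> n * (l2_norm S f)\<^sup>2) \<longlonglongrightarrow> 0 * (l2_norm S f)\<^sup>2"
      by (intro tendsto_intros eps)
    ultimately have "\<mu> * (1 * f \<tau>)\<^sup>2 \<le> 0 * (l2_norm S f)\<^sup>2"
      by (rule LIMSEQ_le) (use bound in blast)
    then have "(f \<tau>)\<^sup>2 \<le> 0" using \<mu> by (simp add: mult_le_0_iff)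
    then show ?thesis by simp
  qed
qed

lemma deg_dist_in_simplex:
  assumes ms: "Metric_space (vertices S) (deg_dist S)"
    and \<sigma>: "\<sigma> \<in> S" "v \<in> \<sigma>" "x \<in> \<sigma>"
  shows "deg_dist S v x \<le> real (deg S v) powr (-1/2)"
proof (cases "x = v")
  case True
  then show ?thesis
    using Metric_space.mdist_zero[OF ms vertex_of[OF \<sigma>(1,2)]] by simp
next
  case False
  then have "adj S v x" using S_subset[OF \<sigma>(1), of "{v, x}"] \<sigma> by (auto simp: adj_iff)
  then show ?thesis using deg_dist_le_edge[of S v x] edge_length_le[of v x] by linarith
qed

text \<open>Every further vertex of a simplex at \<open>v\<close> is a neighbour of
  \<open>v\<close>. This turns finite balls of vertices into finite supports of cutoffs.\<close>

lemma finite_star: "finite {\<tau>\<in>S. v \<in> \<tau>}"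
proof (rule finite_subset)
  show "{\<tau>\<in>S. v \<in> \<tau>} \<subseteq> Pow (insert v {w. adj S v w})"
  proof (intro subsetI PowI)
    fix \<tau> x assume "\<tau> \<in> {\<tau>\<in>S. v \<in> \<tau>}" "x \<in> \<tau>"
    then show "x \<in> insert v {w. adj S v w}" using S_subset[of \<tau> "{v, x}"] by (auto simp: adj_iff)
  qed
qed (simp add: finite_neighbours)

lemma finite_metric_ball:
  assumes conn: "connected_complex S"
    and ms: "Metric_space (vertices S) (deg_dist S)"
    and complete: "Metric_space.mcomplete (vertices S) (deg_dist S)"
    and b: "b \<in> vertices S"
  shows "finite {v \<in> vertices S. deg_dist S b v < R}"
proof (rule finite_subset[OF _ finite_path_ball[OF conn ms complete b]])
  show "{v \<in> vertices S. deg_dist S b v < R} \<subseteq> path_ball S b R"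
  proof clarify
    fix v assume v: "v \<in> vertices S" "deg_dist S b v < R"
    have ne: "path_lengths S b v \<noteq> {}"
      using conn b v by (intro path_lengths_nonempty) (auto simp: connected_complex_def)
    then have "Inf (path_lengths S b v) < R" using v(2) by (simp add: deg_dist_def)
    then show "v \<in> path_ball S b R"
      using cInf_lessD[OF ne] unfolding path_ball_def by blast
  qed
qed

text \<open>Here the exponent of the edge lengths pays off: up to n squared differences of size 1/n
  add up to a bounded amount.\<close>

lemma deg_mult_powr_le: "real n * (real n powr (-1/2))\<^sup>2 \<le> 1"
proof (cases "n = 0")
  case False
  have "(real n powr (-1/2))\<^sup>2 = real n powr (-1/2 + -1/2)"
    unfolding power2_eq_square powr_add ..
  also have "\<dots> = 1 / real n" using False by (simp add: powr_minus_divide)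
  finally show ?thesis using False by simp
qed simp

text \<open>The cutoff at a simplex is the cutoff at one of its vertices: by the choice of the edge lengths
  all vertices of neighbouring simplices are within \<open>deg v powr (-1/2)\<close> of a common vertex \<open>v\<close>, while
  at most \<open>deg v\<close> simplices contribute.\<close>

lemma essentially_self_adjoint_complete:
  assumes lap: "is_laplacian S \<delta> k \<Delta>" and conn: "connected_complex S"
    and ms: "Metric_space (vertices S) (deg_dist S)"
    and complete: "Metric_space.mcomplete (vertices S) (deg_dist S)"
  shows "essentially_self_adjoint S (restrict_fin S \<Delta>)"
proof (rule essentially_self_adjoint_from_hodge[OF lap, of 1])
  fix f assume f: "f \<in> l2 S" "bdr (cob f) + cob (bdr f) = (\<lambda>\<tau>. - 1 * f \<tau>)"
  show "f = 0"
  proof (cases "finite S")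
    case True
    \<comment> \<open>For finite \<open>S\<close> the constant 1 is itself a finite cochain. This
      case also covers the empty simplex, in which no vertex could be chosen.\<close>
    let ?\<phi> = "\<lambda>(n::nat) \<tau>. if \<tau> \<in> S then 1 else 0 :: real"
    have zero: "?\<phi> n \<tau> - ?\<phi> n \<tau>' = 0" if "\<tau> \<in> S" "\<tau>' \<in> S" for n \<tau> \<tau>' using that by simp
    show ?thesis
    proof (rule kernel_trivial_by_cutoffs[OF f(1) _ f(2), where \<phi> = ?\<phi> and \<epsilon> = "\<lambda>_. 0"])
      show "?\<phi> n \<in> fin_cochains S" for n
        using True by (auto simp: fin_cochains_def cochains_def)
    qed (auto simp: faces_def cofaces_def intro!: sum_nonpos)
  next
    case False
    then have ne: "{} \<notin> S" using finite_or_no_empty by blast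
    interpret Metric_space "vertices S" "deg_dist S" by (rule ms)
    obtain \<tau>0 where "\<tau>0 \<in> S" using False by (metis finite.emptyI ex_in_conv)
    then obtain b where b: "b \<in> vertices S" using ne vertex_of by (metis ex_in_conv)
    obtain d where d: "\<And>\<tau>. \<tau> \<in> S \<Longrightarrow> card \<tau> \<le> d" using card_bound by blast
    define R where "R n = real (Suc n)" for n
    have R: "R n > 0" for n by (simp add: R_def)
    \<comment> \<open>A tent of height 1 around \<open>b\<close> with Lipschitz constant
      \<open>1 / R n\<close>: it vanishes outside the ball of radius \<open>R n\<close> and tends to
      1 pointwise.\<close>
    define \<psi> where "\<psi> n v = max 0 (1 - deg_dist S b v / R n)" for n v
    define pick where "pick \<tau> = (SOME v. v \<in> \<tau>)" for \<tau> :: "'v set"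
    define \<phi> where "\<phi> n \<tau> = (if \<tau> \<in> S then \<psi> n (pick \<tau>) else 0)" for n \<tau>
    have pick: "pick \<tau> \<in> \<tau>" if "\<tau> \<in> S" for \<tau>
      using that ne unfolding pick_def by (metis ex_in_conv someI_ex)
    have lip: "\<bar>\<psi> n v - \<psi> n w\<bar> \<le> deg_dist S v w / R n" if "v \<in> vertices S" "w \<in> vertices S" for n v w
    proof -
      have "\<bar>deg_dist S b v - deg_dist S b w\<bar> \<le> deg_dist S v w"
        using triangle[OF b that] triangle[OF b that(2,1)] commute[of v w] by linarith
      then have "\<bar>deg_dist S b v / R n - deg_dist S b w / R n\<bar> \<le> deg_dist S v w / R n"
        using R[of n] by (simp add: diff_divide_distrib[symmetric] divide_right_mono)
      then show ?thesis unfolding \<psi>_def by linarith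
    qed
    \<comment> \<open>Both chosen vertices lie within \<open>deg v powr (-1/2)\<close> of the common
      vertex \<open>v\<close>, so their distance is at most twice that; squaring gives the
      4.\<close>
    have near: "(\<phi> n \<tau> - \<phi> n \<tau>')\<^sup>2 \<le> 4 / (R n)\<^sup>2 * (real (deg S v) powr (-1/2))\<^sup>2"
      if \<tau>: "\<tau> \<in> S" "\<tau>' \<in> S" and \<sigma>: "\<sigma> \<in> S" "v \<in> \<sigma>" "\<tau> \<subseteq> \<sigma>" and \<sigma>': "\<sigma>' \<in> S" "v \<in> \<sigma>'" "\<tau>' \<subseteq> \<sigma>'"
      for n \<tau> \<tau>' \<sigma> \<sigma>' v
    proof -
      let ?h = "real (deg S v) powr (-1/2)"
      have V: "v \<in> vertices S" "pick \<tau> \<in> vertices S" "pick \<tau>' \<in> vertices S"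
        using vertex_of[OF \<sigma>(1,2)] vertex_of[OF \<tau>(1) pick[OF \<tau>(1)]] vertex_of[OF \<tau>(2) pick[OF \<tau>(2)]]
        by auto
      have "deg_dist S v (pick \<tau>) \<le> ?h" "deg_dist S v (pick \<tau>') \<le> ?h"
        using deg_dist_in_simplex[OF ms \<sigma>(1,2) subsetD[OF \<sigma>(3) pick[OF \<tau>(1)]]]
          deg_dist_in_simplex[OF ms \<sigma>'(1,2) subsetD[OF \<sigma>'(3) pick[OF \<tau>(2)]]] by auto
      then have "deg_dist S (pick \<tau>) (pick \<tau>') \<le> 2 * ?h"
        using triangle[OF V(2,1,3)] commute[of v "pick \<tau>"] by simp
      then have "deg_dist S (pick \<tau>) (pick \<tau>') / R n \<le> 2 * ?h / R n"
        using R[of n] by (intro divide_right_mono) auto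
      then have "\<bar>\<phi> n \<tau> - \<phi> n \<tau>'\<bar> \<le> 2 * ?h / R n"
        using lip[OF V(2,3), of n] \<tau> by (simp add: \<phi>_def)
      then have "\<bar>\<phi> n \<tau> - \<phi> n \<tau>'\<bar>\<^sup>2 \<le> (2 * ?h / R n)\<^sup>2" by (rule power_mono) simp
      then show ?thesis by (simp add: power_divide power_mult_distrib)
    qed
    have count: "real (deg S v) * (real d * (4 / (R n)\<^sup>2 * (real (deg S v) powr (-1/2))\<^sup>2))
        \<le> 4 * real d / (R n)\<^sup>2" for n v
    proof -
      have "4 * real d / (R n)\<^sup>2 * (real (deg S v) * (real (deg S v) powr (-1/2))\<^sup>2) \<le> 4 * real d / (R n)\<^sup>2 * 1"
        by (intro mult_left_mono deg_mult_powr_le) auto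
      then show ?thesis by (simp add: mult_ac)
    qed
    show ?thesis
    proof (rule kernel_trivial_by_cutoffs[OF f(1) _ f(2), where \<phi> = \<phi> and \<epsilon> = "\<lambda>n. 4 * real d / (R n)\<^sup>2"])
      show "\<phi> n \<in> fin_cochains S" for n
      proof -
        let ?B = "{v \<in> vertices S. deg_dist S b v < R n}"
        have "{\<tau>. \<phi> n \<tau> \<noteq> 0} \<subseteq> (\<Union>v\<in>?B. {\<tau>\<in>S. v \<in> \<tau>})"
        proof
          fix \<tau> assume "\<tau> \<in> {\<tau>. \<phi> n \<tau> \<noteq> 0}"
          then have \<tau>: "\<tau> \<in> S" "\<psi> n (pick \<tau>) \<noteq> 0" by (auto simp: \<phi>_def split: if_splits)
          then have "deg_dist S b (pick \<tau>) / R n < 1" unfolding \<psi>_def by linarith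
          then have "deg_dist S b (pick \<tau>) < R n" using R[of n] by (simp add: field_simps)
          then show "\<tau> \<in> (\<Union>v\<in>?B. {\<tau>\<in>S. v \<in> \<tau>})"
            using \<tau> pick[OF \<tau>(1)] vertex_of[OF \<tau>(1)] by blast
        qed
        moreover have "finite (\<Union>v\<in>?B. {\<tau>\<in>S. v \<in> \<tau>})"
          using finite_metric_ball[OF conn ms complete b] finite_star by blast
        ultimately have "finite {\<tau>. \<phi> n \<tau> \<noteq> 0}" by (rule finite_subset)
        then show ?thesis by (auto simp: fin_cochains_def cochains_def \<phi>_def)
      qed
      fix \<tau> assume \<tau>: "\<tau> \<in> S"
      have "(\<lambda>n. max 0 (1 - deg_dist S b (pick \<tau>) * (1 / real (Suc n)))) \<longlonglongrightarrow> max 0 (1 - deg_dist S b (pick \<tau>) * 0)"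
        by (intro tendsto_intros LIMSEQ_Suc[OF lim_1_over_n])
      then show "(\<lambda>n. \<phi> n \<tau>) \<longlonglongrightarrow> 1" using \<tau> by (simp add: \<phi>_def \<psi>_def R_def)
      fix n
      \<comment> \<open>For the sum through cofaces one vertex of \<open>\<tau>\<close> serves all
        terms, since every coface contains it: there are at most \<open>deg S v\<close> cofaces with
        at most \<open>d\<close> faces each.\<close>
      obtain v where v: "v \<in> \<tau>" using pick[OF \<tau>] by blast
      let ?q = "\<lambda>v. 4 / (R n)\<^sup>2 * (real (deg S v) powr (-1/2))\<^sup>2"
      have "(\<Sum>\<sigma>\<in>cofaces S \<tau>. \<Sum>\<tau>'\<in>faces S \<sigma>. (\<phi> n \<tau> - \<phi> n \<tau>')\<^sup>2) \<le> (\<Sum>\<sigma>\<in>cofaces S \<tau>. real d * ?q v)"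
      proof (rule sum_mono)
        fix \<sigma> assume "\<sigma> \<in> cofaces S \<tau>"
        then have \<sigma>: "\<sigma> \<in> S" "\<tau> \<subseteq> \<sigma>" by (auto simp: cofaces_def covered_def)
        have "(\<Sum>\<tau>'\<in>faces S \<sigma>. (\<phi> n \<tau> - \<phi> n \<tau>')\<^sup>2) \<le> (\<Sum>\<tau>'\<in>faces S \<sigma>. ?q v)"
        proof (rule sum_mono)
          fix \<tau>' assume "\<tau>' \<in> faces S \<sigma>"
          then have "\<tau>' \<in> S" "\<tau>' \<subseteq> \<sigma>" by (auto simp: faces_def covered_def)
          with \<sigma> v show "(\<phi> n \<tau> - \<phi> n \<tau>')\<^sup>2 \<le> ?q v"
            by (intro near[OF \<tau> _ \<sigma>(1) _ \<sigma>(2) \<sigma>(1)]) auto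
        qed
        also have "\<dots> \<le> real d * ?q v"
          using card_faces_le[OF \<sigma>(1)] d[OF \<sigma>(1)] unfolding sum_constant
          by (intro mult_right_mono) auto
        finally show "(\<Sum>\<tau>'\<in>faces S \<sigma>. (\<phi> n \<tau> - \<phi> n \<tau>')\<^sup>2) \<le> real d * ?q v" .
      qed
      also have "\<dots> \<le> real (deg S v) * (real d * ?q v)"
        using card_cofaces_le_deg[OF \<tau> v] unfolding sum_constant by (intro mult_right_mono) auto
      also have "\<dots> \<le> 4 * real d / (R n)\<^sup>2" by (rule count)
      finally show "(\<Sum>\<sigma>\<in>cofaces S \<tau>. \<Sum>\<tau>'\<in>faces S \<sigma>. (\<phi> n \<tau> - \<phi> n \<tau>')\<^sup>2) \<le> 4 * real d / (R n)\<^sup>2" .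
      have "(\<Sum>\<rho>\<in>faces S \<tau>. \<Sum>\<tau>'\<in>cofaces S \<rho>. (\<phi> n \<tau> - \<phi> n \<tau>')\<^sup>2) \<le> (\<Sum>\<rho>\<in>faces S \<tau>. 4 / (R n)\<^sup>2)"
      proof (rule sum_mono)
        fix \<rho> assume "\<rho> \<in> faces S \<tau>"
        then have \<rho>: "\<rho> \<in> S" "\<rho> \<subseteq> \<tau>" by (auto simp: faces_def covered_def)
        \<comment> \<open>For the sum through faces the common vertex has to lie in
          \<open>\<rho>\<close> and so varies with it; summing over the at most \<open>d\<close>
          faces gives the same bound.\<close>
        let ?w = "pick \<rho>"
        have w: "?w \<in> \<rho>" by (rule pick[OF \<rho>(1)])
        have "(\<Sum>\<tau>'\<in>cofaces S \<rho>. (\<phi> n \<tau> - \<phi> n \<tau>')\<^sup>2) \<le> (\<Sum>\<tau>'\<in>cofaces S \<rho>. ?q ?w)"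
        proof (rule sum_mono)
          fix \<tau>' assume "\<tau>' \<in> cofaces S \<rho>"
          then have "\<tau>' \<in> S" "\<rho> \<subseteq> \<tau>'" by (auto simp: cofaces_def covered_def)
          with \<rho> w show "(\<phi> n \<tau> - \<phi> n \<tau>')\<^sup>2 \<le> ?q ?w"
            by (intro near[OF \<tau> _ \<tau>, of \<tau>' _ \<tau>']) auto
        qed
        also have "\<dots> \<le> real (deg S ?w) * ?q ?w"
          using card_cofaces_le_deg[OF \<rho>(1) w] unfolding sum_constant by (intro mult_right_mono) auto
        also have "\<dots> = 4 / (R n)\<^sup>2 * (real (deg S ?w) * (real (deg S ?w) powr (-1/2))\<^sup>2)"
          by (simp add: mult_ac)
        also have "\<dots> \<le> 4 / (R n)\<^sup>2 * 1"
          by (intro mult_left_mono deg_mult_powr_le) auto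
        finally show "(\<Sum>\<tau>'\<in>cofaces S \<rho>. (\<phi> n \<tau> - \<phi> n \<tau>')\<^sup>2) \<le> 4 / (R n)\<^sup>2" by simp
      qed
      also have "\<dots> \<le> real d * (4 / (R n)\<^sup>2)"
        using card_faces_le[OF \<tau>] d[OF \<tau>] unfolding sum_constant by (intro mult_right_mono) auto
      finally show "(\<Sum>\<rho>\<in>faces S \<tau>. \<Sum>\<tau>'\<in>cofaces S \<rho>. (\<phi> n \<tau> - \<phi> n \<tau>')\<^sup>2) \<le> 4 * real d / (R n)\<^sup>2"
        by (simp add: mult.commute)
    next
      have "(\<lambda>n. 4 * real d * (1 / real (Suc n))\<^sup>2) \<longlonglongrightarrow> 4 * real d * 0\<^sup>2"
        by (intro tendsto_intros LIMSEQ_Suc[OF lim_1_over_n])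
      then show "(\<lambda>n. 4 * real d / (R n)\<^sup>2) \<longlonglongrightarrow> 0" by (simp add: R_def power_divide)
    qed simp
  qed
qed simp

end

theorem theorem6p1:
  fixes V :: "'v set" and K S :: "'v set set"
    and \<delta> :: "('v set \<Rightarrow> real) \<Rightarrow> 'v set \<Rightarrow> real"
    and \<Delta> :: "lap_kind \<Rightarrow> 'v l2_op"
  assumes complex: "abstract_simplicial_complex V K"
    and S_def: "S = simplices K"
    and conn: "connected_complex S"
    and findim: "finite_dimensional K"
    and locsum: "locally_summable S"
    and cobd: "coboundary S \<delta>"
    and lap: "\<And>k. is_laplacian S \<delta> k (\<Delta> k)"
  shows "\<forall>k.
      (bounded_op S (\<Delta> k) \<longleftrightarrow> bdd_above (deg S ` vertices S)) \<and>
      fin_cochains S \<subseteq> Domain (\<Delta> k) \<and>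
      (bdd_below (forman S ` S) \<longrightarrow> essentially_self_adjoint S (restrict_fin S (\<Delta> k))) \<and>
      (Metric_space (vertices S) (deg_dist S) \<and> Metric_space.mcomplete (vertices S) (deg_dist S)
         \<longrightarrow> essentially_self_adjoint S (restrict_fin S (\<Delta> k)))"
proof
  fix k
  interpret unit_weight_complex V K S \<delta> by unfold_locales fact+
  obtain Q where Q: "matrix_form S (ent k) Q" and \<Delta>: "\<Delta> k = form_operator S Q"
    by (rule laplacian_matrix_form[OF lap])
  interpret matrix_form S "ent k" Q by (rule Q)
  have "bounded_op S (\<Delta> k) \<longleftrightarrow> bdd_above (deg S ` vertices S)"
  proof
    assume "bounded_op S (\<Delta> k)"
    then obtain C where
      "\<And>u. u \<in> fin_cochains S \<Longrightarrow> (l2_norm S (mat_op (ent k) u))\<^sup>2 \<le> C * (l2_norm S u)\<^sup>2"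
      using bounded_imp_form_bounded unfolding \<Delta> by blast
    then show "bdd_above (deg S ` vertices S)" by (rule form_bounded_imp_deg_bounded)
  next
    assume "bdd_above (deg S ` vertices S)"
    then obtain C where "C \<ge> 0"
      "\<And>f. f \<in> l2 S \<Longrightarrow> (l2_norm S (mat_op (ent k) f))\<^sup>2 \<le> C\<^sup>2 * (l2_norm S f)\<^sup>2"
      using deg_bounded_imp_form_bounded by blast
    then show "bounded_op S (\<Delta> k)" unfolding \<Delta> by (rule form_bounded_imp_bounded)
  qed
  then show "(bounded_op S (\<Delta> k) \<longleftrightarrow> bdd_above (deg S ` vertices S)) \<and>
      fin_cochains S \<subseteq> Domain (\<Delta> k) \<and>
      (bdd_below (forman S ` S) \<longrightarrow> essentially_self_adjoint S (restrict_fin S (\<Delta> k))) \<and>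
      (Metric_space (vertices S) (deg_dist S) \<and> Metric_space.mcomplete (vertices S) (deg_dist S)
         \<longrightarrow> essentially_self_adjoint S (restrict_fin S (\<Delta> k)))"
    using fin_cochains_in_domain essentially_self_adjoint_forman[OF lap[of k]]
      essentially_self_adjoint_complete[OF lap[of k] conn] unfolding \<Delta> by simp
qed

end
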